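(* Consider instances $(G,f)$ of $[\{2,3\},3]$-CH in which $G$ is bipartite, and say that $v$ has a 2-list if $f(v)=2$ (all other vertices have $f(v)=3$). (i) $[\{2,3\},3]$-CH restricted to those instances with $G$ bipartite in which exactly 6 vertices have 2-lists and these 6 vertices induce a cycle $C_6$ is NP-complete. (ii) $[\{2,3\},3]$-CH restricted to those instances with $G$ bipartite in which exactly 6 vertices have 2-lists and these 6 vertices do not induce a $C_6$ is solvable in polynomial time. (iii) If $G$ is bipartite and at most 5 vertices have 2-lists (all others having $f(v)=3$), then $G$ is $[f,3]$-choosable.
   Context: All graphs are finite and simple. Given a graph $G=(V,E)$, a function $f:V\to\mathbb N$ and an integer $k\ge\max_v f(v)$, $G$ is $[f,k]$-choosable if for every assignment of lists $L(v)\subseteq\{1,\dots,k\}$ with $|L(v)|=f(v)$ for all $v$, there is a proper coloring $c$ of $G$ with $c(v)\in L(v)$ for all $v$. $[\{2,3\},3]$-CH is the decision problem: given a graph $G$ and a function $f:V(G)\to\{2,3\}$, decide whether $G$ is $[f,3]$-choosable. $C_6$ is the cycle on 6 vertices. *)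

theory Defs
  imports "HOL-Computational_Algebra.Polynomial"
begin

section \<open>Deterministic multitape Turing machines\<close>

text \<open>
  States and tape symbols are initial segments of the natural numbers.
  State 0 is initial; states 1 (accept) and 2 (reject) are halting.
  Symbol 0 is the blank, symbols 1 and 2 are the input bits; a machine may use further symbols.
  Tapes are infinite in both directions.
  The transition function is only ever consulted on states, and on tuples of scanned symbols,
  within the bounds of the machine, so a machine is a finite object.
\<close>

type_synonym word = "bool list"
type_synonym language = "word set"
type_synonym tape = "(int \<Rightarrow> nat) \<times> int"
type_synonym config = "nat \<times> tape list"

datatype dir = MoveL | Stay | MoveR

fun offset :: "dir \<Rightarrow> int" where
  "offset MoveL = -1"
| "offset Stay = 0"
| "offset MoveR = 1"

record tm =
  num_tapes :: nat
  num_states :: nat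
  num_syms :: nat
  delta :: "nat \<Rightarrow> nat list \<Rightarrow> nat \<times> (nat \<times> dir) list"

definition wf_tm :: "tm \<Rightarrow> bool" where
  "wf_tm M \<longleftrightarrow> num_tapes M \<ge> 1 \<and> num_states M \<ge> 3 \<and> num_syms M \<ge> 3 \<and>
    (\<forall>q < num_states M. \<forall>ss. length ss = num_tapes M \<and> set ss \<subseteq> {..<num_syms M} \<longrightarrow>
      (let (q', as) = delta M q ss in
        q' < num_states M \<and> length as = num_tapes M \<and> (\<forall>(b, d) \<in> set as. b < num_syms M)))"

fun act :: "tape \<Rightarrow> nat \<times> dir \<Rightarrow> tape" where
  "act (t, h) (b, d) = (t(h := b), h + offset d)"

definition halting :: "nat \<Rightarrow> bool" where
  "halting q \<longleftrightarrow> q = 1 \<or> q = 2"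

text \<open>Halting configurations are fixed points, so that having halted within a number of steps is
  the same as being in a halting state after exactly that number of steps.\<close>

fun step :: "tm \<Rightarrow> config \<Rightarrow> config" where
  "step M (q, ts) =
    (if halting q then (q, ts)
     else let (q', as) = delta M q (map (\<lambda>(t, h). t h) ts) in (q', map2 act ts as))"

definition bit_sym :: "bool \<Rightarrow> nat" where
  "bit_sym b = (if b then 2 else 1)"

definition word_tape :: "word \<Rightarrow> tape" where
  "word_tape w = (\<lambda>i. if 0 \<le> i \<and> i < int (length w) then bit_sym (w ! nat i) else 0, 0)"

text \<open>A machine may receive several words, each on its own tape; the other tapes are blank.\<close>

definition init_config :: "tm \<Rightarrow> word list \<Rightarrow> config" where
  "init_config M ws =
    (0, map (\<lambda>i. word_tape (if i < length ws then ws ! i else [])) [0..<num_tapes M])"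

definition run :: "tm \<Rightarrow> word list \<Rightarrow> nat \<Rightarrow> config" where
  "run M ws t = (step M ^^ t) (init_config M ws)"

definition tape_output :: "tape \<Rightarrow> word \<Rightarrow> bool" where
  "tape_output tp w \<longleftrightarrow> (case tp of (t, h) \<Rightarrow>
    (\<forall>i < length w. t (h + int i) = bit_sym (w ! i)) \<and> t (h + int (length w)) = 0)"

section \<open>Polynomial time, NP and NP-completeness\<close>

definition ptime_decidable :: "nat \<Rightarrow> word list set \<Rightarrow> bool" where
  "ptime_decidable k A \<longleftrightarrow> (\<exists>M (p :: nat poly). wf_tm M \<and> k \<le> num_tapes M \<and>
    (\<forall>ws. length ws = k \<longrightarrow>
      fst (run M ws (poly p (sum_list (map length ws)))) = (if ws \<in> A then 1 else 2)))"

definition in_P :: "language \<Rightarrow> bool" where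
  "in_P L \<longleftrightarrow> ptime_decidable 1 {[x] | x. x \<in> L}"

text \<open>NP via polynomial-time verifiers and certificates of polynomially bounded length;
  the certificate is given to the verifier on a separate tape.\<close>

definition in_NP :: "language \<Rightarrow> bool" where
  "in_NP L \<longleftrightarrow> (\<exists>(R :: (word \<times> word) set) (q :: nat poly).
    ptime_decidable 2 {[x, y] | x y. (x, y) \<in> R} \<and>
    (\<forall>x. x \<in> L \<longleftrightarrow> (\<exists>y. length y \<le> poly q (length x) \<and> (x, y) \<in> R)))"

text \<open>The input and the output are on the first tape.\<close>

definition ptime_computable :: "(word \<Rightarrow> word) \<Rightarrow> bool" where
  "ptime_computable g \<longleftrightarrow> (\<exists>M (p :: nat poly). wf_tm M \<and>
    (\<forall>x. let (q, ts) = run M [x] (poly p (length x)) in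
      halting q \<and> tape_output (ts ! 0) (g x)))"

definition ptime_reducible :: "language \<Rightarrow> language \<Rightarrow> bool" where
  "ptime_reducible L L' \<longleftrightarrow> (\<exists>g. ptime_computable g \<and> (\<forall>x. x \<in> L \<longleftrightarrow> g x \<in> L'))"

definition NP_hard :: "language \<Rightarrow> bool" where
  "NP_hard L \<longleftrightarrow> (\<forall>L'. in_NP L' \<longrightarrow> ptime_reducible L' L)"

definition NP_complete :: "language \<Rightarrow> bool" where
  "NP_complete L \<longleftrightarrow> in_NP L \<and> NP_hard L"

section \<open>Graphs and list colorings\<close>

definition simple_graph :: "'a set \<Rightarrow> 'a set set \<Rightarrow> bool" where
  "simple_graph V E \<longleftrightarrow> finite V \<and> (\<forall>e \<in> E. e \<subseteq> V \<and> card e = 2)"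

definition bipartite :: "'a set \<Rightarrow> 'a set set \<Rightarrow> bool" where
  "bipartite V E \<longleftrightarrow>
    (\<exists>A B. A \<union> B = V \<and> A \<inter> B = {} \<and> (\<forall>e \<in> E. \<exists>a \<in> A. \<exists>b \<in> B. e = {a, b}))"

definition induced_edges :: "'a set set \<Rightarrow> 'a set \<Rightarrow> 'a set set" where
  "induced_edges E S = {e \<in> E. e \<subseteq> S}"

definition graph_iso :: "'a set \<Rightarrow> 'a set set \<Rightarrow> 'b set \<Rightarrow> 'b set set \<Rightarrow> bool" where
  "graph_iso V E V' E' \<longleftrightarrow> (\<exists>\<phi>. bij_betw \<phi> V V' \<and> (\<lambda>e. \<phi> ` e) ` E = E')"

definition cycle_edges :: "nat \<Rightarrow> nat set set" where
  "cycle_edges n = {{i, (i + 1) mod n} | i. i < n}"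

definition induces_C6 :: "'a set set \<Rightarrow> 'a set \<Rightarrow> bool" where
  "induces_C6 E S \<longleftrightarrow> graph_iso S (induced_edges E S) {..<6::nat} (cycle_edges 6)"

definition proper_coloring :: "'a set set \<Rightarrow> ('a \<Rightarrow> nat) \<Rightarrow> bool" where
  "proper_coloring E c \<longleftrightarrow> (\<forall>u v. {u, v} \<in> E \<longrightarrow> c u \<noteq> c v)"

definition choosable :: "'a set \<Rightarrow> 'a set set \<Rightarrow> ('a \<Rightarrow> nat) \<Rightarrow> nat \<Rightarrow> bool" where
  "choosable V E f k \<longleftrightarrow>
    (\<forall>L :: 'a \<Rightarrow> nat set. (\<forall>v \<in> V. L v \<subseteq> {1..k} \<and> card (L v) = f v) \<longrightarrow>
      (\<exists>c. proper_coloring E c \<and> (\<forall>v \<in> V. c v \<in> L v)))"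

definition two_list_vertices :: "'a set \<Rightarrow> ('a \<Rightarrow> nat) \<Rightarrow> 'a set" where
  "two_list_vertices V f = {v \<in> V. f v = 2}"

definition CH23_instance :: "'a set \<Rightarrow> 'a set set \<Rightarrow> ('a \<Rightarrow> nat) \<Rightarrow> bool" where
  "CH23_instance V E f \<longleftrightarrow> simple_graph V E \<and> (\<forall>v \<in> V. f v \<in> {2, 3})"

section \<open>The decision problem as a language\<close>

text \<open>An instance on the vertex set \<open>{..<n}\<close> is encoded by \<open>n\<close> in unary,
  one bit per vertex telling whether \<open>f v\<close> is 3 rather than 2, and the adjacency matrix by rows.\<close>

definition encode :: "nat \<Rightarrow> nat set set \<Rightarrow> (nat \<Rightarrow> nat) \<Rightarrow> word" where
  "encode n E f =
    replicate n True @ [False] @ map (\<lambda>v. f v = 3) [0..<n] @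
    concat (map (\<lambda>u. map (\<lambda>v. {u, v} \<in> E) [0..<n]) [0..<n])"

text \<open>The problem restricted to the instances satisfying \<open>C\<close>: as usual, the language consists of the
  codes of the yes-instances, and words that do not encode an admissible instance are not in it.\<close>

definition CH23_restricted ::
  "(nat set \<Rightarrow> nat set set \<Rightarrow> (nat \<Rightarrow> nat) \<Rightarrow> bool) \<Rightarrow> language" where
  "CH23_restricted C = {encode n E f | n E f.
    CH23_instance {..<n} E f \<and> C {..<n} E f \<and> choosable {..<n} E f 3}"

end

theory Submission
  imports Defs
begin

text \<open>
  A list of size 2 is a missing colour. If some colour is missing from no vertex on one side, colour that
  side by it; so an obstruction needs vertices missing 1, 2, 3 on both sides, hence six of them, and a
  short recolouring shows that those missing different colours must be adjacent. Thus six 2-lists without a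
  spanning hexagon are always choosable, a hexagon with a chord never is, and for an induced hexagon a
  single assignment of lists matters, in which opposite vertices miss the same colour. It forces
  the hexagon to be coloured with all three colours on both sides, so that its vertices serve as
  reference colours on both sides and every list can be imposed. Satisfiability of CNF formulas then reduces
  to the colouring problem, by gadgets that forbid an unordered pair of colours on two vertices.

  For the Turing machines, every predicate on words and numbers that is definable with addition,
  multiplication and bounded quantifiers is compiled to a polynomial-time machine. The
  CNF formula of an NP computation, the graph built from it and the verifiers are all definable; only
  bipartiteness needs an additional iteration.
\<close>

section \<open>Stack programs and their machines\<close>

text \<open>Choosability quantifies over list assignments and then over colourings, so even
  membership in NP is not evident. Rigidity removes the outer quantifier: all assignments that can
  fail on an induced hexagon agree up to renaming colours, so one colouring for one of them is a
  certificate. With these lists a colour at one vertex propagates around the hexagon, which leaves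
  two colourings; both give opposite vertices equal colours, and opposite vertices lie on different
  sides.

  A gadget vertex next to one reference colour keeps two colours, so its other two neighbours cannot
  carry these two, in whichever order. Therefore a clause is read along a path that may not start
  with the second colour, may not end with the first, and may not pass directly between them; so the
  third colour must occur and can mark a true literal.

  \<open>NP_hard\<close> speaks about all languages in NP and about concrete machines, so the step
  from computations to formulas is carried out as well. Unary counters suffice, because the values
  in a fixed bounded formula are polynomial in the input size.\<close>

datatype cmd =
    Skip
  | Push nat bool
  | Write nat bool
  | Pop nat
  | Seq cmd cmd (infixr ";;" 60)
  | Case nat cmd cmd cmd
  | While nat cmd

type_synonym store = "nat \<Rightarrow> word"

text \<open>The step counts are exactly those of \<open>micro\<close> below: pushing takes two,
  because the head moves and writes in separate steps. \<open>Write\<close> has no rule, since it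
  only arises as the second half of a \<open>Push\<close>.\<close>

inductive big :: "cmd \<Rightarrow> store \<Rightarrow> nat \<Rightarrow> store \<Rightarrow> bool" where
  "big Skip s 1 s"
| "big (Push r b) s 2 (s(r := b # s r))"
| "big (Pop r) s 1 (s(r := tl (s r)))"
| "big a s t s' \<Longrightarrow> big b s' t' s'' \<Longrightarrow> big (a ;; b) s (Suc (t + t')) s''"
| "s r = [] \<Longrightarrow> big a s t s' \<Longrightarrow> big (Case r a b c) s (Suc t) s'"
| "s r = False # w \<Longrightarrow> big b s t s' \<Longrightarrow> big (Case r a b c) s (Suc t) s'"
| "s r = True # w \<Longrightarrow> big c s t s' \<Longrightarrow> big (Case r a b c) s (Suc t) s'"
| "s r = [] \<Longrightarrow> big (While r a) s 1 s"
| "s r \<noteq> [] \<Longrightarrow> big a s t s' \<Longrightarrow> big (While r a) s' t' s'' \<Longrightarrow>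
    big (While r a) s (Suc (t + t')) s''"

fun regs :: "cmd \<Rightarrow> nat set" where
  "regs Skip = {}"
| "regs (Push r b) = {r}"
| "regs (Write r b) = {r}"
| "regs (Pop r) = {r}"
| "regs (a ;; b) = regs a \<union> regs b"
| "regs (Case r a b c) = insert r (regs a \<union> regs b \<union> regs c)"
| "regs (While r a) = insert r (regs a)"

lemma finite_regs: "finite (regs c)"
  by (induction c) auto

section \<open>Control flow by continuations\<close>

definition keep :: "nat list \<Rightarrow> (nat \<times> dir) list" where
  "keep ss = map (\<lambda>a. (a, Stay)) ss"

text \<open>The control is the list of commands still to be executed, and each equation is one
  machine step. On an empty tape \<open>Pop\<close> stays put, matching
  \<open>tl [] = []\<close>.\<close>

fun nxt :: "cmd list \<Rightarrow> nat list \<Rightarrow> cmd list \<times> (nat \<times> dir) list" where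
  "nxt [] ss = ([], keep ss)"
| "nxt (Skip # k) ss = (k, keep ss)"
| "nxt (Push r b # k) ss = (Write r b # k, (keep ss)[r := (ss ! r, MoveL)])"
| "nxt (Write r b # k) ss = (k, (keep ss)[r := (bit_sym b, Stay)])"
| "nxt (Pop r # k) ss = (k, (keep ss)[r := (ss ! r, if ss ! r = 0 then Stay else MoveR)])"
| "nxt ((a ;; b) # k) ss = (a # b # k, keep ss)"
| "nxt (Case r a b c # k) ss =
    ((if ss ! r = 0 then a else if ss ! r = 1 then b else c) # k, keep ss)"
| "nxt (While r a # k) ss = (if ss ! r = 0 then k else a # While r a # k, keep ss)"

text \<open>A loop returns to a continuation already listed; hence a program has only finitely many
  of them.\<close>

fun conts :: "cmd \<Rightarrow> cmd list \<Rightarrow> cmd list set" where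
  "conts (Push r b) k = {Push r b # k, Write r b # k}"
| "conts (a ;; b) k = insert ((a ;; b) # k) (conts a (b # k) \<union> conts b k)"
| "conts (Case r a b c) k = insert (Case r a b c # k) (conts a k \<union> conts b k \<union> conts c k)"
| "conts (While r a) k = insert (While r a # k) (conts a (While r a # k))"
| "conts c k = {c # k}"

lemma finite_conts: "finite (conts c k)"
  by (induction c k rule: conts.induct) auto

lemma conts_self: "c # k \<in> conts c k"
  by (cases c) auto

lemma conts_closed: "l \<in> conts c k \<Longrightarrow> fst (nxt l ss) \<in> insert k (conts c k)"
proof (induction c k arbitrary: l rule: conts.induct)
  case (2 a b k)
  consider "l = (a ;; b) # k" | "l \<in> conts a (b # k)" | "l \<in> conts b k" using 2(3) by auto
  then show ?case
    by cases (use conts_self[of a "b # k"] conts_self[of b k] 2(1,2)[of l] in force)+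
next
  case (3 r a b c k)
  then show ?case
    using conts_self[of a k] conts_self[of b k] conts_self[of c k] by auto
next
  case (4 r a k)
  then show ?case using conts_self[of a "While r a # k"] by (auto split: if_splits)
qed auto

lemma keep_simps [simp]: "length (keep ss) = length ss"
  "i < length ss \<Longrightarrow> keep ss ! i = (ss ! i, Stay)"
  by (auto simp: keep_def)

lemma length_nxt [simp]: "length (snd (nxt l ss)) = length ss"
  by (induction l ss rule: nxt.induct) auto

lemma nth_list_update_if: "i < length xs \<Longrightarrow> xs[r := a] ! i = (if r = i then a else xs ! i)"
  by auto

lemma nxt_syms:
  assumes "set ss \<subseteq> {..<3}" "i < length ss"
  shows "fst (snd (nxt l ss) ! i) < 3"
proof -
  have "ss ! i < 3" using assms by (auto simp: subset_iff)
  then show ?thesis using assms(2)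
    by (induction l ss rule: nxt.induct) (auto simp: nth_list_update_if bit_sym_def)
qed

definition micro :: "cmd list \<times> tape list \<Rightarrow> cmd list \<times> tape list" where
  "micro = (\<lambda>(l, ts). let (l', as) = nxt l (map (\<lambda>(t, h). t h) ts) in (l', map2 act ts as))"

text \<open>A stack occupies its tape from the head to the right, up to the first blank. The part
  left of the head is unconstrained, so popped symbols need not be erased.\<close>

definition rep :: "nat \<Rightarrow> store \<Rightarrow> tape list \<Rightarrow> bool" where
  "rep K s ts \<longleftrightarrow> length ts = K \<and> (\<forall>r < K. tape_output (ts ! r) (s r))"

lemma map2_act_keep: "map2 act ts (keep (map (\<lambda>(t, h). t h) ts)) = ts"
  by (rule nth_equalityI) (auto simp: split: prod.splits)

lemma map2_act_update:
  assumes "r < length ts"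
  shows "map2 act ts ((keep (map (\<lambda>(t, h). t h) ts))[r := a]) = ts[r := act (ts ! r) a]"
  using assms
  by (intro nth_equalityI) (auto simp: nth_list_update split: prod.splits)

lemma rep_scan:
  assumes "rep K s ts" "r < K"
  shows "map (\<lambda>(t, h). t h) ts ! r = (case s r of [] \<Rightarrow> 0 | b # _ \<Rightarrow> bit_sym b)"
  using assms unfolding rep_def tape_output_def
  by (cases "ts ! r"; cases "s r") force+

lemma rep_update:
  assumes "rep K s ts" "tape_output tp w"
  shows "rep K (s(r := w)) (ts[r := tp])"
  using assms by (auto simp: rep_def nth_list_update)

lemma push_tape:
  assumes "tape_output tp w" "a = fst tp (snd tp)"
  shows "tape_output (act (act tp (a, MoveL)) (bit_sym b, Stay)) (b # w)"
  using assms
  by (cases tp) (auto simp: tape_output_def nth_Cons algebra_simps split: nat.splits)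

lemma pop_tape:
  assumes "tape_output tp w" "a = fst tp (snd tp)"
  shows "tape_output (act tp (a, if w = [] then Stay else MoveR)) (tl w)"
  using assms
  by (cases tp; cases w) (auto simp: tape_output_def nth_Cons algebra_simps dest: spec[of _ "Suc _"])

lemma funpow_Suc': "(f ^^ Suc n) x = (f ^^ n) (f x)"
  by (simp add: funpow_swap1)

text \<open>The continuation \<open>k\<close> is arbitrary, so that the induction passes through
  \<open>Seq\<close>, whose first command is run with continuation \<open>b # k\<close>.\<close>

lemma big_micro:
  assumes "big c s t s'" "regs c \<subseteq> {..<K}" "rep K s ts"
  shows "\<exists>ts'. (micro ^^ t) (c # k, ts) = (k, ts') \<and> rep K s' ts'"
  using assms
proof (induction arbitrary: ts k rule: big.induct)
  case (1 s)
  then show ?case by (auto simp: micro_def map2_act_keep)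
next
  case (2 r b s)
  then have r: "r < length ts" and tp: "tape_output (ts ! r) (s r)" by (auto simp: rep_def)
  let ?a = "map (\<lambda>(t, h). t h) ts ! r"
  have a: "?a = fst (ts ! r) (snd (ts ! r))" using r by (auto split: prod.splits)
  have "(micro ^^ 2) (Push r b # k, ts) =
      (k, ts[r := act (act (ts ! r) (?a, MoveL)) (bit_sym b, Stay)])"
    using r by (simp add: micro_def map2_act_update numeral_2_eq_2 del: nth_map)
  then show ?case using rep_update[OF 2(2) push_tape[OF tp a]] by blast
next
  case (3 r s)
  then have r: "r < length ts" and tp: "tape_output (ts ! r) (s r)" by (auto simp: rep_def)
  let ?a = "map (\<lambda>(t, h). t h) ts ! r"
  have a: "?a = fst (ts ! r) (snd (ts ! r))" using r by (auto split: prod.splits)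
  have "(?a = 0) = (s r = [])"
    using rep_scan[OF 3(2), of r] 3(1) by (auto simp: bit_sym_def split: list.splits)
  then have "(micro ^^ 1) (Pop r # k, ts) =
      (k, ts[r := act (ts ! r) (?a, if s r = [] then Stay else MoveR)])"
    using r by (simp add: micro_def map2_act_update del: nth_map)
  then show ?case using rep_update[OF 3(2) pop_tape[OF tp a]] by blast
next
  case (4 a s t s' b t' s'')
  obtain ts1 where 1: "(micro ^^ t) (a # b # k, ts) = (b # k, ts1)" "rep K s' ts1"
    using 4 by fastforce
  obtain ts2 where 2: "(micro ^^ t') (b # k, ts1) = (k, ts2)" "rep K s'' ts2"
    using 4 1 by fastforce
  have "(micro ^^ Suc (t + t')) ((a ;; b) # k, ts) = (micro ^^ (t' + t)) (a # b # k, ts)"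
    by (simp only: funpow_Suc') (simp add: micro_def map2_act_keep add.commute)
  also have "\<dots> = (k, ts2)" using 1 2 by (simp add: funpow_add)
  finally show ?case using 2 by blast
next
  case (5 s r a t s' b c)
  then have "micro (Case r a b c # k, ts) = (a # k, ts)"
    using rep_scan[OF 5(5), of r] by (simp add: micro_def map2_act_keep del: nth_map)
  then show ?case using 5 by (simp only: funpow_Suc') simp
next
  case (6 s r w b t s' a c)
  then have "micro (Case r a b c # k, ts) = (b # k, ts)"
    using rep_scan[OF 6(5), of r] by (simp add: micro_def map2_act_keep bit_sym_def del: nth_map)
  then show ?case using 6 by (simp only: funpow_Suc') simp
next
  case (7 s r w c t s' a b)
  then have "micro (Case r a b c # k, ts) = (c # k, ts)"
    using rep_scan[OF 7(5), of r] by (simp add: micro_def map2_act_keep bit_sym_def del: nth_map)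
  then show ?case using 7 by (simp only: funpow_Suc') simp
next
  case (8 s r a)
  then have "micro (While r a # k, ts) = (k, ts)"
    using rep_scan[OF 8(3), of r] by (simp add: micro_def map2_act_keep del: nth_map)
  then show ?case using 8 by simp
next
  case (9 s r a t s' t' s'')
  have nz: "map (\<lambda>(t, h). t h) ts ! r \<noteq> 0"
    using rep_scan[OF 9(7), of r] 9(1,6) by (auto simp: bit_sym_def split: list.splits)
  obtain ts1 where 1: "(micro ^^ t) (a # While r a # k, ts) = (While r a # k, ts1)" "rep K s' ts1"
    using 9 by fastforce
  obtain ts2 where 2: "(micro ^^ t') (While r a # k, ts1) = (k, ts2)" "rep K s'' ts2"
    using 9 1 by fastforce
  have "(micro ^^ Suc (t + t')) (While r a # k, ts) = (micro ^^ (t' + t)) (a # While r a # k, ts)"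
    using nz by (simp only: funpow_Suc') (simp add: micro_def map2_act_keep add.commute del: nth_map)
  also have "\<dots> = (k, ts2)" using 1 2 by (simp add: funpow_add)
  finally show ?case using 2 by blast
qed

section \<open>From programs to Turing machines\<close>

lemma run_add: "run M ws (m + n) = (step M ^^ m) (run M ws n)"
  by (simp add: run_def funpow_add)

lemma halting_stable:
  assumes "run M ws t = (q, ts)" "halting q" "t \<le> t'"
  shows "run M ws t' = (q, ts)"
proof -
  have "(step M ^^ m) (q, ts) = (q, ts)" for m using assms(2) by (induction m) auto
  then show ?thesis using run_add[of M ws "t' - t" t] assms by simp
qed

definition init_store :: "word list \<Rightarrow> store" where
  "init_store ws i = (if i < length ws then ws ! i else [])"

definition verdict :: "store \<Rightarrow> bool" where
  "verdict s \<longleftrightarrow> (\<exists>w. s 0 = True # w)"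

text \<open>The two extra steps enter the start continuation and, at the empty continuation, turn
  the top of stack 0 into a halting state.\<close>

definition implements :: "tm \<Rightarrow> cmd \<Rightarrow> bool" where
  "implements M c \<longleftrightarrow> (\<forall>ws t s. big c (init_store ws) t s \<longrightarrow>
    (\<exists>ts. run M ws (t + 2) = (if verdict s then 1 else 2, ts) \<and> tape_output (ts ! 0) (s 0)))"

text \<open>The control states of the machine are the continuations of the program.\<close>

lemma machine_exists: "\<exists>M. wf_tm M \<and> k \<le> num_tapes M \<and> implements M c"
proof -
  define S where "S = insert [] (conts c [])"
  have "finite S" by (simp add: S_def finite_conts)
  then obtain \<beta> where "bij_betw \<beta> S {0..<card S}" using ex_bij_betw_finite_nat by blast
  then have \<beta>: "\<And>l. l \<in> S \<Longrightarrow> \<beta> l < card S"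
    "\<And>l. l \<in> S \<Longrightarrow> inv_into S \<beta> (\<beta> l) = l" "\<And>i. i < card S \<Longrightarrow> inv_into S \<beta> i \<in> S"
    by (auto simp: bij_betw_def intro: inv_into_into)
  have start: "[c] \<in> S" by (auto simp: S_def conts_self)
  have "0 < card S" using \<open>finite S\<close> by (auto simp: S_def card_gt_0_iff)
  have closed: "fst (nxt l ss) \<in> S" if "l \<in> S" for l ss
    using that conts_closed[of l c "[]" ss] by (auto simp: S_def)
  obtain K where K: "regs c \<subseteq> {..<K}" "k \<le> K" "0 < K"
  proof -
    obtain b where "\<forall>r\<in>regs c. r < b" using finite_regs finite_nat_set_iff_bounded by blast
    then show ?thesis using that[of "b + k + 1"] by force
  qed
  \<comment> \<open>The shift by 3 keeps 0 for the start and 1, 2 for acceptance and rejection. The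
    scanned symbol 2 is \<open>bit_sym True\<close>.\<close>
  define D where "D q ss =
    (if q = 0 then (\<beta> [c] + 3, keep ss)
     else let l = inv_into S \<beta> (q - 3) in
       if l = [] then (if ss ! 0 = 2 then 1 else 2, keep ss)
       else (\<beta> (fst (nxt l ss)) + 3, snd (nxt l ss)))" for q ss
  define M where "M = \<lparr>num_tapes = K, num_states = card S + 3, num_syms = 3, delta = D\<rparr>"
  have wf: "wf_tm M"
  proof -
    have "fst (D q ss) < card S + 3 \<and> length (snd (D q ss)) = K \<and>
        (\<forall>i < K. fst (snd (D q ss) ! i) < 3)"
      if "q < card S + 3" "length ss = K" "set ss \<subseteq> {..<3}" for q ss
    proof -
      have "inv_into S \<beta> (q - 3) \<in> S" using \<open>0 < card S\<close> that by (intro \<beta>) auto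
      moreover have "\<forall>i < K. ss ! i < 3" using that by (auto simp: subset_iff)
      ultimately show ?thesis
        using that \<beta>(1)[OF start] \<beta>(1)[OF closed] nxt_syms
        by (auto simp: D_def Let_def)
    qed
    note D = this
    have "case D q ss of (q', as) \<Rightarrow> q' < card S + 3 \<and> length as = K \<and> (\<forall>(b, d)\<in>set as. b < 3)"
      if "q < card S + 3" "length ss = K" "set ss \<subseteq> {..<3}" for q ss
    proof -
      obtain q' as where E: "D q ss = (q', as)" by (rule prod.exhaust)
      have "q' < card S + 3" and l: "length as = K" and 1: "\<forall>i < K. fst (as ! i) < 3"
        using D[OF that] unfolding E by simp_all
      moreover have "fst x < 3" if "x \<in> set as" for x
        using that l 1 unfolding in_set_conv_nth by blast
      ultimately show ?thesis unfolding E by (simp add: case_prod_beta)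
    qed
    then show ?thesis using K by (simp add: wf_tm_def M_def Let_def)
  qed
  have sim: "step M (\<beta> l + 3, ts) = (\<beta> (fst (micro (l, ts))) + 3, snd (micro (l, ts)))"
    if "l \<in> S" "l \<noteq> []" for l ts
    using that \<beta>(2)[OF that(1)]
    by (simp add: M_def D_def micro_def halting_def Let_def split: prod.split)
  have micro_S: "fst (micro (l, ts)) \<in> S" if "l \<in> S" for l ts
    using closed[OF that] by (simp add: micro_def split: prod.split) (metis fst_conv)
  \<comment> \<open>\<open>micro\<close> idles at the empty continuation, where the machine is about
    to halt; so the machine may arrive there in fewer than \<open>t\<close> steps.\<close>
  have sim': "\<exists>t' \<le> t. (step M ^^ t') (\<beta> l + 3, ts) = (\<beta> [] + 3, ts')"
    if "l \<in> S" "(micro ^^ t) (l, ts) = ([], ts')" for l ts t ts'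
    using that
  proof (induction t arbitrary: l ts)
    case (Suc t)
    show ?case
    proof (cases "l = []")
      case True
      have "(micro ^^ n) ([], ts) = ([], ts)" for n
        by (induction n) (auto simp: micro_def map2_act_keep)
      then show ?thesis using Suc.prems True by (intro exI[of _ 0]) (simp del: funpow.simps)
    next
      case False
      obtain l1 ts1 where m: "micro (l, ts) = (l1, ts1)" by fastforce
      have "l1 \<in> S" using micro_S[OF Suc.prems(1), of ts] m by simp
      then obtain t' where "t' \<le> t" "(step M ^^ t') (\<beta> l1 + 3, ts1) = (\<beta> [] + 3, ts')"
        using Suc.IH[of l1 ts1] Suc.prems(2) m by (simp only: funpow_Suc') auto
      then show ?thesis using sim[OF Suc.prems(1) False, of ts] m
        by (intro exI[of _ "Suc t'"]) (simp only: funpow_Suc', simp)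
    qed
  qed auto
  have "implements M c" unfolding implements_def
  proof (intro allI impI)
    fix ws t s
    assume b: "big c (init_store ws) t s"
    define ts0 where "ts0 = snd (init_config M ws)"
    have "rep K (init_store ws) ts0"
      by (auto simp: rep_def ts0_def init_config_def M_def init_store_def tape_output_def
          word_tape_def)
    then obtain ts where ts: "(micro ^^ t) ([c], ts0) = ([], ts)" "rep K s ts"
      using big_micro[OF b K(1)] by blast
    then obtain t' where t': "t' \<le> t" "(step M ^^ t') (\<beta> [c] + 3, ts0) = (\<beta> [] + 3, ts)"
      using sim'[OF start] by blast
    have "run M ws 0 = (0, ts0)" by (simp add: run_def ts0_def init_config_def)
    then have "run M ws 1 = (\<beta> [c] + 3, ts0)"
      using run_add[of M ws 1 0]
      by (simp add: M_def D_def halting_def map2_act_keep)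
    then have "run M ws (t' + 1) = (\<beta> [] + 3, ts)" using run_add[of M ws t' 1] t' by simp
    moreover have "[] \<in> S" by (simp add: S_def)
    moreover have "(map (\<lambda>(t, h). t h) ts ! 0 = 2) = verdict s"
      using rep_scan[OF ts(2) K(3)] by (auto simp: verdict_def bit_sym_def split: list.splits)
    ultimately have "run M ws (1 + (t' + 1)) = (if verdict s then 1 else 2, ts)"
      using run_add[of M ws 1 "t' + 1"] \<beta>(2)[of "[]"]
      by (simp add: M_def D_def halting_def map2_act_keep)
    then have "run M ws (t + 2) = (if verdict s then 1 else 2, ts)"
      by (rule halting_stable) (use t' in \<open>auto simp: halting_def\<close>)
    then show "\<exists>ts. run M ws (t + 2) = (if verdict s then 1 else 2, ts) \<and> tape_output (ts ! 0) (s 0)"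
      using ts K by (auto simp: rep_def)
  qed
  moreover have "k \<le> num_tapes M" using K by (simp add: M_def)
  ultimately show ?thesis using wf by blast
qed

lemma run_halted:
  assumes "run M ws t = (if b then 1 else 2, ts)" "t \<le> t'"
  shows "run M ws t' = (if b then 1 else 2, ts)"
  using assms(1) _ assms(2) by (rule halting_stable) (simp add: halting_def)

lemma ptime_decidableI:
  assumes "\<And>ws. length ws = k \<Longrightarrow>
    \<exists>t s. big c (init_store ws) t s \<and> t \<le> poly p (sum_list (map length ws)) \<and> (verdict s \<longleftrightarrow> ws \<in> A)"
  shows "ptime_decidable k A"
proof -
  obtain M where M: "wf_tm M" "k \<le> num_tapes M" "implements M c"
    using machine_exists by blast
  have "fst (run M ws (poly (p + [:2:]) (sum_list (map length ws)))) = (if ws \<in> A then 1 else 2)"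
    if "length ws = k" for ws
  proof -
    obtain t s where t: "big c (init_store ws) t s" "t \<le> poly p (sum_list (map length ws))"
      "verdict s \<longleftrightarrow> ws \<in> A" using assms[OF \<open>length ws = k\<close>] by blast
    obtain ts where "run M ws (t + 2) = (if verdict s then 1 else 2, ts)" using M(3) t(1) unfolding implements_def by blast
    moreover have "t + 2 \<le> poly (p + [:2:]) (sum_list (map length ws))" using t(2) by simp
    ultimately have "run M ws (poly (p + [:2:]) (sum_list (map length ws))) =
        (if verdict s then 1 else 2, ts)" by (rule run_halted)
    then show ?thesis using t(3) by simp
  qed
  with M(1,2) show ?thesis unfolding ptime_decidable_def
    by (intro exI[of _ M] exI[of _ "p + [:2:]"] conjI allI impI)
qed

lemma ptime_computableI:
  assumes "\<And>x. \<exists>t s. big c (init_store [x]) t s \<and> t \<le> poly p (length x) \<and> s 0 = g x"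
  shows "ptime_computable g"
proof -
  obtain M where M: "wf_tm M" "implements M c" using machine_exists by blast
  have "let (q, ts) = run M [x] (poly (p + [:2:]) (length x)) in
      halting q \<and> tape_output (ts ! 0) (g x)" for x
  proof -
    obtain t s where t: "big c (init_store [x]) t s" "t \<le> poly p (length x)" "s 0 = g x"
      using assms by blast
    obtain ts where ts: "run M [x] (t + 2) = (if verdict s then 1 else 2, ts)"
        "tape_output (ts ! 0) (s 0)"
      using M(2) t(1) unfolding implements_def by blast
    have "t + 2 \<le> poly (p + [:2:]) (length x)" using t(2) by simp
    from run_halted[OF ts(1) this] t(3) ts(2) show ?thesis by (simp add: halting_def)
  qed
  with M(1) show ?thesis unfolding ptime_computable_def
    by (intro exI[of _ M] exI[of _ "p + [:2:]"] conjI allI)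
qed

section \<open>Bounded arithmetic on words\<close>

definition runs :: "cmd \<Rightarrow> store \<Rightarrow> nat \<Rightarrow> store \<Rightarrow> bool" where
  "runs c s T s' \<longleftrightarrow> (\<exists>t \<le> T. big c s t s')"

lemma runs_mono: "runs c s T s' \<Longrightarrow> T \<le> T' \<Longrightarrow> runs c s T' s'"
  unfolding runs_def by (meson le_trans)

lemma runs_weaken: "runs c s T s1 \<Longrightarrow> s1 = s' \<Longrightarrow> T \<le> T' \<Longrightarrow> runs c s T' s'"
  using runs_mono by blast

lemma runs_Skip: "runs Skip s 1 s"
  unfolding runs_def using big.intros(1) by blast

lemma runs_Push: "runs (Push r b) s 2 (s(r := b # s r))"
  unfolding runs_def using big.intros(2) by blast

lemma runs_Pop: "runs (Pop r) s 1 (s(r := tl (s r)))"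
  unfolding runs_def using big.intros(3) by blast

lemma runs_Seq: "runs a s T s' \<Longrightarrow> runs b s' T' s'' \<Longrightarrow> runs (a ;; b) s (T + T' + 1) s''"
  unfolding runs_def
  by (elim exE conjE) (rule exI, rule conjI[rotated], erule (1) big.intros(4), simp)

lemma runs_Case:
  assumes "s r = [] \<Longrightarrow> runs a s T s'"
    and "\<And>w. s r = False # w \<Longrightarrow> runs b s T s'"
    and "\<And>w. s r = True # w \<Longrightarrow> runs c s T s'"
  shows "runs (Case r a b c) s (T + 1) s'"
proof -
  consider "s r = []" | w where "s r = False # w" | w where "s r = True # w"
    by (cases "s r") auto
  then show ?thesis
  proof cases
    case 1
    then obtain t where "t \<le> T" "big a s t s'" using assms(1) by (auto simp: runs_def)
    then show ?thesis unfolding runs_def using big.intros(5)[of s r a t s' b c] 1 by auto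
  next
    case 2
    then obtain t where "t \<le> T" "big b s t s'" using assms(2) by (auto simp: runs_def)
    then show ?thesis unfolding runs_def using big.intros(6)[of s r w b t s' a c] 2 by auto
  next
    case 3
    then obtain t where "t \<le> T" "big c s t s'" using assms(3) by (auto simp: runs_def)
    then show ?thesis unfolding runs_def using big.intros(7)[of s r w c t s' a b] 3 by auto
  qed
qed

text \<open>The stores between iterations are supplied as an explicit sequence
  \<open>\<sigma>\<close>, which serves as invariant and fixes the number of iterations.\<close>

lemma runs_While:
  assumes "\<And>i. i < m \<Longrightarrow> \<sigma> i r \<noteq> [] \<and> runs c (\<sigma> i) B (\<sigma> (Suc i))" "\<sigma> m r = []"
  shows "runs (While r c) (\<sigma> 0) (m * (B + 1) + 1) (\<sigma> m)"
  using assms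
proof (induction m arbitrary: \<sigma>)
  case 0
  then show ?case unfolding runs_def using big.intros(8)[of "\<sigma> 0" r c] by auto
next
  case (Suc m)
  have "runs (While r c) (\<sigma> (Suc 0)) (m * (B + 1) + 1) (\<sigma> (Suc m))"
    using Suc.IH[of "\<lambda>i. \<sigma> (Suc i)"] Suc.prems by simp
  then obtain t' where t': "t' \<le> m * (B + 1) + 1" "big (While r c) (\<sigma> (Suc 0)) t' (\<sigma> (Suc m))"
    unfolding runs_def by blast
  have "\<sigma> 0 r \<noteq> []" and "runs c (\<sigma> 0) B (\<sigma> (Suc 0))" using Suc.prems(1)[of 0] by auto
  then obtain t where t: "t \<le> B" "big c (\<sigma> 0) t (\<sigma> (Suc 0))"
    unfolding runs_def by blast
  from big.intros(9)[OF \<open>\<sigma> 0 r \<noteq> []\<close> t(2) t'(2)] t(1) t'(1)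
  show ?case unfolding runs_def by (intro exI[of _ "Suc (t + t')"]) auto
qed

section \<open>Subroutines on registers\<close>

definition Move :: "nat \<Rightarrow> nat \<Rightarrow> cmd" where
  "Move a b = While a (Case a Skip (Pop a ;; Push b False) (Pop a ;; Push b True))"

text \<open>Only the length of \<open>a\<close> reaches \<open>d\<close>, in unary. The register
  \<open>a\<close> is emptied into \<open>e\<close> and rebuilt from there, the two reversals
  cancelling.\<close>

definition Copy :: "nat \<Rightarrow> nat \<Rightarrow> nat \<Rightarrow> cmd" where
  "Copy a d e = Move a e ;; While e (Case e Skip
    ((Pop e ;; Push a False) ;; Push d True) ((Pop e ;; Push a True) ;; Push d True))"

definition Clear :: "nat \<Rightarrow> cmd" where
  "Clear r = While r (Pop r)"

lemma nth_drop_Cons: "i < length w \<Longrightarrow> drop i w = w ! i # drop (Suc i) w"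
  by (simp add: Cons_nth_drop_Suc)

lemma runs_Clear: "runs (Clear r) s (2 * length (s r) + 1) (s(r := []))"
proof -
  have "runs (While r (Pop r)) (s(r := drop 0 (s r))) (length (s r) * (1 + 1) + 1)
      (s(r := drop (length (s r)) (s r)))"
  proof (rule runs_While)
    fix i assume "i < length (s r)"
    then show "(s(r := drop i (s r))) r \<noteq> [] \<and>
        runs (Pop r) (s(r := drop i (s r))) 1 (s(r := drop (Suc i) (s r)))"
      using runs_Pop[of r "s(r := drop i (s r))"] by (simp add: drop_Suc tl_drop)
  qed simp
  then show ?thesis by (simp add: Clear_def mult_2)
qed

lemma runs_Move:
  assumes "a \<noteq> b"
  shows "runs (Move a b) s (6 * length (s a) + 1) (s(a := [], b := rev (s a) @ s b))"
proof -
  define \<sigma> where "\<sigma> i = s(a := drop i (s a), b := rev (take i (s a)) @ s b)" for i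
  have "runs (Move a b) (\<sigma> 0) (length (s a) * (5 + 1) + 1) (\<sigma> (length (s a)))"
    unfolding Move_def
  proof (rule runs_While, intro conjI)
    fix i assume i: "i < length (s a)"
    then show "\<sigma> i a \<noteq> []" using assms by (simp add: \<sigma>_def)
    have *: "runs (Pop a ;; Push b (s a ! i)) (\<sigma> i) (1 + 2 + 1) (\<sigma> (Suc i))"
      using runs_Seq[OF runs_Pop[of a "\<sigma> i"] runs_Push[of b "s a ! i" "(\<sigma> i)(a := tl (\<sigma> i a))"]]
        assms i
      by (simp add: \<sigma>_def tl_drop drop_Suc take_Suc_conv_app_nth fun_upd_twist)
    have "\<sigma> i a = s a ! i # drop (Suc i) (s a)" using i assms by (simp add: \<sigma>_def nth_drop_Cons)
    then show "runs (Case a Skip (Pop a ;; Push b False) (Pop a ;; Push b True)) (\<sigma> i) 5 (\<sigma> (Suc i))"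
      using * by (intro runs_mono[OF runs_Case[where T = 4]]) (auto simp: numeral_eq_Suc)
  qed (use assms in \<open>simp add: \<sigma>_def\<close>)
  then show ?thesis using assms by (simp add: \<sigma>_def mult.commute)
qed

lemma runs_Copy:
  assumes "a \<noteq> d" "a \<noteq> e" "d \<noteq> e" "s e = []"
  shows "runs (Copy a d e) s (15 * length (s a) + 3) (s(d := replicate (length (s a)) True @ s d))"
proof -
  let ?w = "rev (s a)"
  define \<sigma> where "\<sigma> i = s(e := drop i ?w, a := rev (take i ?w), d := replicate i True @ s d)" for i
  have "runs (While e (Case e Skip
    ((Pop e ;; Push a False) ;; Push d True) ((Pop e ;; Push a True) ;; Push d True)))
     (\<sigma> 0) (length (s a) * (8 + 1) + 1) (\<sigma> (length (s a)))"
  proof (rule runs_While, intro conjI)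
    fix i assume i: "i < length (s a)"
    then show "\<sigma> i e \<noteq> []" using assms by (simp add: \<sigma>_def)
    have 1: "runs (Pop e ;; Push a (?w ! i)) (\<sigma> i) (1 + 2 + 1)
        ((\<sigma> i)(e := drop (Suc i) ?w, a := rev (take (Suc i) ?w)))"
      using runs_Seq[OF runs_Pop[of e "\<sigma> i"] runs_Push[of a "?w ! i" "(\<sigma> i)(e := tl (\<sigma> i e))"]]
        assms i
      by (simp add: \<sigma>_def tl_drop drop_Suc take_Suc_conv_app_nth fun_upd_twist)
    have "((\<sigma> i)(e := drop (Suc i) ?w, a := rev (take (Suc i) ?w)))(d := True # \<sigma> i d) = \<sigma> (Suc i)"
      using assms by (auto simp: \<sigma>_def fun_eq_iff)
    then have *: "runs ((Pop e ;; Push a (?w ! i)) ;; Push d True) (\<sigma> i) (1 + 2 + 1 + 2 + 1) (\<sigma> (Suc i))"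
      using runs_Seq[OF 1 runs_Push[of d True]] assms by simp
    have "\<sigma> i e = ?w ! i # drop (Suc i) ?w" using i assms by (simp add: \<sigma>_def nth_drop_Cons)
    then show "runs (Case e Skip ((Pop e ;; Push a False) ;; Push d True)
        ((Pop e ;; Push a True) ;; Push d True)) (\<sigma> i) 8 (\<sigma> (Suc i))"
      using * by (intro runs_mono[OF runs_Case[where T = 7]]) (auto simp: numeral_eq_Suc)
  qed (use assms in \<open>simp add: \<sigma>_def\<close>)
  moreover have "\<sigma> 0 = s(a := [], e := rev (s a) @ s e)"
      "\<sigma> (length (s a)) = s(d := replicate (length (s a)) True @ s d)"
    using assms by (auto simp: \<sigma>_def fun_eq_iff)
  ultimately show ?thesis
    unfolding Copy_def using runs_weaken[OF runs_Seq[OF runs_Move[OF \<open>a \<noteq> e\<close>, of s]] refl]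
    by (simp add: mult.commute)
qed

text \<open>The Booleans select one of two words. Variables are de Bruijn indices; an index without a value denotes 0.\<close>

datatype trm = TVar nat | TConst nat | TLen bool | TAdd trm trm | TMul trm trm

datatype fm = FLess trm trm | FBit bool trm | FNot fm | FAnd fm fm | FEx trm fm

definition wsel :: "word \<Rightarrow> word \<Rightarrow> bool \<Rightarrow> word" where
  "wsel x y b = (if b then y else x)"

definition bit_at :: "word \<Rightarrow> nat \<Rightarrow> bool" where
  "bit_at w i \<longleftrightarrow> i < length w \<and> w ! i"

fun tval :: "word \<Rightarrow> word \<Rightarrow> nat list \<Rightarrow> trm \<Rightarrow> nat" where
  "tval x y e (TVar i) = (if i < length e then e ! i else 0)"
| "tval x y e (TConst n) = n"
| "tval x y e (TLen b) = length (wsel x y b)"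
| "tval x y e (TAdd a b) = tval x y e a + tval x y e b"
| "tval x y e (TMul a b) = tval x y e a * tval x y e b"

fun fval :: "word \<Rightarrow> word \<Rightarrow> nat list \<Rightarrow> fm \<Rightarrow> bool" where
  "fval x y e (FLess a b) \<longleftrightarrow> tval x y e a < tval x y e b"
| "fval x y e (FBit b t) \<longleftrightarrow> bit_at (wsel x y b) (tval x y e t)"
| "fval x y e (FNot f) \<longleftrightarrow> \<not> fval x y e f"
| "fval x y e (FAnd f g) \<longleftrightarrow> fval x y e f \<and> fval x y e g"
| "fval x y e (FEx t f) \<longleftrightarrow> (\<exists>n < tval x y e t. fval x y (n # e) f)"

text \<open>Compiled code keeps the words in registers 0 and 1 and the values of the variables in the
  registers listed in \<open>\<rho>\<close>; it puts its result in \<open>d\<close> and uses the registers above \<open>d\<close> as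
  scratch space.\<close>

abbreviation wreg :: "bool \<Rightarrow> nat" where
  "wreg b \<equiv> (if b then 1 else 0)"

fun ctrm :: "trm \<Rightarrow> nat list \<Rightarrow> nat \<Rightarrow> cmd" where
  "ctrm (TVar i) \<rho> d = (if i < length \<rho> then Copy (\<rho> ! i) d (d + 1) else Skip)"
| "ctrm (TConst n) \<rho> d = ((\<lambda>c. Push d True ;; c) ^^ n) Skip"
| "ctrm (TLen b) \<rho> d = Copy (wreg b) d (d + 1)"
| "ctrm (TAdd a b) \<rho> d = (ctrm a \<rho> d ;; ctrm b \<rho> (d + 1)) ;; Move (d + 1) d"
| "ctrm (TMul a b) \<rho> d = (ctrm a \<rho> (d + 1) ;; ctrm b \<rho> (d + 2)) ;;
    While (d + 1) (Pop (d + 1) ;; Copy (d + 2) d (d + 3)) ;; Clear (d + 2)"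

text \<open>Comparison pops both numbers in parallel and looks for a remainder of the second. Bit
  access unloads the word into \<open>d + 1\<close> and moves it back. A quantifier counts
  \<open>d + 1\<close> down while its variable \<open>d + 2\<close> counts up, and runs through all
  values even after a witness was found.\<close>

fun cfm :: "fm \<Rightarrow> nat list \<Rightarrow> nat \<Rightarrow> cmd" where
  "cfm (FLess a b) \<rho> d = (ctrm a \<rho> d ;; ctrm b \<rho> (d + 1)) ;;
    While d (Pop d ;; Pop (d + 1)) ;;
    Case (d + 1) Skip (Clear (d + 1) ;; Push d True) (Clear (d + 1) ;; Push d True)"
| "cfm (FBit b t) \<rho> d = ctrm t \<rho> d ;;
    While d (Pop d ;; Case (wreg b) Skip (Pop (wreg b) ;; Push (d + 1) False)
      (Pop (wreg b) ;; Push (d + 1) True)) ;;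
    Case (wreg b) Skip Skip (Push d True) ;; Move (d + 1) (wreg b)"
| "cfm (FNot f) \<rho> d = cfm f \<rho> d ;; Case d (Push d True) (Pop d) (Pop d)"
| "cfm (FAnd f g) \<rho> d = cfm f \<rho> d ;; Case d Skip Skip (Pop d ;; cfm g \<rho> d)"
| "cfm (FEx t f) \<rho> d = ctrm t \<rho> (d + 1) ;;
    While (d + 1) (Pop (d + 1) ;; cfm f ((d + 2) # \<rho>) (d + 3) ;;
      Case (d + 3) Skip Skip (Pop (d + 3) ;; Clear d ;; Push d True) ;; Push (d + 2) True) ;;
    Clear (d + 2)"

text \<open>Registers from \<open>d\<close> on must be empty at entry, because results are pushed
  onto them.\<close>

definition st :: "word \<Rightarrow> word \<Rightarrow> nat list \<Rightarrow> nat list \<Rightarrow> nat \<Rightarrow> store \<Rightarrow> bool" where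
  "st x y e \<rho> d s \<longleftrightarrow> s 0 = x \<and> s 1 = y \<and> length \<rho> = length e \<and> 2 \<le> d \<and>
    (\<forall>i < length \<rho>. 2 \<le> \<rho> ! i \<and> \<rho> ! i < d \<and> s (\<rho> ! i) = replicate (e ! i) True) \<and>
    (\<forall>r \<ge> d. s r = [])"

definition size_of :: "word \<Rightarrow> word \<Rightarrow> nat list \<Rightarrow> nat" where
  "size_of x y e = length x + length y + sum_list e"

lemma poly_nat_mono: "m \<le> n \<Longrightarrow> poly (p :: nat poly) m \<le> poly p n"
  by (induction p) (auto intro: add_mono mult_le_mono)

text \<open>Terms only contain sums and products; this bound is what makes unary registers
  affordable.\<close>

lemma tval_poly: "\<exists>p. \<forall>x y e. tval x y e t \<le> poly p (size_of x y e)"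
proof (induction t)
  case (TVar i)
  have "e ! i \<le> sum_list e" if "i < length e" for e :: "nat list"
    using that by (simp add: member_le_sum_list)
  then show ?case
    by (intro exI[of _ "[:0, 1:]"]) (auto simp: size_of_def intro: le_trans trans_le_add2)
next
  case (TConst n)
  show ?case by (intro exI[of _ "[:n:]"]) auto
next
  case (TLen b)
  show ?case by (intro exI[of _ "[:0, 1:]"]) (auto simp: size_of_def wsel_def)
next
  case (TAdd a b)
  then obtain p q where "\<forall>x y e. tval x y e a \<le> poly p (size_of x y e)"
    "\<forall>x y e. tval x y e b \<le> poly q (size_of x y e)" by blast
  then show ?case by (intro exI[of _ "p + q"]) (auto intro: add_mono)
next
  case (TMul a b)
  then obtain p q where "\<forall>x y e. tval x y e a \<le> poly p (size_of x y e)"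
    "\<forall>x y e. tval x y e b \<le> poly q (size_of x y e)" by blast
  then show ?case by (intro exI[of _ "p * q"]) (auto intro: mult_le_mono)
qed


lemma runs_pushes: "runs (((\<lambda>c. Push d True ;; c) ^^ n) Skip) s (3 * n + 1) (s(d := replicate n True @ s d))"
proof (induction n arbitrary: s)
  case 0
  then show ?case using runs_Skip[of s] by simp
next
  case (Suc n)
  show ?case unfolding funpow.simps o_apply
    by (rule runs_weaken[OF runs_Seq[OF runs_Push Suc.IH]])
      (simp_all add: replicate_app_Cons_same fun_eq_iff)
qed

lemma wsel_le: "length (wsel x y b) \<le> size_of x y e"
  by (auto simp: wsel_def size_of_def)

lemma st_var_le: "st x y e \<rho> d s \<Longrightarrow> i < length \<rho> \<Longrightarrow> length (s (\<rho> ! i)) \<le> size_of x y e"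
  using member_le_sum_list[of "e ! i" e] by (auto simp: st_def size_of_def)

lemma st_Suc: "st x y e \<rho> d s \<Longrightarrow> st x y e \<rho> (Suc d) (s(d := w))"
  by (auto simp: st_def)

text \<open>The polynomial is chosen before the registers and the environment, so one bound serves
  at every nesting depth.\<close>

lemma runs_ctrm:
  "\<exists>p. \<forall>x y e \<rho> d s. st x y e \<rho> d s \<longrightarrow>
    runs (ctrm t \<rho> d) s (poly p (size_of x y e)) (s(d := replicate (tval x y e t) True))"
proof (induction t)
  case (TVar i)
  have "runs (ctrm (TVar i) \<rho> d) s (poly [:4, 15:] (size_of x y e))
      (s(d := replicate (tval x y e (TVar i)) True))" if "st x y e \<rho> d s" for x y e \<rho> d s
  proof (cases "i < length \<rho>")
    case True
    then have "\<rho> ! i < d" "s d = []" "s (d + 1) = []" "s (\<rho> ! i) = replicate (e ! i) True" "i < length e"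
      using that by (auto simp: st_def)
    then show ?thesis unfolding ctrm.simps if_P[OF True]
      by (intro runs_weaken[OF runs_Copy]) (use st_var_le[OF that True] in simp_all)
  next
    case False
    then have "s d = []" "\<not> i < length e" using that by (auto simp: st_def)
    then have "s(d := replicate (tval x y e (TVar i)) True) = s" by auto
    then show ?thesis using runs_mono[OF runs_Skip[of s]] False by simp
  qed
  then show ?case by blast
next
  case (TConst n)
  have "runs (ctrm (TConst n) \<rho> d) s (poly [:3 * n + 1:] (size_of x y e))
      (s(d := replicate (tval x y e (TConst n)) True))" if "st x y e \<rho> d s" for x y e \<rho> d s
  proof -
    have "s d = []" using that by (auto simp: st_def)
    then show ?thesis using runs_pushes[of n d s] by simp
  qed
  then show ?case by blast
next
  case (TLen b)
  have "runs (ctrm (TLen b) \<rho> d) s (poly [:4, 15:] (size_of x y e))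
      (s(d := replicate (tval x y e (TLen b)) True))" if "st x y e \<rho> d s" for x y e \<rho> d s
  proof -
    have "wreg b < d" "s d = []" "s (d + 1) = []" "s (wreg b) = wsel x y b"
      using that by (auto simp: st_def wsel_def)
    then show ?thesis unfolding ctrm.simps
      by (intro runs_weaken[OF runs_Copy]) (use wsel_le[of x y b e] in simp_all)
  qed
  then show ?case by blast
next
  case (TAdd a b)
  then obtain p q where p: "\<And>x y e \<rho> d s. st x y e \<rho> d s \<Longrightarrow>
      runs (ctrm a \<rho> d) s (poly p (size_of x y e)) (s(d := replicate (tval x y e a) True))"
    and q: "\<And>x y e \<rho> d s. st x y e \<rho> d s \<Longrightarrow>
      runs (ctrm b \<rho> d) s (poly q (size_of x y e)) (s(d := replicate (tval x y e b) True))"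
    by blast
  obtain v where v: "\<And>x y e. tval x y e b \<le> poly v (size_of x y e)" using tval_poly by blast
  have "runs (ctrm (TAdd a b) \<rho> d) s (poly (p + q + smult 6 v + [:3:]) (size_of x y e))
      (s(d := replicate (tval x y e (TAdd a b)) True))" if "st x y e \<rho> d s" for x y e \<rho> d s
  proof -
    let ?s1 = "s(d := replicate (tval x y e a) True)"
    let ?s2 = "?s1(d + 1 := replicate (tval x y e b) True)"
    have "s (Suc d) = []" using that by (auto simp: st_def)
    then have eq: "?s2(d + 1 := [], d := rev (?s2 (d + 1)) @ ?s2 d) =
        s(d := replicate (tval x y e (TAdd a b)) True)"
      by (auto simp: replicate_add[symmetric] add.commute)
    have "runs (ctrm a \<rho> d ;; ctrm b \<rho> (d + 1)) s (poly p (size_of x y e) + poly q (size_of x y e) + 1) ?s2"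
      using runs_Seq[OF p[OF that] q[OF st_Suc[OF that]]] by simp
    from runs_Seq[OF this runs_Move[of "d + 1" d ?s2]]
    show ?thesis unfolding ctrm.simps by (rule runs_weaken) (use v[of x y e] eq in simp_all)
  qed
  then show ?case by blast
next
  case (TMul a b)
  then obtain p q where p: "\<And>x y e \<rho> d s. st x y e \<rho> d s \<Longrightarrow>
      runs (ctrm a \<rho> d) s (poly p (size_of x y e)) (s(d := replicate (tval x y e a) True))"
    and q: "\<And>x y e \<rho> d s. st x y e \<rho> d s \<Longrightarrow>
      runs (ctrm b \<rho> d) s (poly q (size_of x y e)) (s(d := replicate (tval x y e b) True))"
    by blast
  obtain u where u: "\<And>x y e. tval x y e a \<le> poly u (size_of x y e)" using tval_poly by blast
  obtain v where v: "\<And>x y e. tval x y e b \<le> poly v (size_of x y e)" using tval_poly by blast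
  have "runs (ctrm (TMul a b) \<rho> d) s
        (poly (p + q + u * (smult 15 v + [:6:]) + smult 2 v + [:10:]) (size_of x y e))
      (s(d := replicate (tval x y e (TMul a b)) True))" if "st x y e \<rho> d s" for x y e \<rho> d s
  proof -
    let ?a = "tval x y e a" and ?b = "tval x y e b" and ?n = "size_of x y e"
    have 0: "s d = []" "s (d + 1) = []" "s (d + 2) = []" "s (d + 3) = []"
      using that by (auto simp: st_def)
    then have s: "s(d := []) = s" by auto
    let ?s1 = "s(d + 1 := replicate ?a True)"
    define \<sigma> where "\<sigma> i = s(d + 1 := replicate (?a - i) True, d + 2 := replicate ?b True,
        d := replicate (i * ?b) True)" for i
    have "\<sigma> 0 = ?s1(d + 2 := replicate ?b True)" using 0 by (auto simp: \<sigma>_def fun_eq_iff)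
    then have 1: "runs (ctrm a \<rho> (d + 1) ;; ctrm b \<rho> (d + 2)) s (poly p ?n + poly q ?n + 1) (\<sigma> 0)"
      using runs_Seq[OF p[of x y e \<rho> "d + 1" s] q[of x y e \<rho> "d + 2" ?s1]]
        st_Suc[OF that, of "[]"] st_Suc[OF st_Suc[OF that, of "[]"], of "replicate ?a True"] s
      by (simp add: numeral_2_eq_2)
    have 2: "runs (While (d + 1) (Pop (d + 1) ;; Copy (d + 2) d (d + 3))) (\<sigma> 0)
        (?a * ((1 + (15 * ?b + 3) + 1) + 1) + 1) (\<sigma> ?a)"
    proof (rule runs_While, intro conjI)
      fix i assume i: "i < ?a"
      then show "\<sigma> i (d + 1) \<noteq> []" by (simp add: \<sigma>_def)
      let ?s = "(\<sigma> i)(d + 1 := tl (\<sigma> i (d + 1)))"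
      have "?s(d := replicate (length (?s (d + 2))) True @ ?s d) = \<sigma> (Suc i)"
        using i by (auto simp: \<sigma>_def fun_eq_iff replicate_add[symmetric] Suc_diff_Suc)
      moreover have "length (?s (d + 2)) = ?b" "?s (d + 3) = []"
        using 0 by (auto simp: \<sigma>_def)
      ultimately have "runs (Copy (d + 2) d (d + 3)) ?s (15 * ?b + 3) (\<sigma> (Suc i))"
        using runs_Copy[of "d + 2" d "d + 3" ?s] by simp
      with runs_Pop show "runs (Pop (d + 1) ;; Copy (d + 2) d (d + 3)) (\<sigma> i)
        (1 + (15 * ?b + 3) + 1) (\<sigma> (Suc i))" by (rule runs_Seq)
    qed (simp add: \<sigma>_def)
    have "(\<sigma> ?a)(d + 2 := []) = s(d := replicate (tval x y e (TMul a b)) True)"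
      using 0 by (auto simp: \<sigma>_def fun_eq_iff)
    moreover have "length (\<sigma> ?a (d + 2)) = ?b" by (simp add: \<sigma>_def)
    ultimately have 3: "runs (Clear (d + 2)) (\<sigma> ?a) (2 * ?b + 1)
        (s(d := replicate (tval x y e (TMul a b)) True))"
      using runs_Clear[of "d + 2" "\<sigma> ?a"] by simp
    have "?a * (15 * ?b + 6) \<le> poly u ?n * (15 * poly v ?n + 6)"
      using u[of x y e] v[of x y e] by (intro mult_le_mono) auto
    then show ?thesis unfolding ctrm.simps
      using v[of x y e] by (intro runs_mono[OF runs_Seq[OF 1 runs_Seq[OF 2 3]]]) (simp add: algebra_simps)
  qed
  then show ?case by blast
qed


lemma st_bind:
  assumes "st x y e \<rho> d s" "\<forall>r > d + 2. s' r = []" "s' (d + 2) = replicate i True"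
    "\<And>r. r < d \<Longrightarrow> s' r = s r"
  shows "st x y (i # e) ((d + 2) # \<rho>) (d + 3) s'"
  using assms unfolding st_def by (auto simp: nth_Cons' less_Suc_eq_0_disj)

lemma runs_cfm:
  "\<exists>p. \<forall>x y e \<rho> d s. st x y e \<rho> d s \<longrightarrow>
    runs (cfm f \<rho> d) s (poly p (size_of x y e)) (s(d := if fval x y e f then [True] else []))"
proof (induction f)
  case (FLess a b)
  obtain p q where p: "\<And>x y e \<rho> d s. st x y e \<rho> d s \<Longrightarrow>
      runs (ctrm a \<rho> d) s (poly p (size_of x y e)) (s(d := replicate (tval x y e a) True))"
    and q: "\<And>x y e \<rho> d s. st x y e \<rho> d s \<Longrightarrow>
      runs (ctrm b \<rho> d) s (poly q (size_of x y e)) (s(d := replicate (tval x y e b) True))"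
    using runs_ctrm by metis
  obtain u where u: "\<And>x y e. tval x y e a \<le> poly u (size_of x y e)" using tval_poly by blast
  obtain v where v: "\<And>x y e. tval x y e b \<le> poly v (size_of x y e)" using tval_poly by blast
  have "runs (cfm (FLess a b) \<rho> d) s
        (poly (p + q + smult 4 u + smult 2 v + [:20:]) (size_of x y e))
      (s(d := if fval x y e (FLess a b) then [True] else []))" if "st x y e \<rho> d s" for x y e \<rho> d s
  proof -
    let ?a = "tval x y e a" and ?b = "tval x y e b" and ?n = "size_of x y e"
    have 0: "s d = []" "s (d + 1) = []" using that by (auto simp: st_def)
    let ?s1 = "s(d := replicate ?a True)"
    define \<sigma> where "\<sigma> i = s(d := replicate (?a - i) True, d + 1 := replicate (?b - i) True)" for i
    have "?s1(d + 1 := replicate ?b True) = \<sigma> 0" by (simp add: \<sigma>_def)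
    then have 1: "runs (ctrm a \<rho> d ;; ctrm b \<rho> (d + 1)) s (poly p ?n + poly q ?n + 1) (\<sigma> 0)"
      using runs_Seq[OF p[OF that] q[OF st_Suc[OF that]]] by simp
    have 2: "runs (While d (Pop d ;; Pop (d + 1))) (\<sigma> 0) (?a * ((1 + 1 + 1) + 1) + 1) (\<sigma> ?a)"
    proof (rule runs_While, intro conjI)
      fix i assume i: "i < ?a"
      then show "\<sigma> i d \<noteq> []" by (simp add: \<sigma>_def)
      show "runs (Pop d ;; Pop (d + 1)) (\<sigma> i) (1 + 1 + 1) (\<sigma> (Suc i))"
        by (rule runs_weaken[OF runs_Seq[OF runs_Pop runs_Pop]])
          (simp_all add: \<sigma>_def fun_eq_iff tl_replicate)
    qed (simp add: \<sigma>_def)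
    have eq: "(\<sigma> ?a)(d + 1 := [], d := True # (\<sigma> ?a) d) = s(d := [True])"
      using 0 by (auto simp: \<sigma>_def fun_eq_iff)
    have 3: "runs (Case (d + 1) Skip (Clear (d + 1) ;; Push d True) (Clear (d + 1) ;; Push d True))
        (\<sigma> ?a) ((2 * ?b + 4) + 1) (s(d := if fval x y e (FLess a b) then [True] else []))"
    proof (cases "?a < ?b")
      case True
      have "runs (Clear (d + 1) ;; Push d True) (\<sigma> ?a) (2 * ?b + 4) (s(d := [True]))"
        by (rule runs_weaken[OF runs_Seq[OF runs_Clear runs_Push]])
          (use eq in \<open>simp_all add: \<sigma>_def\<close>)
      moreover have "\<sigma> ?a (d + 1) \<noteq> []" using True by (simp add: \<sigma>_def)
      ultimately show ?thesis using True by (intro runs_Case) simp_all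
    next
      case False
      have "\<sigma> ?a (d + 1) = []" "\<sigma> ?a = s(d := [])"
        using False 0 by (auto simp: \<sigma>_def fun_eq_iff)
      then show ?thesis using False by (intro runs_Case) (simp_all add: runs_weaken[OF runs_Skip])
    qed
    show ?thesis unfolding cfm.simps
      by (rule runs_weaken[OF runs_Seq[OF 1 runs_Seq[OF 2 3]]])
        (use u[of x y e] v[of x y e] in simp_all)
  qed
  then show ?case by blast
next
  case (FBit b t)
  obtain p where p: "\<And>x y e \<rho> d s. st x y e \<rho> d s \<Longrightarrow>
      runs (ctrm t \<rho> d) s (poly p (size_of x y e)) (s(d := replicate (tval x y e t) True))"
    using runs_ctrm by metis
  obtain u where u: "\<And>x y e. tval x y e t \<le> poly u (size_of x y e)" using tval_poly by blast
  have "runs (cfm (FBit b t) \<rho> d) s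
        (poly (p + smult 20 u + [:20:]) (size_of x y e))
      (s(d := if fval x y e (FBit b t) then [True] else []))" if "st x y e \<rho> d s" for x y e \<rho> d s
  proof -
    let ?i = "tval x y e t" and ?n = "size_of x y e" and ?w = "wsel x y b" and ?r = "wreg b"
    have 0: "s d = []" "s (d + 1) = []" "s ?r = ?w" "?r \<noteq> d" "?r \<noteq> d + 1"
      using that by (auto simp: st_def wsel_def)
    define \<sigma> where "\<sigma> i = s(d := replicate (?i - i) True, ?r := drop i ?w,
        d + 1 := rev (take i ?w))" for i
    have "s(d := replicate ?i True) = \<sigma> 0" using 0 by (auto simp: \<sigma>_def fun_eq_iff)
    then have 1: "runs (ctrm t \<rho> d) s (poly p ?n) (\<sigma> 0)" using p[OF that] by simp
    have 2: "runs (While d (Pop d ;; Case ?r Skip (Pop ?r ;; Push (d + 1) False)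
      (Pop ?r ;; Push (d + 1) True))) (\<sigma> 0) (?i * ((1 + (4 + 1) + 1) + 1) + 1) (\<sigma> ?i)"
    proof (rule runs_While, intro conjI)
      fix i assume i: "i < ?i"
      then show "\<sigma> i d \<noteq> []" using 0 by (simp add: \<sigma>_def)
      let ?s = "(\<sigma> i)(d := tl (\<sigma> i d))"
      have a: "?s ?r = drop i ?w" using 0 by (simp add: \<sigma>_def)
      have "runs (Case ?r Skip (Pop ?r ;; Push (d + 1) False) (Pop ?r ;; Push (d + 1) True))
          ?s (4 + 1) (\<sigma> (Suc i))"
      proof (cases "i < length ?w")
        case True
        have "runs (Pop ?r ;; Push (d + 1) (?w ! i)) ?s 4 (\<sigma> (Suc i))"
          by (rule runs_weaken[OF runs_Seq[OF runs_Pop runs_Push]])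
            (use 0 True in \<open>auto simp: \<sigma>_def fun_eq_iff tl_drop drop_Suc take_Suc_conv_app_nth tl_replicate\<close>)
        moreover have "?s ?r = ?w ! i # drop (Suc i) ?w"
          unfolding a using True by (rule nth_drop_Cons)
        ultimately show ?thesis by (intro runs_Case) (simp_all del: fun_upd_apply)
      next
        case False
        then have "?s ?r = []" "?s = \<sigma> (Suc i)"
          using a 0 by (auto simp: \<sigma>_def fun_eq_iff tl_replicate)
        then show ?thesis by (intro runs_Case) (simp_all add: runs_weaken[OF runs_Skip] del: fun_upd_apply)
      qed
      with runs_Pop show "runs (Pop d ;; Case ?r Skip (Pop ?r ;; Push (d + 1) False)
        (Pop ?r ;; Push (d + 1) True)) (\<sigma> i) (1 + (4 + 1) + 1) (\<sigma> (Suc i))" by (rule runs_Seq)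
    qed (use 0 in \<open>simp add: \<sigma>_def\<close>)
    let ?b = "fval x y e (FBit b t)"
    have a: "\<sigma> ?i ?r = drop ?i ?w" "\<sigma> ?i d = []" using 0 by (auto simp: \<sigma>_def)
    have 3: "runs (Case ?r Skip Skip (Push d True)) (\<sigma> ?i) (2 + 1)
        ((\<sigma> ?i)(d := if ?b then [True] else []))"
    proof (cases ?b)
      case True
      then have "\<sigma> ?i ?r = True # drop (Suc ?i) ?w"
        using a nth_drop_Cons[of ?i ?w] by (simp add: bit_at_def)
      then show ?thesis using runs_Push[of d True "\<sigma> ?i"] True a by (intro runs_Case) simp_all
    next
      case False
      then have "\<sigma> ?i ?r \<noteq> True # w" for w
        using a nth_drop_Cons[of ?i ?w] by (cases "?i < length ?w") (auto simp: bit_at_def)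
      moreover have "(\<sigma> ?i)(d := if ?b then [True] else []) = \<sigma> ?i" using False a by auto
      ultimately show ?thesis by (intro runs_Case; (blast | simp add: runs_weaken[OF runs_Skip]))
    qed
    have len: "length (take ?i ?w) \<le> ?i" by simp
    show ?thesis unfolding cfm.simps
      by (rule runs_weaken[OF runs_Seq[OF 1 runs_Seq[OF 2 runs_Seq[OF 3 runs_Move]]]])
        (use 0 u[of x y e] len in \<open>auto simp: \<sigma>_def fun_eq_iff\<close>)
  qed
  then show ?case by blast
next
  case (FNot f)
  then obtain p where p: "\<And>x y e \<rho> d s. st x y e \<rho> d s \<Longrightarrow>
    runs (cfm f \<rho> d) s (poly p (size_of x y e)) (s(d := if fval x y e f then [True] else []))"
    by blast
  have "runs (cfm (FNot f) \<rho> d) s (poly (p + [:4:]) (size_of x y e))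
      (s(d := if fval x y e (FNot f) then [True] else []))" if "st x y e \<rho> d s" for x y e \<rho> d s
  proof -
    let ?s = "s(d := if fval x y e f then [True] else [])"
    have "runs (Case d (Push d True) (Pop d) (Pop d)) ?s (2 + 1)
        (s(d := if fval x y e (FNot f) then [True] else []))"
      by (rule runs_Case; rule runs_weaken, (rule runs_Push | rule runs_Pop))
        (auto split: if_splits)
    from runs_Seq[OF p[OF that] this] show ?thesis by (auto intro: runs_weaken)
  qed
  then show ?case by blast
next
  case (FAnd f g)
  then obtain p q where p: "\<And>x y e \<rho> d s. st x y e \<rho> d s \<Longrightarrow>
      runs (cfm f \<rho> d) s (poly p (size_of x y e)) (s(d := if fval x y e f then [True] else []))"
    and q: "\<And>x y e \<rho> d s. st x y e \<rho> d s \<Longrightarrow>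
      runs (cfm g \<rho> d) s (poly q (size_of x y e)) (s(d := if fval x y e g then [True] else []))"
    by metis
  have "runs (cfm (FAnd f g) \<rho> d) s (poly (p + q + [:4:]) (size_of x y e))
      (s(d := if fval x y e (FAnd f g) then [True] else []))" if "st x y e \<rho> d s" for x y e \<rho> d s
  proof -
    let ?s = "s(d := if fval x y e f then [True] else [])"
    have s: "s(d := []) = s" using that by (auto simp: st_def)
    have "runs (Case d Skip Skip (Pop d ;; cfm g \<rho> d)) ?s ((1 + poly q (size_of x y e) + 1) + 1)
        (s(d := if fval x y e (FAnd f g) then [True] else []))"
    proof (cases "fval x y e f")
      case True
      have "runs (Pop d ;; cfm g \<rho> d) ?s (1 + poly q (size_of x y e) + 1)
          (s(d := if fval x y e (FAnd f g) then [True] else []))"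
        by (rule runs_Seq[OF runs_Pop]) (use q[OF that] True s in simp)
      then show ?thesis using True by (intro runs_Case) simp_all
    next
      case False
      then show ?thesis by (intro runs_Case) (simp_all add: runs_weaken[OF runs_Skip])
    qed
    from runs_Seq[OF p[OF that] this] show ?thesis by (auto intro: runs_weaken)
  qed
  then show ?case by blast
next
  case (FEx t f)
  then obtain q where q: "\<And>x y e \<rho> d s. st x y e \<rho> d s \<Longrightarrow>
    runs (cfm f \<rho> d) s (poly q (size_of x y e)) (s(d := if fval x y e f then [True] else []))"
    by blast
  obtain p where p: "\<And>x y e \<rho> d s. st x y e \<rho> d s \<Longrightarrow>
      runs (ctrm t \<rho> d) s (poly p (size_of x y e)) (s(d := replicate (tval x y e t) True))"
    using runs_ctrm by metis
  obtain u where u: "\<And>x y e. tval x y e t \<le> poly u (size_of x y e)" using tval_poly by blast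
  \<comment> \<open>A bound variable adds less than the value of \<open>t\<close>, hence at most
    \<open>poly u\<close>, to the size of the environment; this is the reason for composing
    \<open>q\<close> with \<open>[:0, 1:] + u\<close>.\<close>
  have "runs (cfm (FEx t f) \<rho> d) s
        (poly (p + u * (q \<circ>\<^sub>p ([:0, 1:] + u) + [:30:]) + smult 2 u + [:20:]) (size_of x y e))
      (s(d := if fval x y e (FEx t f) then [True] else []))" if "st x y e \<rho> d s" for x y e \<rho> d s
  proof -
    let ?m = "tval x y e t" and ?n = "size_of x y e"
    let ?q = "poly q (?n + poly u ?n)"
    have 0: "s d = []" "s (d + 1) = []" "s (d + 2) = []" "\<forall>r \<ge> d. s r = []"
      using that by (auto simp: st_def)
    define \<sigma> where "\<sigma> i = s(d + 1 := replicate (?m - i) True, d + 2 := replicate i True,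
      d := if \<exists>j < i. fval x y (j # e) f then [True] else [])" for i
    have \<sigma>0: "\<sigma> i (d + 1) = replicate (?m - i) True" "\<sigma> i (d + 2) = replicate i True"
      "\<sigma> i d = (if \<exists>j < i. fval x y (j # e) f then [True] else [])"
      "r \<noteq> d \<Longrightarrow> r \<noteq> d + 1 \<Longrightarrow> r \<noteq> d + 2 \<Longrightarrow> \<sigma> i r = s r" for i r
      by (auto simp: \<sigma>_def)
    note \<sigma>_simps = \<sigma>0 \<sigma>0[simplified]
    have "s(d + 1 := replicate ?m True) = \<sigma> 0" using 0 by (auto simp: \<sigma>_def fun_eq_iff)
    moreover have "s(d := []) = s" using 0 by auto
    ultimately have 1: "runs (ctrm t \<rho> (d + 1)) s (poly p ?n) (\<sigma> 0)"
      using p[of x y e \<rho> "d + 1" s] st_Suc[OF that, of "[]"] by simp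
    have 2: "runs (While (d + 1) (Pop (d + 1) ;; cfm f ((d + 2) # \<rho>) (d + 3) ;;
      Case (d + 3) Skip Skip (Pop (d + 3) ;; Clear d ;; Push d True) ;; Push (d + 2) True)) (\<sigma> 0)
        (?m * ((1 + (?q + ((9 + 1) + 2 + 1) + 1) + 1) + 1) + 1) (\<sigma> ?m)"
    proof (rule runs_While, intro conjI)
      fix i assume i: "i < ?m"
      then show "\<sigma> i (d + 1) \<noteq> []" by (simp add: \<sigma>_simps)
      let ?s = "(\<sigma> i)(d + 1 := tl (\<sigma> i (d + 1)))"
      let ?b = "fval x y (i # e) f"
      let ?s' = "?s(d + 3 := if ?b then [True] else [])"
      have "st x y (i # e) ((d + 2) # \<rho>) (d + 3) ?s"
        by (rule st_bind[OF that]) (use 0 in \<open>auto simp: \<sigma>_simps\<close>)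
      then have "runs (cfm f ((d + 2) # \<rho>) (d + 3)) ?s (poly q (size_of x y (i # e))) ?s'"
        by (rule q)
      moreover have "size_of x y (i # e) \<le> ?n + poly u ?n"
        using i u[of x y e] by (simp add: size_of_def)
      ultimately have a: "runs (cfm f ((d + 2) # \<rho>) (d + 3)) ?s ?q ?s'"
        using poly_nat_mono runs_mono by blast
      have s3: "?s (d + 3) = []" using 0 by (simp add: \<sigma>_simps)
      let ?s'' = "?s(d := if ?b then [True] else \<sigma> i d)"
      have b: "runs (Case (d + 3) Skip Skip (Pop (d + 3) ;; Clear d ;; Push d True)) ?s' (9 + 1) ?s''"
      proof (cases ?b)
        case True
        have "runs (Pop (d + 3) ;; Clear d ;; Push d True) ?s' 9 ?s''"
          by (rule runs_weaken[OF runs_Seq[OF runs_Pop runs_Seq[OF runs_Clear runs_Push]]])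
            (use True s3 in \<open>auto simp: \<sigma>_simps fun_eq_iff\<close>)
        then show ?thesis using True by (intro runs_Case) simp_all
      next
        case False
        then have "?s'' = ?s'" using s3 by (auto simp: fun_eq_iff)
        then show ?thesis using False by (intro runs_Case) (simp_all add: runs_weaken[OF runs_Skip])
      qed
      have c: "?s''(d + 2 := True # ?s'' (d + 2)) = \<sigma> (Suc i)"
        by (auto simp: \<sigma>_def fun_eq_iff less_Suc_eq tl_replicate)
      show "runs (Pop (d + 1) ;; cfm f ((d + 2) # \<rho>) (d + 3) ;;
          Case (d + 3) Skip Skip (Pop (d + 3) ;; Clear d ;; Push d True) ;; Push (d + 2) True) (\<sigma> i)
          (1 + (?q + ((9 + 1) + 2 + 1) + 1) + 1) (\<sigma> (Suc i))"
        by (rule runs_weaken[OF runs_Seq[OF runs_Pop runs_Seq[OF a runs_Seq[OF b runs_Push]]]])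
          (simp_all only: c order_refl)
    qed (simp add: \<sigma>_simps)
    have "?m * (?q + 20) \<le> poly u ?n * (?q + 30)"
      using u[of x y e] by (intro mult_le_mono) auto
    then show ?thesis unfolding cfm.simps
      by (intro runs_weaken[OF runs_Seq[OF 1 runs_Seq[OF 2 runs_Clear]]])
        (use 0 u[of x y e] in \<open>auto simp: \<sigma>_def fun_eq_iff poly_pcompose algebra_simps\<close>)
  qed
  then show ?case by blast
qed

section \<open>Tables and their iteration\<close>

definition tabulate :: "trm \<Rightarrow> fm \<Rightarrow> nat \<Rightarrow> cmd" where
  "tabulate E f d = ctrm E [] d ;; While d (Pop d ;; cfm f [d] (d + 2) ;;
    Case (d + 2) (Push (d + 1) False) Skip (Pop (d + 2) ;; Push (d + 1) True))"

definition table :: "word \<Rightarrow> word \<Rightarrow> trm \<Rightarrow> fm \<Rightarrow> word" where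
  "table x y E f = map (\<lambda>i. fval x y [i] f) [0..<tval x y [] E]"

text \<open>Entries are pushed from the last to the first, so the countdown in \<open>d\<close> is
  itself the index of the entry being computed.\<close>

lemma runs_tabulate:
  "\<exists>p. \<forall>x y d s. st x y [] [] d s \<longrightarrow>
    runs (tabulate E f d) s (poly p (length x + length y)) (s(d + 1 := table x y E f))"
proof -
  obtain p where p: "\<And>x y e \<rho> d s. st x y e \<rho> d s \<Longrightarrow>
      runs (ctrm E \<rho> d) s (poly p (size_of x y e)) (s(d := replicate (tval x y e E) True))"
    using runs_ctrm by metis
  obtain q where q: "\<And>x y e \<rho> d s. st x y e \<rho> d s \<Longrightarrow>
    runs (cfm f \<rho> d) s (poly q (size_of x y e)) (s(d := if fval x y e f then [True] else []))"
    using runs_cfm by metis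
  obtain u where u: "\<And>x y e. tval x y e E \<le> poly u (size_of x y e)" using tval_poly by blast
  have "runs (tabulate E f d) s
      (poly (p + u * (q \<circ>\<^sub>p ([:0, 1:] + u) + [:9:]) + [:2:]) (length x + length y))
      (s(d + 1 := table x y E f))"
    if st: "st x y [] [] d s" for x y d s
  proof -
    let ?m = "tval x y [] E" and ?n = "size_of x y []"
    let ?q = "poly q (?n + poly u ?n)"
    let ?f = "\<lambda>i. fval x y [i] f"
    have 0: "s d = []" "s (Suc d) = []" "s (Suc (Suc d)) = []" "\<forall>r \<ge> d. s r = []"
      using st by (auto simp: st_def)
    define \<sigma> where "\<sigma> i = s(d := replicate (?m - i) True, d + 1 := map ?f [?m - i..<?m])" for i
    have \<sigma>0: "\<sigma> i d = replicate (?m - i) True" "\<sigma> i (d + 1) = map ?f [?m - i..<?m]"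
      "r \<noteq> d \<Longrightarrow> r \<noteq> d + 1 \<Longrightarrow> \<sigma> i r = s r" for i r
      by (auto simp: \<sigma>_def)
    note \<sigma>_simps = \<sigma>0 \<sigma>0[simplified]
    have "s(d := replicate ?m True) = \<sigma> 0" using 0 by (auto simp: \<sigma>_def fun_eq_iff)
    then have 1: "runs (ctrm E [] d) s (poly p ?n) (\<sigma> 0)" using p[OF st] by simp
    have 2: "runs (While d (Pop d ;; cfm f [d] (d + 2) ;;
      Case (d + 2) (Push (d + 1) False) Skip (Pop (d + 2) ;; Push (d + 1) True))) (\<sigma> 0)
        (?m * ((1 + (?q + (4 + 1) + 1) + 1) + 1) + 1) (\<sigma> ?m)"
    proof (rule runs_While, intro conjI)
      fix i assume i: "i < ?m"
      then show "\<sigma> i d \<noteq> []" by (simp add: \<sigma>_simps)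
      define j where "j = ?m - Suc i"
      have j: "?m - i = Suc j" using i by (simp add: j_def)
      let ?s = "(\<sigma> i)(d := tl (\<sigma> i d))"
      let ?s' = "?s(d + 2 := if ?f j then [True] else [])"
      have "st x y [j] [d] (d + 2) ?s"
        using st j by (auto simp: st_def \<sigma>_simps)
      then have "runs (cfm f [d] (d + 2)) ?s (poly q (size_of x y [j])) ?s'"
        by (rule q)
      moreover have "size_of x y [j] \<le> ?n + poly u ?n"
        using i u[of x y "[]"] by (simp add: size_of_def j_def)
      ultimately have a: "runs (cfm f [d] (d + 2)) ?s ?q ?s'"
        using poly_nat_mono runs_mono by blast
      have "[j..<?m] = j # [?m - i..<?m]" using j i by (simp add: upt_conv_Cons)
      then have s': "\<sigma> (Suc i) = ?s(d + 1 := ?f j # \<sigma> i (d + 1))"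
        by (auto simp: \<sigma>_def fun_eq_iff j j_def[symmetric])
      have b: "runs (Case (d + 2) (Push (d + 1) False) Skip (Pop (d + 2) ;; Push (d + 1) True))
          ?s' (4 + 1) (\<sigma> (Suc i))"
      proof (cases "?f j")
        case True
        have "runs (Pop (d + 2) ;; Push (d + 1) True) ?s' 4 (\<sigma> (Suc i))"
          unfolding s' by (rule runs_weaken[OF runs_Seq[OF runs_Pop runs_Push]])
            (use True 0 in \<open>auto simp: \<sigma>_simps fun_eq_iff\<close>)
        then show ?thesis using True by (intro runs_Case) simp_all
      next
        case False
        have "runs (Push (d + 1) False) ?s' 4 (\<sigma> (Suc i))"
          unfolding s' by (rule runs_weaken[OF runs_Push])
            (use False 0 in \<open>auto simp: \<sigma>_simps fun_eq_iff\<close>)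
        then show ?thesis using False by (intro runs_Case) simp_all
      qed
      show "runs (Pop d ;; cfm f [d] (d + 2) ;;
        Case (d + 2) (Push (d + 1) False) Skip (Pop (d + 2) ;; Push (d + 1) True)) (\<sigma> i)
        (1 + (?q + (4 + 1) + 1) + 1) (\<sigma> (Suc i))"
        by (rule runs_Seq[OF runs_Pop runs_Seq[OF a b]])
    qed (simp add: \<sigma>_simps)
    have "?m * (?q + 9) \<le> poly u ?n * (?q + 9)"
      using u[of x y "[]"] by (intro mult_le_mono) auto
    moreover have "\<sigma> ?m = s(d + 1 := table x y E f)"
      using 0 by (auto simp: \<sigma>_def fun_eq_iff table_def)
    moreover have "?n = length x + length y" by (simp add: size_of_def)
    ultimately show ?thesis unfolding tabulate_def
      by (intro runs_weaken[OF runs_Seq[OF 1 2]])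
        (auto simp: poly_pcompose algebra_simps)
  qed
  then show ?thesis by blast
qed

lemma ptime_decidable_fm:
  assumes "k \<le> 2"
    and "\<And>ws. length ws = k \<Longrightarrow> ws \<in> A \<longleftrightarrow> fval (init_store ws 0) (init_store ws 1) [] f"
  shows "ptime_decidable k A"
proof -
  obtain q where q: "\<And>x y e \<rho> d s. st x y e \<rho> d s \<Longrightarrow>
    runs (cfm f \<rho> d) s (poly q (size_of x y e)) (s(d := if fval x y e f then [True] else []))"
    using runs_cfm by metis
  show ?thesis
  proof (rule ptime_decidableI[where c = "cfm f [] 2 ;; Clear 0 ;; Move 2 0"
        and p = "q + [:0, 2:] + [:20:]"])
    fix ws :: "word list" assume ws: "length ws = k"
    let ?x = "init_store ws 0" and ?y = "init_store ws 1" and ?s = "init_store ws"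
    let ?b = "fval ?x ?y [] f"
    have st: "st ?x ?y [] [] 2 ?s" using ws assms(1) by (auto simp: st_def init_store_def)
    have n: "size_of ?x ?y [] = sum_list (map length ws)"
    proof -
      consider "ws = []" | a where "ws = [a]" | a b where "ws = [a, b]"
        using ws assms(1) by (cases ws rule: list.exhaust; cases "tl ws"; cases "tl (tl ws)") auto
      then show ?thesis by cases (auto simp: size_of_def init_store_def)
    qed
    have "runs (cfm f [] 2 ;; Clear 0 ;; Move 2 0) ?s
        (poly q (size_of ?x ?y []) + (2 * length ?x + 1 + (6 + 1) + 1) + 1)
        (?s(2 := [], 0 := if ?b then [True] else []))"
      by (rule runs_weaken[OF runs_Seq[OF q[OF st] runs_Seq[OF runs_Clear runs_Move]]])
        (auto simp: fun_eq_iff)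
    then obtain t s where s: "big (cfm f [] 2 ;; Clear 0 ;; Move 2 0) ?s t s"
      "t \<le> poly q (size_of ?x ?y []) + (2 * length ?x + 1 + (6 + 1) + 1) + 1"
      "verdict s = ?b"
      unfolding runs_def verdict_def by fastforce
    moreover have "length ?x \<le> size_of ?x ?y []" by (simp add: size_of_def)
    ultimately have "t \<le> poly (q + [:0, 2:] + [:20:]) (sum_list (map length ws))"
      by (simp add: n[simplified])
    with s(1,3) assms(2)[OF ws] show "\<exists>t s. big (cfm f [] 2 ;; Clear 0 ;; Move 2 0) ?s t s \<and>
        t \<le> poly (q + [:0, 2:] + [:20:]) (sum_list (map length ws)) \<and> verdict s = (ws \<in> A)"
      by blast
  qed
qed

lemma ptime_computable_table: "ptime_computable (\<lambda>x. table x [] E f)"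
proof -
  obtain p where p: "\<And>x y d s. st x y [] [] d s \<Longrightarrow>
    runs (tabulate E f d) s (poly p (length x + length y)) (s(d + 1 := table x y E f))"
    using runs_tabulate by metis
  obtain u where u: "\<And>x y e. tval x y e E \<le> poly u (size_of x y e)" using tval_poly by blast
  \<comment> \<open>\<open>Move\<close> reverses, so two moves are made to deliver the table in its
    order.\<close>
  let ?c = "tabulate E f 2 ;; Clear 0 ;; Move 3 2 ;; Move 2 0"
  let ?p = "p + [:0, 2:] + smult 12 u + [:20:]"
  show ?thesis
  proof (rule ptime_computableI[where c = ?c and p = ?p])
    fix x :: word
    let ?s = "init_store [x]" and ?t = "table x [] E f"
    have st: "st x [] [] [] 2 ?s" by (auto simp: st_def init_store_def)
    have l: "length ?t \<le> poly u (length x)"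
      using u[of x "[]" "[]"] by (simp add: table_def size_of_def)
    have "runs ?c ?s (poly ?p (length x)) (?s(0 := ?t))"
      by (rule runs_weaken[OF runs_Seq[OF p[OF st] runs_Seq[OF runs_Clear runs_Seq[OF runs_Move runs_Move]]]])
        (use l in \<open>auto simp: fun_eq_iff init_store_def\<close>)
    then show "\<exists>t s. big ?c ?s t s \<and> t \<le> poly ?p (length x) \<and> s 0 = ?t"
      unfolding runs_def by fastforce
  qed
qed

text \<open>Each round sees the previous table as its second word. All tables have the length of
  \<open>x\<close>, so repeated rounds cause no growth.\<close>

definition iterate :: "fm \<Rightarrow> word \<Rightarrow> nat \<Rightarrow> word" where
  "iterate f x n = ((\<lambda>A. table x A (TLen False) f) ^^ n) []"

lemma ptime_decidable_iterate:
  assumes "\<And>x. [x] \<in> A \<longleftrightarrow> fval x (iterate f x (length x)) [] g"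
  shows "ptime_decidable 1 A"
proof -
  obtain p where p: "\<And>x y d s. st x y [] [] d s \<Longrightarrow>
    runs (tabulate (TLen False) f d) s (poly p (length x + length y)) (s(d + 1 := table x y (TLen False) f))"
    using runs_tabulate by metis
  obtain q where q: "\<And>x y e \<rho> d s. st x y e \<rho> d s \<Longrightarrow>
    runs (cfm g \<rho> d) s (poly q (size_of x y e)) (s(d := if fval x y e g then [True] else []))"
    using runs_cfm by metis
  let ?body = "Pop 2 ;; tabulate (TLen False) f 3 ;; Clear 1 ;; Move 4 3 ;; Move 3 1"
  let ?c = "Copy 0 2 3 ;; While 2 ?body ;; cfm g [] 2 ;; Clear 0 ;; Move 2 0"
  let ?p = "[:0, 17:] + [:0, 1:] * (p \<circ>\<^sub>p [:0, 2:] + [:0, 14:] + [:20:]) + q \<circ>\<^sub>p [:0, 2:] + [:20:]"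
  show ?thesis
  proof (rule ptime_decidableI[where c = ?c and p = ?p])
    fix ws :: "word list" assume "length ws = 1"
    then obtain x where x: "ws = [x]" by (metis One_nat_def length_0_conv length_Suc_conv)
    let ?s = "init_store ws" and ?n = "length x"
    have s: "?s 0 = x" "\<And>r. r > 0 \<Longrightarrow> ?s r = []" by (auto simp: x init_store_def)
    have len: "length (iterate f x i) \<le> ?n" for i
      by (cases i) (auto simp: iterate_def table_def wsel_def)
    define \<sigma> where "\<sigma> i = ?s(1 := iterate f x i, 2 := replicate (?n - i) True)" for i
    have \<sigma>_simps: "\<sigma> i 0 = x" "\<sigma> i 1 = iterate f x i" "\<sigma> i 2 = replicate (?n - i) True"
      "r > 2 \<Longrightarrow> \<sigma> i r = []" for i r
      by (auto simp: \<sigma>_def s)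
    have "?s(2 := replicate (length (?s 0)) True @ ?s 2) = \<sigma> 0"
      by (auto simp: \<sigma>_def s iterate_def fun_eq_iff)
    then have 1: "runs (Copy 0 2 3) ?s (15 * ?n + 3) (\<sigma> 0)"
      using runs_Copy[of 0 2 3 ?s] by (simp add: s)
    let ?P = "poly p (2 * ?n)"
    have 2: "runs (While 2 ?body) (\<sigma> 0) (?n * ((?P + 14 * ?n + 10) + 1) + 1) (\<sigma> ?n)"
    proof (rule runs_While, intro conjI)
      fix i assume i: "i < ?n"
      then show "\<sigma> i 2 \<noteq> []" by (simp add: \<sigma>_simps)
      let ?s = "(\<sigma> i)(2 := tl (\<sigma> i 2))"
      have st: "st x (iterate f x i) [] [] 3 ?s" using \<sigma>_simps by (auto simp: st_def)
      have "poly p (length x + length (iterate f x i)) \<le> ?P"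
        using len[of i] by (intro poly_nat_mono) simp
      with p[OF st] have a: "runs (tabulate (TLen False) f 3) ?s ?P
          (?s(4 := table x (iterate f x i) (TLen False) f))"
        using runs_mono by fastforce
      have t: "table x (iterate f x i) (TLen False) f = iterate f x (Suc i)"
        by (simp add: iterate_def)
      show "runs ?body (\<sigma> i) (?P + 14 * ?n + 10) (\<sigma> (Suc i))"
        by (rule runs_weaken[OF runs_Seq[OF runs_Pop runs_Seq[OF a
            runs_Seq[OF runs_Clear runs_Seq[OF runs_Move runs_Move]]]]])
          (use len[of i] len[of "Suc i"] in \<open>auto simp: t \<sigma>_simps[simplified] \<sigma>_def fun_eq_iff s tl_replicate\<close>)
    qed (simp add: \<sigma>_simps)
    let ?y = "iterate f x ?n"
    have st: "st x ?y [] [] 2 (\<sigma> ?n)"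
      by (auto simp: st_def \<sigma>_simps[simplified] \<sigma>_simps le_less[of 2])
    have "size_of x ?y [] \<le> 2 * ?n" using len[of ?n] by (simp add: size_of_def)
    then have 3: "runs (cfm g [] 2) (\<sigma> ?n) (poly q (2 * ?n))
        ((\<sigma> ?n)(2 := if fval x ?y [] g then [True] else []))"
      using q[OF st] poly_nat_mono runs_mono by blast
    have "runs ?c ?s (poly ?p ?n) ((\<sigma> ?n)(2 := [], 0 := if fval x ?y [] g then [True] else []))"
      by (rule runs_weaken[OF runs_Seq[OF 1 runs_Seq[OF 2 runs_Seq[OF 3 runs_Seq[OF runs_Clear runs_Move]]]]])
        (auto simp: fun_eq_iff \<sigma>_simps[simplified] poly_pcompose algebra_simps mult_2_right[symmetric])
    then obtain t s where "big ?c ?s t s" "t \<le> poly ?p ?n" "verdict s = fval x ?y [] g"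
      unfolding runs_def verdict_def by fastforce
    then show "\<exists>t s. big ?c ?s t s \<and> t \<le> poly ?p (sum_list (map length ws)) \<and> verdict s = (ws \<in> A)"
      using assms[of x] by (auto simp: x)
  qed
qed


section \<open>Definability\<close>

text \<open>A context \<open>c\<close> provides two words and the values \<open>R c\<close> of the
  variables. The rules let the automation compile a HOL predicate into a formula.\<close>

definition dtm :: "('c \<Rightarrow> word) \<Rightarrow> ('c \<Rightarrow> word) \<Rightarrow> ('c \<Rightarrow> nat list) \<Rightarrow> ('c \<Rightarrow> nat) \<Rightarrow> bool" where
  "dtm X Y R f \<longleftrightarrow> (\<exists>t. \<forall>c. tval (X c) (Y c) (R c) t = f c)"

definition dfm :: "('c \<Rightarrow> word) \<Rightarrow> ('c \<Rightarrow> word) \<Rightarrow> ('c \<Rightarrow> nat list) \<Rightarrow> ('c \<Rightarrow> bool) \<Rightarrow> bool" where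
  "dfm X Y R P \<longleftrightarrow> (\<exists>f. \<forall>c. fval (X c) (Y c) (R c) f = P c)"

lemma dtm_const: "dtm X Y R (\<lambda>c. n)"
  unfolding dtm_def by (rule exI[of _ "TConst n"]) simp

lemma dtm_len0: "dtm X Y R (\<lambda>c. length (X c))"
  unfolding dtm_def by (rule exI[of _ "TLen False"]) (simp add: wsel_def)

lemma dtm_len1: "dtm X Y R (\<lambda>c. length (Y c))"
  unfolding dtm_def by (rule exI[of _ "TLen True"]) (simp add: wsel_def)

fun shift :: "trm \<Rightarrow> trm" where
  "shift (TVar i) = TVar (Suc i)"
| "shift (TAdd a b) = TAdd (shift a) (shift b)"
| "shift (TMul a b) = TMul (shift a) (shift b)"
| "shift t = t"

lemma tval_shift: "tval x y (n # e) (shift t) = tval x y e t"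
  by (induction t) auto

lemma dtm_var0: "dtm X Y (\<lambda>c. F c # G c) F"
  unfolding dtm_def by (rule exI[of _ "TVar 0"]) simp

lemma dtm_varS: "dtm X Y G F \<Longrightarrow> dtm X Y (\<lambda>c. H c # G c) F"
  unfolding dtm_def by (elim exE, rule_tac x = "shift t" in exI) (simp add: tval_shift)

lemma dtm_add: "dtm X Y R f \<Longrightarrow> dtm X Y R g \<Longrightarrow> dtm X Y R (\<lambda>c. f c + g c)"
  unfolding dtm_def by (elim exE, rule_tac x = "TAdd t ta" in exI) simp

lemma dtm_mult: "dtm X Y R f \<Longrightarrow> dtm X Y R g \<Longrightarrow> dtm X Y R (\<lambda>c. f c * g c)"
  unfolding dtm_def by (elim exE, rule_tac x = "TMul t ta" in exI) simp

lemma dtm_Suc: "dtm X Y R f \<Longrightarrow> dtm X Y R (\<lambda>c. Suc (f c))"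
  using dtm_add[of X Y R f "\<lambda>c. 1"] dtm_const[of X Y R 1] by simp

text \<open>By Horner's scheme, with the coefficients as constants.\<close>

lemma dtm_poly: "dtm X Y R f \<Longrightarrow> dtm X Y R (\<lambda>c. poly p (f c))"
proof (induction p)
  case 0
  then show ?case using dtm_const[of X Y R 0] by simp
next
  case (pCons a p)
  then show ?case
    using dtm_add[OF dtm_const[of X Y R a] dtm_mult[OF pCons.prems pCons.IH[OF pCons.prems]]] by simp
qed

lemma dfm_less: "dtm X Y R f \<Longrightarrow> dtm X Y R g \<Longrightarrow> dfm X Y R (\<lambda>c. f c < g c)"
  unfolding dtm_def dfm_def by (elim exE, rule_tac x = "FLess t ta" in exI) simp

lemma dfm_bit0: "dtm X Y R f \<Longrightarrow> dfm X Y R (\<lambda>c. bit_at (X c) (f c))"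
  unfolding dtm_def dfm_def
  by (elim exE, rule_tac x = "FBit False t" in exI) (simp add: wsel_def)

lemma dfm_bit1: "dtm X Y R f \<Longrightarrow> dfm X Y R (\<lambda>c. bit_at (Y c) (f c))"
  unfolding dtm_def dfm_def
  by (elim exE, rule_tac x = "FBit True t" in exI) (simp add: wsel_def)

lemma dfm_not: "dfm X Y R P \<Longrightarrow> dfm X Y R (\<lambda>c. \<not> P c)"
  unfolding dfm_def by (elim exE, rule_tac x = "FNot f" in exI) simp

lemma dfm_and: "dfm X Y R P \<Longrightarrow> dfm X Y R Q \<Longrightarrow> dfm X Y R (\<lambda>c. P c \<and> Q c)"
  unfolding dfm_def by (elim exE, rule_tac x = "FAnd f fa" in exI) simp

text \<open>The body is compiled for contexts paired with the bound value, which becomes the new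
  head of the environment.\<close>

lemma dfm_ex:
  assumes "dtm X Y R f" "dfm (\<lambda>z. X (snd z)) (\<lambda>z. Y (snd z)) (\<lambda>z. fst z # R (snd z)) (\<lambda>z. P (snd z) (fst z))"
  shows "dfm X Y R (\<lambda>c. \<exists>i < f c. P c i)"
proof -
  obtain t where t: "\<And>c. tval (X c) (Y c) (R c) t = f c" using assms(1) by (auto simp: dtm_def)
  obtain g where "\<And>z. fval (X (snd z)) (Y (snd z)) (fst z # R (snd z)) g = P (snd z) (fst z)"
    using assms(2) by (auto simp: dfm_def)
  then have "fval (X c) (Y c) (i # R c) g = P c i" for c i
    by (metis fst_conv snd_conv)
  then show ?thesis unfolding dfm_def by (intro exI[of _ "FEx t g"]) (simp add: t)
qed

lemma dfm_cong: "(\<And>c. P c = Q c) \<Longrightarrow> dfm X Y R Q \<Longrightarrow> dfm X Y R P"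
  by (simp add: dfm_def)

lemma dfm_const: "dfm X Y R (\<lambda>c. b)"
  using dfm_less[OF dtm_const[of X Y R 0] dtm_const[of X Y R "of_bool b"]] by (rule dfm_cong[rotated]) simp

lemma dfm_or: "dfm X Y R P \<Longrightarrow> dfm X Y R Q \<Longrightarrow> dfm X Y R (\<lambda>c. P c \<or> Q c)"
  using dfm_not[OF dfm_and[OF dfm_not[of X Y R P] dfm_not[of X Y R Q]]] by simp

lemma dfm_imp: "dfm X Y R P \<Longrightarrow> dfm X Y R Q \<Longrightarrow> dfm X Y R (\<lambda>c. P c \<longrightarrow> Q c)"
  using dfm_or[OF dfm_not[of X Y R P], of Q] by simp

lemma dfm_iff: "dfm X Y R P \<Longrightarrow> dfm X Y R Q \<Longrightarrow> dfm X Y R (\<lambda>c. P c = Q c)"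
  using dfm_and[OF dfm_imp[of X Y R P Q] dfm_imp[of X Y R Q P]] by (simp add: iff_conv_conj_imp)

lemma dfm_le: "dtm X Y R f \<Longrightarrow> dtm X Y R g \<Longrightarrow> dfm X Y R (\<lambda>c. f c \<le> g c)"
  using dfm_not[OF dfm_less[of X Y R g f]] by (simp add: not_less)

lemma dfm_eq: "dtm X Y R f \<Longrightarrow> dtm X Y R g \<Longrightarrow> dfm X Y R (\<lambda>c. f c = (g c :: nat))"
  using dfm_and[OF dfm_le[of X Y R f g] dfm_le[of X Y R g f]] by (simp add: eq_iff)

lemma dfm_all:
  assumes "dtm X Y R f" "dfm (\<lambda>z. X (snd z)) (\<lambda>z. Y (snd z)) (\<lambda>z. fst z # R (snd z)) (\<lambda>z. P (snd z) (fst z))"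
  shows "dfm X Y R (\<lambda>c. \<forall>i < f c. P c i)"
  using dfm_not[OF dfm_ex[OF assms(1), of "\<lambda>c i. \<not> P c i"]] dfm_not[OF assms(2)] by simp

text \<open>Unlike in \<open>dfm_ex\<close> the range is constant, so this is a finite disjunction,
  and the bound value may enter \<open>P\<close> through functions that are not definable.\<close>

lemma dfm_bex:
  assumes "finite S" "\<And>i. i \<in> S \<Longrightarrow> dfm X Y R (\<lambda>c. P c i)"
  shows "dfm X Y R (\<lambda>c. \<exists>i \<in> S. P c i)"
  using assms
proof (induction S rule: finite_induct)
  case empty
  then show ?case using dfm_const[of X Y R False] by simp
next
  case (insert i S)
  then have "dfm X Y R (\<lambda>c. P c i \<or> (\<exists>i \<in> S. P c i))" by (intro dfm_or) simp_all
  then show ?case by simp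
qed

lemma dfm_ball:
  assumes "finite S" "\<And>i. i \<in> S \<Longrightarrow> dfm X Y R (\<lambda>c. P c i)"
  shows "dfm X Y R (\<lambda>c. \<forall>i \<in> S. P c i)"
  using assms
proof (induction S rule: finite_induct)
  case empty
  then show ?case using dfm_const[of X Y R True] by simp
next
  case (insert i S)
  then have "dfm X Y R (\<lambda>c. P c i \<and> (\<forall>i \<in> S. P c i))" by (intro dfm_and) simp_all
  then show ?case by simp
qed

lemma dfm_if: "dfm X Y R P \<Longrightarrow> dfm X Y R Q \<Longrightarrow> dfm X Y R S \<Longrightarrow> dfm X Y R (\<lambda>c. if P c then Q c else S c)"
  using dfm_and[OF dfm_imp[of X Y R P Q] dfm_imp[OF dfm_not[of X Y R P], of S]]
  by (simp add: if_bool_eq_conj)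

lemmas dintros = dtm_const dtm_var0 dtm_varS dtm_len0 dtm_len1 dtm_add dtm_mult dtm_Suc dtm_poly
  dfm_const dfm_less dfm_le dfm_eq dfm_bit0 dfm_bit1 dfm_not dfm_and dfm_or dfm_imp dfm_iff dfm_if
  dfm_ex dfm_all dfm_bex dfm_ball

section \<open>List colourings of bipartite graphs\<close>

definition colorable :: "'a set \<Rightarrow> 'a set set \<Rightarrow> ('a \<Rightarrow> nat set) \<Rightarrow> bool" where
  "colorable V E L \<longleftrightarrow> (\<exists>c. proper_coloring E c \<and> (\<forall>v \<in> V. c v \<in> L v))"

definition bipartition :: "'a set \<Rightarrow> 'a set set \<Rightarrow> 'a set \<Rightarrow> 'a set \<Rightarrow> bool" where
  "bipartition V E A B \<longleftrightarrow> A \<union> B = V \<and> A \<inter> B = {} \<and> (\<forall>e \<in> E. \<exists>a \<in> A. \<exists>b \<in> B. e = {a, b})"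

lemma bipartition_commute: "bipartition V E A B \<Longrightarrow> bipartition V E B A"
  unfolding bipartition_def
  by (elim conjE, intro conjI ballI) (auto, metis insert_commute)

lemma colorableI:
  assumes "bipartition V E A B" "\<And>v. v \<in> V \<Longrightarrow> c v \<in> L v"
    and "\<And>a b. a \<in> A \<Longrightarrow> b \<in> B \<Longrightarrow> {a, b} \<in> E \<Longrightarrow> c a \<noteq> c b"
  shows "colorable V E L"
proof -
  have "c u \<noteq> c v" if "{u, v} \<in> E" for u v
  proof -
    have "\<exists>a \<in> A. \<exists>b \<in> B. {u, v} = {a, b}"
      using assms(1) that unfolding bipartition_def by (elim conjE) (drule (1) bspec)
    then obtain a b where ab: "a \<in> A" "b \<in> B" "{u, v} = {a, b}" by (elim bexE)
    have "c a \<noteq> c b" using assms(3)[OF ab(1,2)] that unfolding ab(3) by blast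
    then show ?thesis using ab(3) unfolding doubleton_eq_iff by (elim disjE conjE) simp_all
  qed
  then show ?thesis using assms(2) unfolding colorable_def proper_coloring_def
    by (intro exI[of _ c] conjI allI impI ballI)
qed

lemma three_minus:
  assumes "X \<subseteq> {1..3::nat}" "2 \<le> card X" "i \<in> {1..3}" "i \<notin> X"
  shows "X = {1..3} - {i}"
proof (rule card_subset_eq)
  show "card X = card ({1..3} - {i})"
    using assms card_mono[of "{1..3} - {i}" X] by (simp add: card_Diff_singleton_if subset_Diff_insert)
qed (use assms in auto)

lemma ex_color_avoiding:
  assumes "2 \<le> card (X :: nat set)"
  shows "\<exists>c. c \<in> X \<and> c \<noteq> i"
proof (rule ccontr)
  assume "\<not> ?thesis"
  then have "X \<subseteq> {i}" by blast
  then show False using assms card_mono[of "{i}" X] by simp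
qed

text \<open>If one side is coloured by \<open>i\<close> throughout, the other side can avoid
  \<open>i\<close> because every list has a second colour.\<close>

lemma uncolorable_missing:
  assumes bip: "bipartition V E A B" and L: "\<And>v. v \<in> V \<Longrightarrow> 2 \<le> card (L v)"
    and unc: "\<not> colorable V E L"
  shows "\<exists>a \<in> A. i \<notin> L a"
proof (rule ccontr)
  assume "\<not> ?thesis"
  then have A: "\<And>a. a \<in> A \<Longrightarrow> i \<in> L a" by blast
  define c where "c v = (if v \<in> A then i else (SOME k. k \<in> L v \<and> k \<noteq> i))" for v
  have B: "c b \<in> L b \<and> c b \<noteq> i" if "b \<in> B" for b
  proof -
    have "b \<in> V" "b \<notin> A" using bip that by (auto simp: bipartition_def)
    then show ?thesis using someI_ex[OF ex_color_avoiding[OF L[of b], of i]] by (simp add: c_def)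
  qed
  have "colorable V E L"
  proof (rule colorableI[OF bip])
    show "c v \<in> L v" if "v \<in> V" for v
      using that bip A[of v] B[of v] by (auto simp: bipartition_def c_def)
    show "c a \<noteq> c b" if "a \<in> A" "b \<in> B" "{a, b} \<in> E" for a b
      using that B[of b] by (auto simp: c_def)
  qed
  then show False using unc by blast
qed

text \<open>If a vertex missing colour \<open>i\<close> and a vertex missing \<open>j\<close> on the other side are not adjacent, colour
  the first side by \<open>i\<close> except that the first vertex gets the third colour, and its neighbours by \<open>j\<close>.\<close>

lemma uncolorable_adjacent:
  assumes bip: "bipartition V E A B" and L: "\<And>v. v \<in> V \<Longrightarrow> 2 \<le> card (L v)"
    and unc: "\<not> colorable V E L"
    and a: "a \<in> A" "k \<in> L a" and b: "b \<in> B"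
    and ua: "\<And>v. v \<in> A \<Longrightarrow> i \<notin> L v \<Longrightarrow> v = a" and ub: "\<And>v. v \<in> B \<Longrightarrow> j \<notin> L v \<Longrightarrow> v = b"
    and ijk: "i \<noteq> j" "k \<noteq> i" "k \<noteq> j"
  shows "{a, b} \<in> E"
proof (rule ccontr)
  assume nadj: "{a, b} \<notin> E"
  have AB: "A \<union> B = V" "A \<inter> B = {}" using bip by (auto simp: bipartition_def)
  define c where "c v = (if v \<in> A then (if v = a then k else i)
    else if {a, v} \<in> E then j else (SOME k. k \<in> L v \<and> k \<noteq> i))" for v
  have B: "c v \<in> L v \<and> c v \<noteq> i" if "v \<in> B" for v
  proof -
    have v: "v \<in> V" "v \<notin> A" using AB that by blast+
    show ?thesis
    proof (cases "{a, v} \<in> E")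
      case True
      then have "j \<in> L v" using ub[OF that] nadj by blast
      then show ?thesis using v True ijk by (simp add: c_def)
    next
      case False
      then show ?thesis using someI_ex[OF ex_color_avoiding[OF L[OF v(1)], of i]] v by (simp add: c_def)
    qed
  qed
  have "colorable V E L"
  proof (rule colorableI[OF bip])
    show "c v \<in> L v" if "v \<in> V" for v
    proof (cases "v \<in> A")
      case True
      then show ?thesis using a ua[of v] by (auto simp: c_def)
    next
      case False
      then show ?thesis using that AB B[of v] by blast
    qed
    show "c u \<noteq> c v" if "u \<in> A" "v \<in> B" "{u, v} \<in> E" for u v
    proof (cases "u = a")
      case True
      have "v \<notin> A" using AB that by blast
      then show ?thesis using that True ijk by (simp add: c_def)
    next
      case False
      then have "c u = i" using that(1) by (simp add: c_def)
      then show ?thesis using B[OF that(2)] by simp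
    qed
  qed
  then show False using unc by blast
qed

text \<open>Three vertices on each side, one per missing colour, already exhaust \<open>S\<close>.
  So each colour is missing from exactly one vertex on each side, which is the uniqueness that
  \<open>uncolorable_adjacent\<close> asks for.\<close>

lemma uncolorable_structure:
  assumes bip: "bipartition V E A B" and fin: "finite V"
    and L: "\<And>v. v \<in> V \<Longrightarrow> L v \<subseteq> {1..3} \<and> card (L v) \<in> {2, 3}"
    and S: "S = {v \<in> V. card (L v) = 2}" "card S \<le> 6"
    and unc: "\<not> colorable V E L"
  obtains a b where
    "\<And>i. i \<in> {1..3} \<Longrightarrow> a i \<in> A \<and> L (a i) = {1..3} - {i}"
    "\<And>i. i \<in> {1..3} \<Longrightarrow> b i \<in> B \<and> L (b i) = {1..3} - {i}"
    "\<And>i j. i \<in> {1..3} \<Longrightarrow> j \<in> {1..3} \<Longrightarrow> i \<noteq> j \<Longrightarrow> {a i, b j} \<in> E"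
    "S = a ` {1..3} \<union> b ` {1..3}" "card S = 6"
proof -
  have L2: "2 \<le> card (L v)" if "v \<in> V" for v using L[OF that] by auto
  have AB: "A \<union> B = V" "A \<inter> B = {}" using bip by (auto simp: bipartition_def)
  have miss: "L v = {1..3} - {i}" if "v \<in> V" "i \<in> {1..3}" "i \<notin> L v" for v i
    using three_minus[OF _ L2[OF that(1)] that(2,3)] L[OF that(1)] by blast
  have "\<exists>v. v \<in> A \<and> L v = {1..3} - {i}" if "i \<in> {1..3}" for i
    using uncolorable_missing[OF bip L2 unc, of i] miss[OF _ that] AB by blast
  then obtain a where a: "\<And>i. i \<in> {1..3} \<Longrightarrow> a i \<in> A \<and> L (a i) = {1..3} - {i}" by metis
  have "\<exists>v. v \<in> B \<and> L v = {1..3} - {i}" if "i \<in> {1..3}" for i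
    using uncolorable_missing[OF bipartition_commute[OF bip] L2 unc, of i] miss[OF _ that] AB by blast
  then obtain b where b: "\<And>i. i \<in> {1..3} \<Longrightarrow> b i \<in> B \<and> L (b i) = {1..3} - {i}" by metis
  have inj: "i = j" if "i \<in> {1..3}" "{1..3} - {i} = {1..3} - {j}" for i j :: nat
    using that by blast
  have inj_a: "inj_on a {1..3}"
  proof (rule inj_onI)
    fix i j assume "i \<in> {1..3}" "j \<in> {1..3}" "a i = a j"
    then show "i = j" using a[of i] a[of j] by (intro inj) simp_all
  qed
  have inj_b: "inj_on b {1..3}"
  proof (rule inj_onI)
    fix i j assume "i \<in> {1..3}" "j \<in> {1..3}" "b i = b j"
    then show "i = j" using b[of i] b[of j] by (intro inj) simp_all
  qed
  let ?T = "a ` {1..3} \<union> b ` {1..3}"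
  have aA: "a i \<in> A" and aL: "L (a i) = {1..3} - {i}" if "i \<in> {1..3}" for i
    using a[OF that] by simp_all
  have bB: "b i \<in> B" and bL: "L (b i) = {1..3} - {i}" if "i \<in> {1..3}" for i
    using b[OF that] by simp_all
  have img: "a ` {1..3} \<subseteq> A" "b ` {1..3} \<subseteq> B" using aA bB by (simp_all add: image_subset_iff)
  then have "a ` {1..3} \<inter> b ` {1..3} = {}" using AB(2) by blast
  then have "card ?T = card (a ` {1..3}) + card (b ` {1..3})" by (intro card_Un_disjoint) simp_all
  then have T: "card ?T = 6" unfolding card_image[OF inj_a] card_image[OF inj_b] by simp
  have card2: "card ({1..3} - {i}) = 2" if "i \<in> {1..3}" for i :: nat using that by simp
  have "a i \<in> S" "b i \<in> S" if "i \<in> {1..3}" for i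
    unfolding S(1) using aA[OF that] bB[OF that] AB(1) aL[OF that] bL[OF that] card2[OF that]
    by auto
  then have "?T \<subseteq> S" by (simp add: image_subset_iff)
  moreover have "finite S" using fin S by simp
  ultimately have ST: "S = ?T" using S(2) T by (metis card_seteq)
  have inS: "v \<in> S" if "i \<in> {1..3}" "v \<in> V" "i \<notin> L v" for i v
    unfolding S(1) using miss[OF that(2,1,3)] card2[OF that(1)] that(2) by simp
  have ua: "v = a i" if "i \<in> {1..3}" and v: "v \<in> A" and "i \<notin> L v" for i v
  proof -
    have "v \<in> ?T" using inS[of i v] that AB(1) ST by blast
    then have "v \<in> a ` {1..3}" using img(2) v AB(2) by blast
    then obtain i' where i': "i' \<in> {1..3}" "v = a i'" by (elim imageE)
    then have "i = i'" using aL[OF i'(1)] that(1,3) by simp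
    then show ?thesis using i' by simp
  qed
  have ub: "v = b i" if "i \<in> {1..3}" and v: "v \<in> B" and "i \<notin> L v" for i v
  proof -
    have "v \<in> ?T" using inS[of i v] that AB(1) ST by blast
    then have "v \<in> b ` {1..3}" using img(1) v AB(2) by blast
    then obtain i' where i': "i' \<in> {1..3}" "v = b i'" by (elim imageE)
    then have "i = i'" using bL[OF i'(1)] that(1,3) by simp
    then show ?thesis using i' by simp
  qed
  have "{a i, b j} \<in> E" if "i \<in> {1..3}" "j \<in> {1..3}" "i \<noteq> j" for i j
  proof -
    have "\<exists>k. k \<in> {1..3} - {i} \<and> k \<noteq> j"
      by (rule ex_color_avoiding) (simp only: card2[OF that(1)] order_refl)
    then obtain k where k: "k \<in> {1..3}" "k \<noteq> i" "k \<noteq> j" by blast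
    have "k \<in> L (a i)" using a[OF that(1)] k by simp
    then show ?thesis
      using uncolorable_adjacent[OF bip L2 unc _ _ _ ua[OF that(1)] ub[OF that(2)] that(3) k(2,3)]
        a[OF that(1)] b[OF that(2)] by simp
  qed
  then show ?thesis using that[OF a b _ ST] T ST by simp
qed


lemma choosable_few:
  assumes "CH23_instance V E f" "bipartite V E" "card (two_list_vertices V f) \<le> 5"
  shows "choosable V E f 3"
  unfolding choosable_def
proof (intro allI impI)
  fix L :: "'a \<Rightarrow> nat set"
  assume L: "\<forall>v \<in> V. L v \<subseteq> {1..3} \<and> card (L v) = f v"
  obtain A B where bip: "bipartition V E A B"
    using assms(2) unfolding bipartite_def bipartition_def by blast
  have "finite V" and f: "\<And>v. v \<in> V \<Longrightarrow> f v \<in> {2, 3}"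
    using assms(1) by (auto simp: CH23_instance_def simple_graph_def)
  have S: "two_list_vertices V f = {v \<in> V. card (L v) = 2}"
    using L by (auto simp: two_list_vertices_def)
  have "colorable V E L"
  proof (rule ccontr)
    assume unc: "\<not> colorable V E L"
    have "L v \<subseteq> {1..3} \<and> card (L v) \<in> {2, 3}" if "v \<in> V" for v
      using L f[OF that] that by simp
    moreover have "card (two_list_vertices V f) \<le> 6" using assms(3) by simp
    ultimately have "card (two_list_vertices V f) = 6"
      using uncolorable_structure[OF bip \<open>finite V\<close> _ S _ unc] by metis
    then show False using assms(3) by simp
  qed
  then show "\<exists>c. proper_coloring E c \<and> (\<forall>v \<in> V. c v \<in> L v)" by (simp add: colorable_def)
qed

section \<open>Hexagons and their colourings\<close>

definition hexagon :: "'a set set \<Rightarrow> (nat \<Rightarrow> 'a) \<Rightarrow> bool" where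
  "hexagon E w \<longleftrightarrow> inj_on w {..<6} \<and> {w 0, w 1} \<in> E \<and> {w 1, w 2} \<in> E \<and> {w 2, w 3} \<in> E \<and>
    {w 3, w 4} \<in> E \<and> {w 4, w 5} \<in> E \<and> {w 5, w 0} \<in> E"

definition chordless :: "'a set set \<Rightarrow> (nat \<Rightarrow> 'a) \<Rightarrow> bool" where
  "chordless E w \<longleftrightarrow> {w 0, w 3} \<notin> E \<and> {w 1, w 4} \<notin> E \<and> {w 2, w 5} \<notin> E"

lemma lessThan_6: "{..<6::nat} = {0, 1, 2, 3, 4, 5}"
  by auto

lemma all_less_6: "(\<forall>i < 6. P i) \<longleftrightarrow> P 0 \<and> P 1 \<and> P 2 \<and> P 3 \<and> P 4 \<and> P (5::nat)"
  by (simp add: numeral_eq_Suc All_less_Suc conj_ac)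

lemma cycle_edges_6: "cycle_edges 6 = {{0, 1}, {1, 2}, {2, 3}, {3, 4}, {4, 5}, {5, 0}}"
proof -
  have "cycle_edges 6 = (\<lambda>i. {i, (i + 1) mod 6}) ` {..<6}" by (auto simp: cycle_edges_def)
  then show ?thesis unfolding lessThan_6 by (simp del: One_nat_def)
qed

lemma bipartition_sides:
  assumes "bipartition V E A B" "{u, v} \<in> E"
  shows "u \<in> A \<longleftrightarrow> v \<in> B" "u \<in> B \<longleftrightarrow> v \<in> A" "u \<in> A \<or> u \<in> B"
proof -
  have "\<exists>a \<in> A. \<exists>b \<in> B. {u, v} = {a, b}"
    using assms unfolding bipartition_def by (elim conjE) (drule (1) bspec)
  then obtain a b where ab: "a \<in> A" "b \<in> B" "{u, v} = {a, b}" by (elim bexE)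
  have "A \<inter> B = {}" using assms(1) by (simp add: bipartition_def)
  then show "u \<in> A \<longleftrightarrow> v \<in> B" "u \<in> B \<longleftrightarrow> v \<in> A" "u \<in> A \<or> u \<in> B"
    using ab unfolding doubleton_eq_iff by blast+
qed

text \<open>Vertices at distance two along the cycle lie on the same side.\<close>

lemma hexagon_no_short_chords:
  assumes bip: "bipartition V E A B" and "hexagon E w"
  shows "{w 0, w 2} \<notin> E" "{w 1, w 3} \<notin> E" "{w 2, w 4} \<notin> E" "{w 3, w 5} \<notin> E"
    "{w 4, w 0} \<notin> E" "{w 5, w 1} \<notin> E"
proof -
  have "A \<inter> B = {}" using bip by (simp add: bipartition_def)
  then show "{w 0, w 2} \<notin> E" "{w 1, w 3} \<notin> E" "{w 2, w 4} \<notin> E" "{w 3, w 5} \<notin> E"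
    "{w 4, w 0} \<notin> E" "{w 5, w 1} \<notin> E"
    using assms(2) bipartition_sides[OF bip] unfolding hexagon_def disjoint_iff by meson+
qed

text \<open>Bipartiteness already excludes the six short chords, so being induced only concerns the
  three pairs of opposite vertices.\<close>

lemma induces_C6_iff:
  assumes bip: "bipartition V E A B" and loops: "\<And>e. e \<in> E \<Longrightarrow> card e = 2"
  shows "induces_C6 E S \<longleftrightarrow> (\<exists>w. w ` {..<6} = S \<and> hexagon E w \<and> chordless E w)"
proof
  assume "induces_C6 E S"
  then obtain \<phi> where \<phi>: "bij_betw \<phi> S {..<6::nat}" "(\<lambda>e. \<phi> ` e) ` induced_edges E S = cycle_edges 6"
    unfolding induces_C6_def graph_iso_def by blast
  define w where "w = inv_into S \<phi>"
  have w: "bij_betw w {..<6} S" using bij_betw_inv_into[OF \<phi>(1)] by (simp add: w_def)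
  have \<phi>w: "\<phi> (w i) = i" if "i < 6" for i
    using \<phi>(1) that unfolding w_def by (simp add: bij_betw_inv_into_right)
  have wS: "w i \<in> S" if "i < 6" for i using w that by (auto simp: bij_betw_def)
  have inj: "inj_on \<phi> S" using \<phi>(1) by (simp add: bij_betw_def)
  have E: "{w i, w j} \<in> E \<longleftrightarrow> {i, j} \<in> cycle_edges 6" if "i < 6" "j < 6" for i j
  proof
    assume "{w i, w j} \<in> E"
    then have "{w i, w j} \<in> induced_edges E S" using wS that by (simp add: induced_edges_def)
    then have "\<phi> ` {w i, w j} \<in> cycle_edges 6" unfolding \<phi>(2)[symmetric] by (rule imageI)
    then show "{i, j} \<in> cycle_edges 6" using \<phi>w that by simp
  next
    assume "{i, j} \<in> cycle_edges 6"
    then obtain e where e: "e \<in> induced_edges E S" "\<phi> ` e = {i, j}" using \<phi>(2) by (metis imageE)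
    moreover have "\<phi> ` {w i, w j} = {i, j}" using \<phi>w that by simp
    moreover have "e \<subseteq> S" using e(1) by (simp add: induced_edges_def)
    ultimately have "e = {w i, w j}"
      using inj_on_image_eq_iff[OF inj \<open>e \<subseteq> S\<close>, of "{w i, w j}"] wS that by simp
    then show "{w i, w j} \<in> E" using e(1) by (simp add: induced_edges_def)
  qed
  have "hexagon E w" "chordless E w"
    using w E unfolding hexagon_def chordless_def cycle_edges_6
    by (simp_all add: bij_betw_def doubleton_eq_iff)
  moreover have "w ` {..<6} = S" using w by (simp add: bij_betw_def)
  ultimately show "\<exists>w. w ` {..<6} = S \<and> hexagon E w \<and> chordless E w" by blast
next
  assume "\<exists>w. w ` {..<6} = S \<and> hexagon E w \<and> chordless E w"
  then obtain w where w: "w ` {..<6} = S" "hexagon E w" "chordless E w" by blast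
  have inj: "inj_on w {..<6}" using w(2) by (simp add: hexagon_def)
  define \<phi> where "\<phi> = inv_into {..<6} w"
  have bij: "bij_betw w {..<6} S" using w inj by (simp add: bij_betw_def)
  have \<phi>w: "\<phi> (w i) = i" if "i < 6" for i using inj that by (simp add: \<phi>_def)
  have chords: "{w i, w j} \<in> E \<longleftrightarrow> {i, j} \<in> cycle_edges 6" if "i < 6" "j < 6" for i j
  proof -
    have "{w i, w i} \<notin> E" using loops[of "{w i, w i}"] by auto
    moreover have "i \<in> {0, 1, 2, 3, 4, 5}" "j \<in> {0, 1, 2, 3, 4, 5}"
      using that unfolding lessThan_6[symmetric] by simp_all
    ultimately show ?thesis
      using hexagon_no_short_chords[OF bip w(2)] w(2,3)
      unfolding cycle_edges_6 hexagon_def chordless_def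
      by (elim insertE) (simp_all add: doubleton_eq_iff insert_commute)
  qed
  have "(\<lambda>e. \<phi> ` e) ` induced_edges E S = cycle_edges 6"
  proof (intro equalityI subsetI)
    fix e' assume "e' \<in> (\<lambda>e. \<phi> ` e) ` induced_edges E S"
    then obtain e where e: "e \<in> E" "e \<subseteq> S" "e' = \<phi> ` e" by (auto simp: induced_edges_def)
    obtain u v where uv: "e = {u, v}" using loops[OF e(1)] by (auto simp: card_2_iff)
    then have "u \<in> w ` {..<6}" "v \<in> w ` {..<6}" using e(2) w(1) by simp_all
    then obtain i j where "u = w i" "v = w j" "i < 6" "j < 6" by (elim imageE) simp
    then show "e' \<in> cycle_edges 6" using e uv chords[of i j] \<phi>w by simp
  next
    fix e' :: "nat set" assume e': "e' \<in> cycle_edges 6"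
    then obtain i j where ij: "e' = {i, j}" "i < 6" "j < 6" by (auto simp: cycle_edges_def)
    moreover have "w i \<in> S" "w j \<in> S" using ij w(1) by auto
    ultimately have "{w i, w j} \<in> induced_edges E S"
      using e' chords[of i j] by (simp add: induced_edges_def)
    moreover have "e' = \<phi> ` {w i, w j}" using ij \<phi>w by simp
    ultimately show "e' \<in> (\<lambda>e. \<phi> ` e) ` induced_edges E S" by (rule rev_image_eqI)
  qed
  moreover have "bij_betw \<phi> S {..<6}" unfolding \<phi>_def by (rule bij_betw_inv_into[OF bij])
  ultimately show "induces_C6 E S" unfolding induces_C6_def graph_iso_def by blast
qed

lemma image_6: "w ` {..<6::nat} = {w 0, w 1, w 2, w 3, w 4, w 5}"
  unfolding lessThan_6 by simp

text \<open>The colour of \<open>x0\<close> determines all others: the value 2 propagates backwards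
  around the cycle, starting with \<open>x5\<close>, and the value 3 forwards, starting with
  \<open>x1\<close>.\<close>

lemma hexagon_colors_cases:
  fixes x0 x1 x2 x3 x4 x5 :: nat
  assumes "x0 = 2 \<or> x0 = 3" "x1 = 1 \<or> x1 = 3" "x2 = 1 \<or> x2 = 2"
    "x3 = 2 \<or> x3 = 3" "x4 = 1 \<or> x4 = 3" "x5 = 1 \<or> x5 = 2"
    and "x0 \<noteq> x1" "x1 \<noteq> x2" "x2 \<noteq> x3" "x3 \<noteq> x4" "x4 \<noteq> x5" "x5 \<noteq> x0"
  shows "x0 = 2 \<and> x1 = 3 \<and> x2 = 1 \<and> x3 = 2 \<and> x4 = 3 \<and> x5 = 1 \<or>
    x0 = 3 \<and> x1 = 1 \<and> x2 = 2 \<and> x3 = 3 \<and> x4 = 1 \<and> x5 = 2"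
  using assms by auto

lemma not_one_cases: "x \<in> {1..3::nat} - {Suc 0} \<Longrightarrow> x = 2 \<or> x = 3"
  "x \<in> {1..3::nat} - {Suc 1} \<Longrightarrow> x = 1 \<or> x = 3"
  "x \<in> {1..3::nat} - {Suc 2} \<Longrightarrow> x = 1 \<or> x = 2"
  by auto

lemma hexagon_colors:
  assumes "hexagon E w" "proper_coloring E c"
    and "\<And>k. k < 6 \<Longrightarrow> c (w k) \<in> {1..3} - {Suc (k mod 3)}"
  shows "c (w 0) = 2 \<and> c (w 1) = 3 \<and> c (w 2) = 1 \<and> c (w 3) = 2 \<and> c (w 4) = 3 \<and> c (w 5) = 1 \<or>
    c (w 0) = 3 \<and> c (w 1) = 1 \<and> c (w 2) = 2 \<and> c (w 3) = 3 \<and> c (w 4) = 1 \<and> c (w 5) = 2"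
proof (rule hexagon_colors_cases)
  show "c (w 0) \<noteq> c (w 1)" "c (w 1) \<noteq> c (w 2)" "c (w 2) \<noteq> c (w 3)" "c (w 3) \<noteq> c (w 4)"
    "c (w 4) \<noteq> c (w 5)" "c (w 5) \<noteq> c (w 0)"
    using assms(1,2) unfolding hexagon_def proper_coloring_def by blast+
  show "c (w 0) = 2 \<or> c (w 0) = 3" using not_one_cases(1) assms(3)[of 0] by simp
  show "c (w 1) = 1 \<or> c (w 1) = 3" using not_one_cases(2) assms(3)[of 1] by simp
  show "c (w 2) = 1 \<or> c (w 2) = 2" using not_one_cases(3) assms(3)[of 2] by simp
  show "c (w 3) = 2 \<or> c (w 3) = 3" using not_one_cases(1) assms(3)[of 3] by simp
  show "c (w 4) = 1 \<or> c (w 4) = 3" using not_one_cases(2) assms(3)[of 4] by simp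
  show "c (w 5) = 1 \<or> c (w 5) = 2" using not_one_cases(3) assms(3)[of 5] by simp
qed

section \<open>Reduction to a single list assignment\<close>

locale hexagon_instance =
  fixes V :: "'a set" and E f A B w
  assumes inst: "CH23_instance V E f" and bip: "bipartition V E A B"
    and w: "w ` {..<6::nat} = two_list_vertices V f" and hex: "hexagon E w"
begin

lemma inj_w: "inj_on w {..<6}"
  using hex by (simp add: hexagon_def)

lemma w_in_V: "k < 6 \<Longrightarrow> w k \<in> V"
  using w by (auto simp: two_list_vertices_def)

lemma edge_in_V: "{u, v} \<in> E \<Longrightarrow> u \<in> V \<and> v \<in> V"
  using inst unfolding CH23_instance_def simple_graph_def by blast

lemma f_cases: "v \<in> V \<Longrightarrow> f v = 2 \<or> f v = 3"
  using inst unfolding CH23_instance_def by blast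

text \<open>Opposite vertices \<open>w k\<close> and \<open>w (k + 3)\<close> miss the same colour.
  The proof of \<open>coloring_imp_choosable\<close> shows that on a chordless hexagon nothing else
  can fail, up to renaming colours.\<close>

definition hexlist :: "'a \<Rightarrow> nat set" where
  "hexlist v = {1..3} - {Suc (k mod 3) | k. k < 6 \<and> v = w k}"

lemma hexlist_w: "k < 6 \<Longrightarrow> hexlist (w k) = {1..3} - {Suc (k mod 3)}"
proof -
  assume "k < 6"
  then have "k' = k" if "k' < 6" "w k = w k'" for k'
    using inj_onD[OF inj_w that(2)] that(1) by simp
  then show ?thesis unfolding hexlist_def using \<open>k < 6\<close> by blast
qed

lemma choosable_imp_coloring:
  assumes "choosable V E f 3"
  shows "\<exists>c. proper_coloring E c \<and> (\<forall>v \<in> V. c v \<in> {1..3}) \<and> (\<forall>k < 6. c (w k) \<noteq> Suc (k mod 3))"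
proof -
  have "hexlist v \<subseteq> {1..3} \<and> card (hexlist v) = f v" if "v \<in> V" for v
  proof (cases "f v = 2")
    case True
    then have "v \<in> w ` {..<6}" using that w by (simp add: two_list_vertices_def)
    then obtain k where k: "k < 6" "v = w k" by auto
    have "Suc (k mod 3) \<in> {1..3}" using mod_less_divisor[of 3 k] by auto
    then show ?thesis using hexlist_w[OF k(1)] k True by simp
  next
    case False
    then have "v \<notin> w ` {..<6}" using w by (simp add: two_list_vertices_def)
    then have "hexlist v = {1..3}" by (auto simp: hexlist_def)
    then show ?thesis using False f_cases[OF that] by simp
  qed
  then have "\<exists>c. proper_coloring E c \<and> (\<forall>v \<in> V. c v \<in> hexlist v)"
    using assms[unfolded choosable_def, THEN spec, of hexlist] by simp
  then obtain c where c: "proper_coloring E c" "\<And>v. v \<in> V \<Longrightarrow> c v \<in> hexlist v" by metis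
  have "c (w k) \<noteq> Suc (k mod 3)" if "k < 6" for k
    using c(2)[OF w_in_V[OF that]] hexlist_w[OF that] by simp
  moreover have "c v \<in> {1..3}" if "v \<in> V" for v
    using c(2)[OF that] unfolding hexlist_def by blast
  ultimately show ?thesis using c(1) by blast
qed

lemma coloring_colors:
  assumes "proper_coloring E c" "\<forall>v \<in> V. c v \<in> {1..3}" "\<forall>k < 6. c (w k) \<noteq> Suc (k mod 3)"
  shows "c (w 0) = 2 \<and> c (w 1) = 3 \<and> c (w 2) = 1 \<and> c (w 3) = 2 \<and> c (w 4) = 3 \<and> c (w 5) = 1 \<or>
    c (w 0) = 3 \<and> c (w 1) = 1 \<and> c (w 2) = 2 \<and> c (w 3) = 3 \<and> c (w 4) = 1 \<and> c (w 5) = 2"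
  by (rule hexagon_colors[OF hex assms(1)]) (use assms(2,3) w_in_V in blast)

text \<open>For the lists \<open>hexlist\<close>, every colouring gives opposite vertices equal
  colours, so a chord would make this assignment uncolourable.\<close>

lemma choosable_imp_chordless:
  assumes "choosable V E f 3"
  shows "chordless E w"
proof -
  obtain c where c: "proper_coloring E c" "\<forall>v \<in> V. c v \<in> {1..3}" "\<forall>k < 6. c (w k) \<noteq> Suc (k mod 3)"
    using choosable_imp_coloring[OF assms] by blast
  have "c (w 0) = c (w 3)" "c (w 1) = c (w 4)" "c (w 2) = c (w 5)"
    using coloring_colors[OF c] by auto
  then show ?thesis using c(1) unfolding chordless_def proper_coloring_def by blast
qed

lemma opposite_sides:
  assumes "{x0, x1} \<in> E" "{x1, x2} \<in> E" "{x2, x3} \<in> E"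
  shows "x0 \<in> A \<and> x3 \<in> B \<or> x0 \<in> B \<and> x3 \<in> A"
  using bipartition_sides[OF bip assms(1)] bipartition_sides[OF bip assms(2)]
    bipartition_sides[OF bip assms(3)] by blast

text \<open>In an uncolourable assignment, vertices on different sides with different missing
  colours are adjacent. Opposite vertices are not adjacent, so they miss the same colour, and a
  renaming of the colours of \<open>c\<close> fits the assignment after all.\<close>

lemma coloring_imp_choosable:
  assumes chordless: "chordless E w"
    and c: "proper_coloring E c" "\<forall>v \<in> V. c v \<in> {1..3}" "\<forall>k < 6. c (w k) \<noteq> Suc (k mod 3)"
  shows "choosable V E f 3"
  unfolding choosable_def colorable_def[symmetric]
proof (intro allI impI, rule ccontr)
  fix L :: "'a \<Rightarrow> nat set"
  assume L: "\<forall>v \<in> V. L v \<subseteq> {1..3} \<and> card (L v) = f v" and unc: "\<not> colorable V E L"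
  let ?S = "two_list_vertices V f"
  have "finite V" using inst by (simp add: CH23_instance_def simple_graph_def)
  have S: "?S = {v \<in> V. card (L v) = 2}"
    using L by (auto simp: two_list_vertices_def)
  have L': "L v \<subseteq> {1..3} \<and> card (L v) \<in> {2, 3}" if "v \<in> V" for v
    using L f_cases[OF that] that by auto
  have S6: "card ?S \<le> 6" using card_image[OF inj_w] w by simp
  show False
  proof (rule uncolorable_structure[OF bip \<open>finite V\<close> L' S S6 unc])
    fix a b :: "nat \<Rightarrow> 'a"
    assume a: "\<And>i. i \<in> {1..3} \<Longrightarrow> a i \<in> A \<and> L (a i) = {1..3} - {i}"
      and b: "\<And>i. i \<in> {1..3} \<Longrightarrow> b i \<in> B \<and> L (b i) = {1..3} - {i}"
      and ab: "\<And>i j. i \<in> {1..3} \<Longrightarrow> j \<in> {1..3} \<Longrightarrow> i \<noteq> j \<Longrightarrow> {a i, b j} \<in> E"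
      and Sab: "?S = a ` {1..3} \<union> b ` {1..3}"
    have AB: "A \<inter> B = {}" using bip by (simp add: bipartition_def)
    define l where "l v = (THE i. i \<in> {1..3} \<and> L v = {1..3} - {i})" for v
    have l: "l v = i" if "i \<in> {1..3}" "L v = {1..3} - {i}" for v i
      unfolding l_def by (rule the_equality) (use that in blast)+
    have la: "l (a i) = i" and lb: "l (b i) = i" if "i \<in> {1..3}" for i
      using a[OF that] b[OF that] by (intro l[OF that]; simp)+
    have lS: "l v \<in> {1..3} \<and> L v = {1..3} - {l v}" if "v \<in> ?S" for v
    proof -
      have "v \<in> a ` {1..3} \<or> v \<in> b ` {1..3}" using that unfolding Sab Un_iff .
      then show ?thesis
      proof (elim disjE imageE)
        fix i assume i: "v = a i" "i \<in> {1..3}"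
        then show ?thesis using a[OF i(2)] la[OF i(2)] by simp
      next
        fix i assume i: "v = b i" "i \<in> {1..3}"
        then show ?thesis using b[OF i(2)] lb[OF i(2)] by simp
      qed
    qed
    have far: "l x = l y" if "x \<in> ?S" "y \<in> ?S" "x \<in> A" "y \<in> B" "{x, y} \<notin> E" for x y
    proof -
      have "a ` {1..3} \<subseteq> A" "b ` {1..3} \<subseteq> B"
        by (intro image_subsetI conjunct1[OF a] conjunct1[OF b]; assumption)+
      moreover have "x \<in> a ` {1..3} \<or> x \<in> b ` {1..3}" "y \<in> a ` {1..3} \<or> y \<in> b ` {1..3}"
        using that(1,2) unfolding Sab Un_iff .
      moreover have "x \<notin> B" "y \<notin> A" using that(3,4) AB by blast+
      ultimately have "x \<in> a ` {1..3}" "y \<in> b ` {1..3}" by (metis subsetD)+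
      then obtain i j where ij: "i \<in> {1..3}" "x = a i" "j \<in> {1..3}" "y = b j" by (elim imageE)
      then show ?thesis using ab[OF ij(1,3)] la[OF ij(1)] lb[OF ij(3)] that(5) by (cases "i = j") simp_all
    qed
    have wS: "w k \<in> ?S" if "k < 6" for k using w that by blast
    have far': "l x = l y" if "x \<in> ?S" "y \<in> ?S" "x \<in> A \<and> y \<in> B \<or> x \<in> B \<and> y \<in> A" "{x, y} \<notin> E" for x y
      using that(3)
    proof
      assume "x \<in> A \<and> y \<in> B"
      then show ?thesis using far[of x y] that by blast
    next
      assume "x \<in> B \<and> y \<in> A"
      moreover have "{y, x} \<notin> E" using that(4) by (simp add: insert_commute)
      ultimately show ?thesis using far[of y x] that by simp
    qed
    have opp: "l (w 0) = l (w 3)" "l (w 1) = l (w 4)" "l (w 2) = l (w 5)"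
      using hex chordless opposite_sides[of "w 0" "w 1" "w 2" "w 3"]
        opposite_sides[of "w 1" "w 2" "w 3" "w 4"] opposite_sides[of "w 2" "w 3" "w 4" "w 5"]
      unfolding hexagon_def chordless_def by (intro far' wS; simp)+
    have "l ` ?S = {1..3}"
    proof
      show "l ` ?S \<subseteq> {1..3}" using lS by blast
      show "{1..3} \<subseteq> l ` ?S"
      proof
        fix i :: nat assume i: "i \<in> {1..3}"
        then have "a i \<in> ?S" unfolding Sab by blast
        then show "i \<in> l ` ?S" using la[OF i] by (metis imageI)
      qed
    qed
    moreover have "l ` ?S = {l (w 0), l (w 1), l (w 2)}"
      unfolding w[symmetric] image_6 using opp by auto
    ultimately have "card {l (w 0), l (w 1), l (w 2)} = 3" by simp
    then have dist: "l (w 0) \<noteq> l (w 1)" "l (w 1) \<noteq> l (w 2)" "l (w 0) \<noteq> l (w 2)"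
      by (auto simp: card_insert_if split: if_splits)
    \<comment> \<open>The colour of each of \<open>w 0\<close>, \<open>w 1\<close>,
      \<open>w 2\<close> is renamed to the colour missing at the next one, cyclically. Being defined
      relative to \<open>c\<close>, the renaming treats both colourings of the hexagon
      alike.\<close>
    define c' where "c' v = (if c v = c (w 0) then l (w 1) else if c v = c (w 1) then l (w 2) else l (w 0))" for v
    have cw: "c (w 0) \<noteq> c (w 1)" "c (w 1) \<noteq> c (w 2)" "c (w 0) \<noteq> c (w 2)"
      "c (w 3) = c (w 0)" "c (w 4) = c (w 1)" "c (w 5) = c (w 2)"
      "{c (w 0), c (w 1), c (w 2)} = {1..3}"
      using coloring_colors[OF c] by auto
    have "proper_coloring E c'"
      unfolding proper_coloring_def
    proof (intro allI impI)
      fix u v assume uv: "{u, v} \<in> E"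
      have "c u \<in> {c (w 0), c (w 1), c (w 2)}" "c v \<in> {c (w 0), c (w 1), c (w 2)}"
        using cw(7) c(2) edge_in_V[OF uv] by simp_all
      moreover have "c u \<noteq> c v" using c(1) uv by (simp add: proper_coloring_def)
      ultimately show "c' u \<noteq> c' v" using cw(1-3) dist unfolding c'_def by auto
    qed
    moreover have "c' v \<in> L v" if "v \<in> V" for v
    proof (cases "v \<in> ?S")
      case True
      then have "v \<in> {w 0, w 1, w 2, w 3, w 4, w 5}" unfolding w[symmetric] image_6 .
      moreover have "l (w 0) \<in> {1..3}" "l (w 1) \<in> {1..3}" "l (w 2) \<in> {1..3}" using lS wS by simp_all
      ultimately have "c' v \<in> {1..3} - {l v}"
        using cw(1-6) dist opp unfolding c'_def by (elim insertE) simp_all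
      then show ?thesis using lS[OF True] by simp
    next
      case False
      then have "card (L v) = 3" using S that L'[OF that] by auto
      then have "L v = {1..3}" using L'[OF that] by (intro card_subset_eq) auto
      moreover have "c' v \<in> {1..3}" unfolding c'_def using lS wS by simp
      ultimately show ?thesis by simp
    qed
    ultimately show False using unc unfolding colorable_def by blast
  qed
qed

end

lemma no_hexagon_imp_choosable:
  assumes inst: "CH23_instance V E f" and bip: "bipartition V E A B"
    and six: "card (two_list_vertices V f) = 6"
    and no: "\<not> (\<exists>w. w ` {..<6} = two_list_vertices V f \<and> hexagon E w)"
  shows "choosable V E f 3"
  unfolding choosable_def colorable_def[symmetric]
proof (intro allI impI, rule ccontr)
  fix L :: "'a \<Rightarrow> nat set"
  assume L: "\<forall>v \<in> V. L v \<subseteq> {1..3} \<and> card (L v) = f v" and unc: "\<not> colorable V E L"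
  let ?S = "two_list_vertices V f"
  have "finite V" using inst by (simp add: CH23_instance_def simple_graph_def)
  have S: "?S = {v \<in> V. card (L v) = 2}"
    using L by (auto simp: two_list_vertices_def)
  have L': "L v \<subseteq> {1..3} \<and> card (L v) \<in> {2, 3}" if "v \<in> V" for v
    using L inst that unfolding CH23_instance_def by auto
  have S6: "card ?S \<le> 6" using six by simp
  show False
  proof (rule uncolorable_structure[OF bip \<open>finite V\<close> L' S S6 unc])
    fix a b :: "nat \<Rightarrow> 'a"
    assume ab: "\<And>i j. i \<in> {1..3} \<Longrightarrow> j \<in> {1..3} \<Longrightarrow> i \<noteq> j \<Longrightarrow> {a i, b j} \<in> E"
      and Sab: "?S = a ` {1..3} \<union> b ` {1..3}"
    \<comment> \<open>Sides alternate and consecutive indices differ, so consecutive vertices are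
      adjacent; equal indices come to lie opposite each other.\<close>
    define w where "w = nth [a 1, b 2, a 3, b 1, a 2, b (3::nat)]"
    have "{1..3::nat} = {1, 2, 3}" by auto
    then have w: "w ` {..<6} = ?S" unfolding image_6 w_def Sab by auto
    then have "inj_on w {..<6}" using six by (intro eq_card_imp_inj_on) simp_all
    moreover have "{w 1, w 2} = {a 3, b 2}" "{w 3, w 4} = {a 2, b 1}" "{w 5, w 0} = {a 1, b 3}"
      by (auto simp: w_def)
    ultimately have "hexagon E w" using ab unfolding hexagon_def by (simp add: w_def)
    then show False using no w by blast
  qed
qed

text \<open>A spanning hexagon either is chordless, hence induced, or has a chord, hence prevents
  choosability; without one, choosability is automatic. So the question becomes a search among six
  vertices.\<close>

theorem choosable_not_C6_iff:
  assumes inst: "CH23_instance V E f" and bip: "bipartition V E A B"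
    and six: "card (two_list_vertices V f) = 6"
  shows "choosable V E f 3 \<and> \<not> induces_C6 E (two_list_vertices V f) \<longleftrightarrow>
    \<not> (\<exists>w. w ` {..<6} = two_list_vertices V f \<and> hexagon E w)"
proof -
  have loops: "\<And>e. e \<in> E \<Longrightarrow> card e = 2"
    using inst by (simp add: CH23_instance_def simple_graph_def)
  show ?thesis
    using no_hexagon_imp_choosable[OF assms] induces_C6_iff[OF bip loops]
      hexagon_instance.choosable_imp_chordless[OF hexagon_instance.intro[OF inst bip]]
    by metis
qed

section \<open>From CNF formulas to graphs\<close>

locale cnf_graph =
  fixes Nc Nv :: nat and pos neg :: "nat \<Rightarrow> nat \<Rightarrow> bool"
  assumes Nc: "0 < Nc" and Nv: "0 < Nv"
begin

definition sat :: bool where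
  "sat \<longleftrightarrow> (\<exists>\<alpha> :: nat \<Rightarrow> bool. \<forall>c < Nc. \<exists>j < Nv. pos c j \<and> \<alpha> j \<or> neg c j \<and> \<not> \<alpha> j)"

text \<open>An arithmetical numbering, so that adjacency remains expressible by sums and
  products.\<close>

definition vt :: "nat \<Rightarrow> nat \<Rightarrow> nat \<Rightarrow> nat" where
  "vt k c j = 6 + ((c * Nv + j) * 5 + k)"

definition size_n :: nat where
  "size_n = 6 + Nc * Nv * 5"

text \<open>Vertices 0, 1, 2 and 3, 4, 5 are the reference colours on the two sides. Vertex \<open>vt 1 0 j\<close> is
  variable \<open>j\<close>: first reference colour for true, second for false. The vertices \<open>vt 0 c j\<close> read clause \<open>c\<close>
  from left to right: first colour before the chosen literal, third at it, second after it.
  The remaining vertices each forbid one unordered pair of colours on their neighbours.\<close>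

definition arc :: "nat \<Rightarrow> nat \<Rightarrow> bool" where
  "arc u v \<longleftrightarrow> u < 3 \<and> 3 \<le> v \<and> v < 6 \<and> u + 3 \<noteq> v \<or>
    (\<exists>c < Nc. \<exists>j < Nv.
      u = vt 0 c j \<and> v = vt 2 c j \<or>
      u = vt 0 c (Suc j) \<and> v = vt 2 c j \<and> Suc j < Nv \<or>
      u = vt 0 c j \<and> v = vt 3 c j \<and> \<not> pos c j \<or>
      u = vt 1 0 j \<and> v = vt 3 c j \<or>
      u = vt 0 c j \<and> v = vt 4 c j \<and> \<not> neg c j \<or>
      u = vt 1 0 j \<and> v = vt 4 c j \<or>
      u = vt 1 c j \<and> v = 5 \<or>
      u = vt 0 c j \<and> j = 0 \<and> v = 4 \<or>
      u = vt 0 c j \<and> Suc j = Nv \<and> v = 3 \<or>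
      u = 2 \<and> v = vt 2 c j \<or>
      u = 1 \<and> v = vt 3 c j \<or>
      u = 0 \<and> v = vt 4 c j)"

lemma arcI:
  assumes "c < Nc" "j < Nv" and "
      u = vt 0 c j \<and> v = vt 2 c j \<or>
      u = vt 0 c (Suc j) \<and> v = vt 2 c j \<and> Suc j < Nv \<or>
      u = vt 0 c j \<and> v = vt 3 c j \<and> \<not> pos c j \<or>
      u = vt 1 0 j \<and> v = vt 3 c j \<or>
      u = vt 0 c j \<and> v = vt 4 c j \<and> \<not> neg c j \<or>
      u = vt 1 0 j \<and> v = vt 4 c j \<or>
      u = vt 1 c j \<and> v = 5 \<or>
      u = vt 0 c j \<and> j = 0 \<and> v = 4 \<or>
      u = vt 0 c j \<and> Suc j = Nv \<and> v = 3 \<or>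
      u = 2 \<and> v = vt 2 c j \<or>
      u = 1 \<and> v = vt 3 c j \<or>
      u = 0 \<and> v = vt 4 c j"
  shows "arc u v"
  unfolding arc_def
  by (insert assms, rule disjI2, rule exI[of _ c], rule conjI, assumption, rule exI[of _ j],
      rule conjI, assumption+)

definition edges :: "nat set set" where
  "edges = {{u, v} | u v. arc u v}"

definition lists :: "nat \<Rightarrow> nat" where
  "lists v = (if v < 6 then 2 else 3)"

text \<open>Kinds 0 and 1, for clauses and variables, share a side with the references 0, 1, 2; the
  gadgets share one with 3, 4, 5. Each group is restricted by references of the other side, so these
  must exist on both.\<close>

definition side :: "nat \<Rightarrow> bool" where
  "side v \<longleftrightarrow> v < 3 \<or> 6 \<le> v \<and> (v - 6) mod 5 < 2"

lemma vt_ge: "6 \<le> vt k c j"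
  by (simp add: vt_def)

lemma vt_less: "k < 5 \<Longrightarrow> c < Nc \<Longrightarrow> j < Nv \<Longrightarrow> vt k c j < size_n"
proof -
  assume *: "k < 5" "c < Nc" "j < Nv"
  then have "c * Nv + j < Suc c * Nv" by simp
  also have "\<dots> \<le> Nc * Nv" using * by (intro mult_le_mono1) simp
  finally have "Suc (c * Nv + j) * 5 \<le> Nc * Nv * 5" by (intro mult_le_mono1) simp
  then show ?thesis using * by (simp add: vt_def size_n_def)
qed

lemma vt_minus: "vt k c j - 6 = k + (c * Nv + j) * 5"
  by (simp add: vt_def)

lemma vt_kind: "k < 5 \<Longrightarrow> (vt k c j - 6) mod 5 = k"
  unfolding vt_minus using mod_mult_self1[of k "c * Nv + j" 5] by simp

lemma vt_index: "k < 5 \<Longrightarrow> (vt k c j - 6) div 5 = c * Nv + j"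
  unfolding vt_minus using div_mult_self1[of 5 k "c * Nv + j"] by simp

lemma side_vt: "k < 5 \<Longrightarrow> side (vt k c j) \<longleftrightarrow> k < 2"
  using vt_ge[of k c j] by (simp add: side_def vt_kind)

lemma arcE:
  assumes "arc u v"
  shows "u < size_n \<and> v < size_n \<and> side u \<and> \<not> side v"
  using assms unfolding arc_def
proof (elim disjE exE conjE)
  assume "u < 3" "3 \<le> v" "v < 6"
  then show ?thesis by (simp add: size_n_def side_def)
qed (use Nc in \<open>simp_all add: vt_less side_vt\<close>, simp_all add: size_n_def side_def)

lemma edges_iff: "{u, v} \<in> edges \<longleftrightarrow> arc u v \<or> arc v u"
  unfolding edges_def by (auto simp: doubleton_eq_iff)

lemma proper_edges_iff: "proper_coloring edges c \<longleftrightarrow> (\<forall>u v. arc u v \<longrightarrow> c u \<noteq> c v)"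
  unfolding proper_coloring_def edges_iff by metis

lemma instance_edges: "CH23_instance {..<size_n} edges lists"
proof -
  have "u \<noteq> v \<and> u < size_n \<and> v < size_n" if "arc u v" for u v using arcE[OF that] by auto
  then have "e \<subseteq> {..<size_n} \<and> card e = 2" if "e \<in> edges" for e
    using that unfolding edges_def by auto
  then show ?thesis by (auto simp: CH23_instance_def simple_graph_def lists_def)
qed

lemma bipartition_edges:
  "bipartition {..<size_n} edges {v. v < size_n \<and> side v} {v. v < size_n \<and> \<not> side v}"
  unfolding bipartition_def
proof (intro conjI ballI)
  fix e assume "e \<in> edges"
  then obtain u v where "e = {u, v}" "arc u v" unfolding edges_def by blast
  then show "\<exists>a \<in> {v. v < size_n \<and> side v}. \<exists>b \<in> {v. v < size_n \<and> \<not> side v}. e = {a, b}"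
    using arcE[of u v] by (intro bexI[of _ u] bexI[of _ v]) simp_all
qed auto

lemma two_lists: "two_list_vertices {..<size_n} lists = {..<6}"
  by (auto simp: two_list_vertices_def lists_def size_n_def)

text \<open>The reference vertices form a complete bipartite graph on 3 + 3 vertices minus the
  matching of \<open>u\<close> with \<open>u + 3\<close>. In this cyclic order matched vertices are
  opposite, so they receive the same colour.\<close>

definition hex :: "nat \<Rightarrow> nat" where
  "hex = nth [0, 4, 2, 3, 1, 5]"

lemma hex_simps: "hex 0 = 0" "hex 1 = 4" "hex 2 = 2" "hex 3 = 3" "hex 4 = 1" "hex 5 = 5"
  by (simp_all add: hex_def)

lemma arc_ref: "u < 6 \<Longrightarrow> v < 6 \<Longrightarrow> arc u v \<longleftrightarrow> u < 3 \<and> 3 \<le> v \<and> u + 3 \<noteq> v"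
  using vt_ge by (auto simp: arc_def not_less[symmetric])

lemma hexagon_hex: "hexagon edges hex" and chordless_hex: "chordless edges hex"
  and hex_image: "hex ` {..<6} = {..<6}"
proof -
  show "hex ` {..<6} = {..<6}" unfolding image_6 hex_simps by auto
  then have "inj_on hex {..<6}" by (intro eq_card_imp_inj_on) simp_all
  then show "hexagon edges hex"
    unfolding hexagon_def hex_simps edges_iff by (simp add: arc_ref)
  show "chordless edges hex"
    unfolding chordless_def hex_simps edges_iff by (simp add: arc_ref)
qed

text \<open>The colours are parameters because the hexagon has two colourings. Kind 2 blocks the
  passage from \<open>ga\<close> to \<open>gb\<close> on the path of a clause, whose first vertex is
  not \<open>gb\<close> and whose last is not \<open>ga\<close>; hence some path vertex is
  \<open>gc\<close>, and it marks a true literal.\<close>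

lemma coloring_imp_sat:
  assumes c: "\<And>u v. arc u v \<Longrightarrow> c u \<noteq> c v" and c3: "\<And>v. v < size_n \<Longrightarrow> c v = ga \<or> c v = gb \<or> c v = gc"
    and g: "c 0 = ga" "c 1 = gb" "c 2 = gc" "c 3 = ga" "c 4 = gb" "c 5 = gc"
  shows sat
  unfolding sat_def
proof (intro exI[of _ "\<lambda>j. c (vt 1 0 j) = ga"] allI impI)
  fix i assume i: "i < Nc"
  define t where "t j = c (vt 0 i j)" for j
  note vt3 = c3[OF vt_less]
  have arcs: "arc (vt 0 i j) (vt 2 i j)" "Suc j < Nv \<Longrightarrow> arc (vt 0 i (Suc j)) (vt 2 i j)"
    "\<not> pos i j \<Longrightarrow> arc (vt 0 i j) (vt 3 i j)" "arc (vt 1 0 j) (vt 3 i j)"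
    "\<not> neg i j \<Longrightarrow> arc (vt 0 i j) (vt 4 i j)" "arc (vt 1 0 j) (vt 4 i j)"
    "arc (vt 1 i j) 5" "arc (vt 1 0 j) 5" "arc 2 (vt 2 i j)" "arc 1 (vt 3 i j)" "arc 0 (vt 4 i j)"
    if "j < Nv" for j
    using that i Nc arcI[of i j] arcI[of 0 j] by simp_all
  have ends: "arc (vt 0 i 0) 4" "arc (vt 0 i (Nv - 1)) 3"
    using i Nv arcI[of i 0] arcI[of i "Nv - 1"] by simp_all
  have "\<exists>j < Nv. t j = gc"
  proof (rule ccontr)
    assume none: "\<not> (\<exists>j < Nv. t j = gc)"
    have "t j = ga" if "j < Nv" for j
      using that
    proof (induction j)
      case 0
      then show ?case
        using vt3[of 0 i 0] none i c[OF ends(1)] g unfolding t_def by auto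
    next
      case (Suc j)
      then have j: "j < Nv" and tj: "t j = ga" by auto
      show ?case
        using vt3[of 0 i "Suc j"] vt3[of 2 i j] none i Suc.prems tj g
          c[OF arcs(1)[OF j]] c[OF arcs(2)[OF j Suc.prems]] c[OF arcs(9)[OF j]]
        unfolding t_def by auto
    qed
    then have "t (Nv - 1) = ga" using Nv by simp
    then show False using c[OF ends(2)] g unfolding t_def by simp
  qed
  then obtain j where j: "j < Nv" "t j = gc" by blast
  \<comment> \<open>\<open>vt 3 i j\<close> excludes \<open>ga\<close> together with
    \<open>gc\<close> on its neighbours, and it is joined to the path only if the positive literal
    is absent.\<close>
  have "pos i j" if "c (vt 1 0 j) = ga"
  proof (rule ccontr)
    assume "\<not> pos i j"
    from c[OF arcs(3)[OF j(1) this]] c[OF arcs(4)[OF j(1)]] c[OF arcs(10)[OF j(1)]] vt3[of 3 i j] i j that g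
    show False unfolding t_def by auto
  qed
  \<comment> \<open>Vertex 5 keeps \<open>gc\<close> away from variables, so the variable is
    \<open>gb\<close>; \<open>vt 4 i j\<close> excludes \<open>gb\<close> together with
    \<open>gc\<close>.\<close>
  moreover have "neg i j" if "c (vt 1 0 j) \<noteq> ga"
  proof (rule ccontr)
    assume "\<not> neg i j"
    from c[OF arcs(5)[OF j(1) this]] c[OF arcs(6)[OF j(1)]] c[OF arcs(11)[OF j(1)]] vt3[of 4 i j]
      c[OF arcs(8)[OF j(1)]] vt3[of 1 0 j] Nc i j that g
    show False unfolding t_def by auto
  qed
  ultimately show "\<exists>j < Nv. pos i j \<and> c (vt 1 0 j) = ga \<or> neg i j \<and> c (vt 1 0 j) \<noteq> ga"
    using j(1) by blast
qed

text \<open>The reference colours \<open>ga\<close>, \<open>gb\<close>, \<open>gc\<close> are 2, 3,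
  1 here, and \<open>m\<close> is the first variable whose literal makes the clause true. The
  gadgets of kinds 2, 3, 4 take a colour left over by their neighbours.\<close>

definition hue :: "(nat \<Rightarrow> bool) \<Rightarrow> nat \<Rightarrow> nat \<Rightarrow> nat \<Rightarrow> nat" where
  "hue \<alpha> k c j = (let m = (LEAST j. pos c j \<and> \<alpha> j \<or> neg c j \<and> \<not> \<alpha> j) in
    if k = 0 then (if j < m then 2 else if j = m then 1 else 3)
    else if k = 1 then (if \<alpha> j then 2 else 3)
    else if k = 2 then (if j < m then 3 else 2)
    else if k = 3 then (if j = m \<and> \<not> \<alpha> j then 2 else 1)
    else (if j = m \<and> \<alpha> j then 3 else 1))"

definition paint :: "(nat \<Rightarrow> bool) \<Rightarrow> nat \<Rightarrow> nat" where
  "paint \<alpha> v = (if v < 6 then [2, 3, 1, 2, 3, 1] ! v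
    else hue \<alpha> ((v - 6) mod 5) ((v - 6) div 5 div Nv) ((v - 6) div 5 mod Nv))"

lemma paint_vt: "k < 5 \<Longrightarrow> j < Nv \<Longrightarrow> paint \<alpha> (vt k c j) = hue \<alpha> k c j"
  using vt_ge[of k c j] Nv by (simp add: paint_def vt_kind vt_index not_less[symmetric])

lemma paint_ref: "paint \<alpha> 0 = 2" "paint \<alpha> (Suc 0) = 3" "paint \<alpha> 2 = 1" "paint \<alpha> 3 = 2" "paint \<alpha> 4 = 3"
  "paint \<alpha> 5 = 1"
  by (simp_all add: paint_def)

lemma paint_proper:
  assumes \<alpha>: "\<forall>c < Nc. \<exists>j < Nv. pos c j \<and> \<alpha> j \<or> neg c j \<and> \<not> \<alpha> j" and "arc u v"
  shows "paint \<alpha> u \<noteq> paint \<alpha> v"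
proof -
  define m where "m c = (LEAST j. pos c j \<and> \<alpha> j \<or> neg c j \<and> \<not> \<alpha> j)" for c
  have m: "m c < Nv" "pos c (m c) \<and> \<alpha> (m c) \<or> neg c (m c) \<and> \<not> \<alpha> (m c)" if c: "c < Nc" for c
  proof -
    obtain j where j: "j < Nv" "pos c j \<and> \<alpha> j \<or> neg c j \<and> \<not> \<alpha> j" using \<alpha> c by blast
    show "pos c (m c) \<and> \<alpha> (m c) \<or> neg c (m c) \<and> \<not> \<alpha> (m c)" unfolding m_def by (rule LeastI, rule j(2))
    have "m c \<le> j" unfolding m_def by (rule Least_le, rule j(2))
    then show "m c < Nv" using j(1) by simp
  qed
  \<comment> \<open>The last path vertex must not have colour 2, so the marked position may not lie
    beyond it.\<close>
  have m_last: "\<not> j < m c" if "c < Nc" "Suc j = Nv" for c j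
    using m(1)[OF that(1)] that(2) by simp
  note hue = hue_def[of \<alpha>, folded m_def, unfolded Let_def]
  show ?thesis
    using assms(2) unfolding arc_def
  proof (elim disjE exE conjE)
    assume "u < 3" "3 \<le> v" "v < 6" "u + 3 \<noteq> v"
    then have "u = 0 \<or> u = 1 \<or> u = 2" "v = 3 \<or> v = 4 \<or> v = 5" by auto
    then show ?thesis using \<open>u + 3 \<noteq> v\<close> by (elim disjE) (simp_all add: paint_ref)
  qed (use m m_last in \<open>auto simp: paint_vt paint_ref hue\<close>)
qed

lemma if_mem: "a \<in> S \<Longrightarrow> b \<in> S \<Longrightarrow> (if P then a else b) \<in> S"
  by simp

lemma hue_range: "hue \<alpha> k c j \<in> {1..3}"
  unfolding hue_def Let_def by (intro if_mem; simp)

lemma paint_range: "v < size_n \<Longrightarrow> paint \<alpha> v \<in> {1..3}"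
proof (cases "v < 6")
  case True
  then have "v \<in> {0, 1, 2, 3, 4, 5}" unfolding lessThan_6[symmetric] by simp
  then show ?thesis by (elim insertE) (simp_all add: paint_ref)
next
  case False
  then show ?thesis unfolding paint_def using hue_range by (simp only: if_False)
qed

theorem choosable_iff_sat: "choosable {..<size_n} edges lists 3 \<longleftrightarrow> sat"
proof -
  interpret H: hexagon_instance "{..<size_n}" edges lists "{v. v < size_n \<and> side v}"
    "{v. v < size_n \<and> \<not> side v}" hex
    by unfold_locales (simp_all add: instance_edges bipartition_edges two_lists hex_image hexagon_hex)
  show ?thesis
  proof
    assume "choosable {..<size_n} edges lists 3"
    then obtain c where c: "proper_coloring edges c" "\<forall>v \<in> {..<size_n}. c v \<in> {1..3}"
      "\<forall>k < 6. c (hex k) \<noteq> Suc (k mod 3)"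
      using H.choosable_imp_coloring by blast
    have arc: "\<And>u v. arc u v \<Longrightarrow> c u \<noteq> c v" using c(1) by (simp add: proper_edges_iff)
    have c3: "c v = 1 \<or> c v = 2 \<or> c v = 3" if "v < size_n" for v using c(2) that by force
    from H.coloring_colors[OF c, unfolded hex_simps]
    show sat
    proof
      assume "c 0 = 2 \<and> c 4 = 3 \<and> c 2 = 1 \<and> c 3 = 2 \<and> c 1 = 3 \<and> c 5 = 1"
      then show sat by (intro coloring_imp_sat[OF arc, where ga = 2 and gb = 3 and gc = 1]) (use c3 in auto)
    next
      assume "c 0 = 3 \<and> c 4 = 1 \<and> c 2 = 2 \<and> c 3 = 3 \<and> c 1 = 1 \<and> c 5 = 2"
      then show sat by (intro coloring_imp_sat[OF arc, where ga = 3 and gb = 1 and gc = 2]) (use c3 in auto)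
    qed
  next
    assume sat
    then obtain \<alpha> where \<alpha>: "\<forall>c < Nc. \<exists>j < Nv. pos c j \<and> \<alpha> j \<or> neg c j \<and> \<not> \<alpha> j"
      unfolding sat_def by blast
    show "choosable {..<size_n} edges lists 3"
    proof (rule H.coloring_imp_choosable[OF chordless_hex])
      show "proper_coloring edges (paint \<alpha>)"
        unfolding proper_edges_iff using paint_proper[OF \<alpha>] by blast
      show "\<forall>v \<in> {..<size_n}. paint \<alpha> v \<in> {1..3}" using paint_range by blast
      show "\<forall>k < 6. paint \<alpha> (hex k) \<noteq> Suc (k mod 3)"
        unfolding all_less_6 by (simp add: hex_simps[simplified] paint_ref)
    qed
  qed
qed

end

section \<open>Cellular automata as CNF formulas\<close>

lemma radix_inj:
  fixes q :: nat
  assumes "r < D" "r' < D"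
  shows "q * D + r = q' * D + r' \<longleftrightarrow> q = q' \<and> r = r'"
proof
  assume eq: "q * D + r = q' * D + r'"
  have "(r + q * D) div D = q" "(r' + q' * D) div D = q'" using assms by simp_all
  then show "q = q' \<and> r = r'" using eq by (metis add.commute add_left_cancel)
qed simp

lemma radix_less:
  fixes q :: nat
  assumes "q < A" "r < D"
  shows "q * D + r < A * D"
proof -
  have "q * D + r < Suc q * D" using assms by simp
  also have "\<dots> \<le> A * D" using assms by (intro mult_le_mono1) simp
  finally show ?thesis .
qed

lemma radix_ex:
  fixes n :: nat
  assumes "n < A * D"
  obtains q r where "q < A" "r < D" "n = q * D + r"
proof
  have "0 < D" using assms by (cases D) auto
  then show "n div D < A" "n mod D < D" "n = n div D * D + n mod D"
    using assms by (simp_all add: less_mult_imp_div_less)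
qed

text \<open>A cellular automaton whose local rule \<open>F\<close> also reads the central cell \<open>T\<close>, run for \<open>T\<close> steps on a
  window of \<open>2 T + 1\<close> cells. The cells whose content is determined shrink towards the centre.
  Clauses and variables are triples (time, cell, template) and (time, cell, symbol), coded as numbers;
  a template is a family of clauses together with up to four symbols.\<close>

locale automaton =
  fixes G T :: nat and F :: "nat \<Rightarrow> nat \<Rightarrow> nat \<Rightarrow> nat \<Rightarrow> nat"
    and ini :: "nat \<Rightarrow> nat \<Rightarrow> bool" and bad :: "nat \<Rightarrow> nat \<Rightarrow> nat \<Rightarrow> bool" and acc :: "nat \<Rightarrow> bool"
    and D :: nat and tpl :: "nat \<Rightarrow> nat \<times> nat \<times> nat \<times> nat \<times> nat"
  assumes F: "\<And>a b c e. a < G \<Longrightarrow> b < G \<Longrightarrow> c < G \<Longrightarrow> e < G \<Longrightarrow> F a b c e < G"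
    and tpl: "tpl ` {..<D} = {..<4} \<times> {..<G} \<times> {..<G} \<times> {..<G} \<times> {..<G}"
    and G: "0 < G"
begin

definition width :: nat where "width = 2 * T + 1"

definition vr :: "nat \<Rightarrow> nat \<Rightarrow> nat \<Rightarrow> nat" where
  "vr t u g = (t * width + u) * G + g"

definition cl :: "nat \<Rightarrow> nat \<Rightarrow> nat \<Rightarrow> nat" where
  "cl t u d = (t * width + u) * D + d"

definition nvars :: nat where "nvars = (Suc T * width) * G"

definition nclauses :: nat where "nclauses = (Suc T * width) * D"

text \<open>Templates 0 to 3 express the initial row, forbidden neighbours in it, the local rule,
  and acceptance. Where a template does not apply, \<open>posl\<close> and \<open>negl\<close> both
  hold of every variable, which makes the clause a tautology.\<close>

definition posl :: "nat \<Rightarrow> nat \<Rightarrow> nat \<Rightarrow> nat \<Rightarrow> bool" where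
  "posl t u d j = (case tpl d of (k, a, b, c, e) \<Rightarrow>
    if k = 0 then \<exists>g \<in> {..<G}. ini u g \<and> j = vr 0 u g
    else if k = 1 then \<not> (Suc u < width \<and> bad u a b)
    else if k = 2 then t < T \<and> Suc (Suc u) < width \<longrightarrow> j = vr (Suc t) (Suc u) (F a b c e)
    else acc a)"

definition negl :: "nat \<Rightarrow> nat \<Rightarrow> nat \<Rightarrow> nat \<Rightarrow> bool" where
  "negl t u d j = (case tpl d of (k, a, b, c, e) \<Rightarrow>
    if k = 0 then False
    else if k = 1 then Suc u < width \<and> bad u a b \<longrightarrow> j = vr 0 u a \<or> j = vr 0 (Suc u) b
    else if k = 2 then t < T \<and> Suc (Suc u) < width \<longrightarrow>
      j = vr t T a \<or> j = vr t u b \<or> j = vr t (Suc u) c \<or> j = vr t (Suc (Suc u)) e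
    else acc a \<or> j = vr T T a)"

text \<open>The bounds on \<open>t\<close> and \<open>u\<close> depend on the input, while
  \<open>{..<D}\<close> is constant; the two notations select \<open>dfm_ex\<close> and
  \<open>dfm_bex\<close> when this is compiled.\<close>

definition pos :: "nat \<Rightarrow> nat \<Rightarrow> bool" where
  "pos i j \<longleftrightarrow> (\<exists>t < Suc T. \<exists>u < width. \<exists>d \<in> {..<D}. i = cl t u d \<and> posl t u d j)"

definition neg :: "nat \<Rightarrow> nat \<Rightarrow> bool" where
  "neg i j \<longleftrightarrow> (\<exists>t < Suc T. \<exists>u < width. \<exists>d \<in> {..<D}. i = cl t u d \<and> negl t u d j)"

lemma vr_inj: "u < width \<Longrightarrow> u' < width \<Longrightarrow> g < G \<Longrightarrow> g' < G \<Longrightarrow>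
    vr t u g = vr t' u' g' \<longleftrightarrow> t = t' \<and> u = u' \<and> g = g'"
  by (simp add: vr_def radix_inj)

lemma cl_inj: "u < width \<Longrightarrow> u' < width \<Longrightarrow> d < D \<Longrightarrow> d' < D \<Longrightarrow>
    cl t u d = cl t' u' d' \<longleftrightarrow> t = t' \<and> u = u' \<and> d = d'"
  by (simp add: cl_def radix_inj)

lemma vr_less: "t \<le> T \<Longrightarrow> u < width \<Longrightarrow> g < G \<Longrightarrow> vr t u g < nvars"
  unfolding vr_def nvars_def by (intro radix_less) simp_all

lemma cl_less: "t \<le> T \<Longrightarrow> u < width \<Longrightarrow> d < D \<Longrightarrow> cl t u d < nclauses"
  unfolding cl_def nclauses_def by (intro radix_less) simp_all

lemma cl_ex:
  assumes "i < nclauses"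
  obtains t u d where "t \<le> T" "u < width" "d < D" "i = cl t u d"
proof -
  obtain q d where q: "q < Suc T * width" "d < D" "i = q * D + d"
    using assms unfolding nclauses_def by (rule radix_ex)
  obtain t u where "t < Suc T" "u < width" "q = t * width + u" using q(1) by (rule radix_ex)
  then show ?thesis using that[of t u d] q by (simp add: cl_def)
qed

lemma pos_cl: "t \<le> T \<Longrightarrow> u < width \<Longrightarrow> d < D \<Longrightarrow> pos (cl t u d) j \<longleftrightarrow> posl t u d j"
  unfolding pos_def using cl_inj by (auto simp: less_Suc_eq_le)

lemma neg_cl: "t \<le> T \<Longrightarrow> u < width \<Longrightarrow> d < D \<Longrightarrow> neg (cl t u d) j \<longleftrightarrow> negl t u d j"
  unfolding neg_def using cl_inj by (auto simp: less_Suc_eq_le)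

lemma nvars_pos: "0 < nvars" and nclauses_pos: "0 < nclauses"
proof -
  show "0 < nvars" using G by (simp add: nvars_def width_def)
  have "(0, 0, 0, 0, 0) \<in> tpl ` {..<D}" unfolding tpl using G by simp
  then have "0 < D" by auto
  then show "0 < nclauses" by (simp add: nclauses_def width_def)
qed

section \<open>Satisfying assignments and evolutions\<close>

definition satisfied :: "(nat \<Rightarrow> bool) \<Rightarrow> bool" where
  "satisfied \<alpha> \<longleftrightarrow> (\<forall>i < nclauses. \<exists>j < nvars. pos i j \<and> \<alpha> j \<or> neg i j \<and> \<not> \<alpha> j)"

lemma satisfied_iff: "satisfied \<alpha> \<longleftrightarrow>
  (\<forall>t \<le> T. \<forall>u < width. \<forall>d < D. \<exists>j < nvars. posl t u d j \<and> \<alpha> j \<or> negl t u d j \<and> \<not> \<alpha> j)"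
proof
  assume *: "satisfied \<alpha>"
  show "\<forall>t \<le> T. \<forall>u < width. \<forall>d < D. \<exists>j < nvars. posl t u d j \<and> \<alpha> j \<or> negl t u d j \<and> \<not> \<alpha> j"
  proof (intro allI impI)
    fix t u d assume tud: "t \<le> T" "u < width" "d < D"
    show "\<exists>j < nvars. posl t u d j \<and> \<alpha> j \<or> negl t u d j \<and> \<not> \<alpha> j"
      using *[unfolded satisfied_def, rule_format, OF cl_less[OF tud]]
      unfolding pos_cl[OF tud] neg_cl[OF tud] .
  qed
next
  assume *: "\<forall>t \<le> T. \<forall>u < width. \<forall>d < D. \<exists>j < nvars. posl t u d j \<and> \<alpha> j \<or> negl t u d j \<and> \<not> \<alpha> j"
  show "satisfied \<alpha>" unfolding satisfied_def
  proof (intro allI impI)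
    fix i assume "i < nclauses"
    then obtain t u d where "t \<le> T" "u < width" "d < D" "i = cl t u d" by (rule cl_ex)
    then show "\<exists>j < nvars. pos i j \<and> \<alpha> j \<or> neg i j \<and> \<not> \<alpha> j"
      using * pos_cl neg_cl by metis
  qed
qed

lemma template_ex:
  assumes "k < 4" "a < G" "b < G" "c < G" "e < G"
  shows "\<exists>d. d < D \<and> tpl d = (k, a, b, c, e)"
proof -
  have "(k, a, b, c, e) \<in> tpl ` {..<D}" unfolding tpl using assms by simp
  then show ?thesis by (auto simp: image_iff)
qed

text \<open>The clauses do not say that a cell has only one symbol. Instead one true symbol is
  chosen in each initial cell, the rule determines the later rows, and the clauses force these
  symbols to be true in turn.\<close>

lemma satisfied_imp_row:
  assumes "satisfied \<alpha>"
  shows "\<exists>row. (\<forall>u < width. row 0 u < G \<and> ini u (row 0 u)) \<and>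
    (\<forall>u. Suc u < width \<longrightarrow> \<not> bad u (row 0 u) (row 0 (Suc u))) \<and>
    (\<forall>t u. row (Suc t) (Suc u) = F (row t T) (row t u) (row t (Suc u)) (row t (Suc (Suc u)))) \<and>
    acc (row T T)"
proof -
  have cl: "\<exists>j < nvars. posl t u d j \<and> \<alpha> j \<or> negl t u d j \<and> \<not> \<alpha> j"
    if "t \<le> T" "u < width" "d < D" for t u d
    using assms that unfolding satisfied_iff by simp
  have "\<exists>g. g < G \<and> ini u g \<and> \<alpha> (vr 0 u g)" if u: "u < width" for u
  proof -
    obtain d where d: "d < D" "tpl d = (0, 0, 0, 0, 0)"
      using template_ex[of 0 0 0 0 0] G by auto
    show ?thesis using cl[of 0 u d] u d by (auto simp: posl_def negl_def)
  qed
  then obtain r0 where r0: "\<And>u. u < width \<Longrightarrow> r0 u < G \<and> ini u (r0 u) \<and> \<alpha> (vr 0 u (r0 u))"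
    by metis
  \<comment> \<open>Subtraction makes the value at cell 0 meaningless after time 0, but that cell is
    then outside the determined region.\<close>
  define row where "row = rec_nat r0 (\<lambda>_ r u. F (r T) (r (u - 1)) (r u) (r (Suc u)))"
  have row0: "row 0 = r0" by (simp add: row_def)
  have rowS: "row (Suc t) (Suc u) = F (row t T) (row t u) (row t (Suc u)) (row t (Suc (Suc u)))" for t u
    by (simp add: row_def)
  \<comment> \<open>Every step loses one cell at either end of the window; its centre
    \<open>T\<close> lasts until time \<open>T\<close>.\<close>
  have true: "row t u < G \<and> \<alpha> (vr t u (row t u))" if "t \<le> u" "u + t < width" "t \<le> T" for t u
    using that
  proof (induction t arbitrary: u)
    case 0
    then show ?case using r0[of u] by (simp add: row0)
  next
    case (Suc t)
    obtain v where v: "u = Suc v" using Suc.prems by (cases u) auto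
    let ?a = "row t T" and ?b = "row t v" and ?c = "row t (Suc v)" and ?e = "row t (Suc (Suc v))"
    have a: "?a < G \<and> \<alpha> (vr t T ?a)" using Suc.prems by (intro Suc.IH) (simp_all add: width_def)
    have b: "?b < G \<and> \<alpha> (vr t v ?b)" using Suc.prems v by (intro Suc.IH) simp_all
    have c: "?c < G \<and> \<alpha> (vr t (Suc v) ?c)" using Suc.prems v by (intro Suc.IH) simp_all
    have e: "?e < G \<and> \<alpha> (vr t (Suc (Suc v)) ?e)" using Suc.prems v by (intro Suc.IH) simp_all
    obtain d where d: "d < D" "tpl d = (2, ?a, ?b, ?c, ?e)"
      using template_ex[of 2 ?a ?b ?c ?e] a b c e by auto
    have "v < width" "Suc (Suc v) < width" using Suc.prems v by simp_all
    then have "\<alpha> (vr (Suc t) u (row (Suc t) u))"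
      using cl[of t v d] d Suc.prems a b c e unfolding posl_def negl_def v rowS by auto
    moreover have "row (Suc t) u < G" unfolding v rowS using F a b c e by blast
    ultimately show ?case by blast
  qed
  have "\<not> bad u (row 0 u) (row 0 (Suc u))" if u: "Suc u < width" for u
    unfolding row0
  proof
    assume bad: "bad u (r0 u) (r0 (Suc u))"
    have r: "r0 u < G" "r0 (Suc u) < G" "\<alpha> (vr 0 u (r0 u))" "\<alpha> (vr 0 (Suc u) (r0 (Suc u)))"
      using r0 u by simp_all
    obtain d where d: "d < D" "tpl d = (1, r0 u, r0 (Suc u), 0, 0)"
      using template_ex[of 1 "r0 u" "r0 (Suc u)" 0 0] r G by auto
    show False using cl[of 0 u d] d u bad r unfolding posl_def negl_def by auto
  qed
  then have 2: "\<forall>u. Suc u < width \<longrightarrow> \<not> bad u (row 0 u) (row 0 (Suc u))" by blast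
  have 3: "acc (row T T)"
  proof (rule ccontr)
    assume na: "\<not> acc (row T T)"
    have r: "row T T < G" "\<alpha> (vr T T (row T T))" using true[of T T] by (simp_all add: width_def)
    obtain d where d: "d < D" "tpl d = (3, row T T, 0, 0, 0)"
      using template_ex[of 3 "row T T" 0 0 0] r G by auto
    show False using cl[of 0 0 d] d na r unfolding posl_def negl_def by (auto simp: width_def)
  qed
  have 1: "\<forall>u < width. row 0 u < G \<and> ini u (row 0 u)" unfolding row0 using r0 by blast
  show ?thesis by (rule exI[of _ row], intro conjI[OF 1] conjI[OF 2] conjI[OF _ 3] allI rowS)
qed

text \<open>The assignment makes exactly the symbols of \<open>row\<close> true, and injectivity of
  \<open>vr\<close> decides all literals.\<close>

lemma row_imp_satisfied:
  assumes bound: "\<And>t u. row t u < G" and i: "\<And>u. u < width \<Longrightarrow> ini u (row 0 u)"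
    and b: "\<And>u. Suc u < width \<Longrightarrow> \<not> bad u (row 0 u) (row 0 (Suc u))"
    and S: "\<And>t u. row (Suc t) (Suc u) = F (row t T) (row t u) (row t (Suc u)) (row t (Suc (Suc u)))"
    and a: "acc (row T T)"
  shows "\<exists>\<alpha>. satisfied \<alpha>"
proof -
  define \<alpha> where "\<alpha> j \<longleftrightarrow> (\<exists>t u. u < width \<and> j = vr t u (row t u))" for j
  have \<alpha>: "\<alpha> (vr t u g) \<longleftrightarrow> g = row t u" if "u < width" "g < G" for t u g
  proof
    assume "\<alpha> (vr t u g)"
    then obtain t' u' where *: "u' < width" "vr t u g = vr t' u' (row t' u')"
      unfolding \<alpha>_def by (elim exE conjE)
    from *(2) show "g = row t u" unfolding vr_inj[OF that(1) *(1) that(2) bound] by simp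
  next
    assume "g = row t u"
    then show "\<alpha> (vr t u g)" unfolding \<alpha>_def using that(1) by (intro exI[of _ t] exI[of _ u]) simp
  qed
  have "\<exists>j < nvars. posl t u d j \<and> \<alpha> j \<or> negl t u d j \<and> \<not> \<alpha> j"
    if t: "t \<le> T" and u: "u < width" and d: "d < D" for t u d
  proof -
    obtain k a b c e where p: "tpl d = (k, a, b, c, e)" by (rule prod_cases5)
    have "tpl d \<in> tpl ` {..<D}" using d by simp
    then have abce: "a < G" "b < G" "c < G" "e < G" "k < 4" unfolding tpl p by auto
    have z: "0 < nvars" by (rule nvars_pos)
    have Tw: "T < width" by (simp add: width_def)
    consider "k = 0" | "k = 1" | "k = 2" | "k = 3" using abce(5) by linarith
    then show ?thesis
    proof cases
      case 1
      then have "posl t u d (vr 0 u (row 0 u))" "\<alpha> (vr 0 u (row 0 u))"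
        using i[OF u] bound \<alpha>[OF u bound] by (auto simp: posl_def p)
      moreover have "vr 0 u (row 0 u) < nvars" using u bound by (intro vr_less) simp_all
      ultimately show ?thesis by blast
    next
      case 2
      show ?thesis
      proof (cases "Suc u < width \<and> bad u a b")
        case True
        then have "row 0 u \<noteq> a \<or> row 0 (Suc u) \<noteq> b" using assms(3)[of u] by blast
        then show ?thesis
        proof
          assume "row 0 u \<noteq> a"
          then have "\<not> \<alpha> (vr 0 u a)" using \<alpha>[OF u abce(1)] by simp
          then show ?thesis using 2 True u abce vr_less[of 0 u a] by (auto simp: negl_def p)
        next
          assume "row 0 (Suc u) \<noteq> b"
          then have "\<not> \<alpha> (vr 0 (Suc u) b)" using \<alpha>[OF _ abce(2)] True by simp
          then show ?thesis using 2 True u abce vr_less[of 0 "Suc u" b] by (auto simp: negl_def p)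
        qed
      next
        case False
        then show ?thesis using 2 z by (auto simp: negl_def posl_def p)
      qed
    next
      case 3
      show ?thesis
      proof (cases "t < T \<and> Suc (Suc u) < width")
        case True
        let ?good = "a = row t T \<and> b = row t u \<and> c = row t (Suc u) \<and> e = row t (Suc (Suc u))"
        show ?thesis
        proof (cases ?good)
          case good: True
          have "\<alpha> (vr (Suc t) (Suc u) (F a b c e))"
            using \<alpha>[OF _ F[OF abce(1-4)], of "Suc u" "Suc t"] True good S by simp
          moreover have "vr (Suc t) (Suc u) (F a b c e) < nvars"
            using True abce F by (intro vr_less) simp_all
          ultimately show ?thesis using 3 True by (auto simp: posl_def p)
        next
          case False
          have "vr t T a < nvars" "vr t u b < nvars" "vr t (Suc u) c < nvars" "vr t (Suc (Suc u)) e < nvars"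
            using True abce Tw by (intro vr_less; simp)+
          moreover have "\<not> \<alpha> (vr t T a) \<or> \<not> \<alpha> (vr t u b) \<or> \<not> \<alpha> (vr t (Suc u) c) \<or> \<not> \<alpha> (vr t (Suc (Suc u)) e)"
            using False True abce Tw \<alpha>[of T a t] \<alpha>[of u b t] \<alpha>[of "Suc u" c t] \<alpha>[of "Suc (Suc u)" e t]
            by simp
          ultimately show ?thesis using 3 True unfolding negl_def p by auto
        qed
      next
        case False
        then show ?thesis using 3 z by (auto simp: negl_def posl_def p)
      qed
    next
      case 4
      show ?thesis
      proof (cases "acc a")
        case True
        then have "posl t u d 0" "negl t u d 0" using 4 by (auto simp: negl_def posl_def p)
        then show ?thesis using z by blast
      next
        case False
        then have "\<not> \<alpha> (vr T T a)" using \<alpha>[OF Tw abce(1)] assms(5) by metis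
        then show ?thesis using 4 vr_less[of T T a] Tw abce by (auto simp: negl_def p)
      qed
    qed
  qed
  then show ?thesis unfolding satisfied_iff by blast
qed

end

section \<open>Turing machines as cellular automata\<close>

type_synonym cell = "bool \<times> nat \<times> nat list"

text \<open>Cell \<open>p\<close> of a configuration holds the contents of all tapes at offset \<open>p\<close> from their own heads,
  together with the state and a flag for offset 0; so a move of a head shifts the cells of its tape.\<close>

definition cell_at :: "config \<Rightarrow> int \<Rightarrow> cell" where
  "cell_at c p = (p = 0, fst c, map (\<lambda>(t, h). t (h + p)) (snd c))"

definition local_step :: "tm \<Rightarrow> nat \<Rightarrow> nat list \<Rightarrow> nat \<times> (nat \<times> dir) list" where
  "local_step M q ss = (if halting q then (q, keep ss) else delta M q ss)"

fun source :: "dir \<Rightarrow> cell \<Rightarrow> cell \<Rightarrow> cell \<Rightarrow> cell" where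
  "source MoveL a b c = a"
| "source Stay a b c = b"
| "source MoveR a b c = c"

text \<open>State and scanned symbols in the cell \<open>z\<close> at offset 0 fix the action of all
  cells at once, which is why the automaton must read its centre. Contents are relative to the
  heads: a tape whose head moves left is copied from the left neighbour, and where the source is the
  flagged cell the written symbol replaces the old one.\<close>

definition rule :: "tm \<Rightarrow> cell \<Rightarrow> cell \<Rightarrow> cell \<Rightarrow> cell \<Rightarrow> cell" where
  "rule M z a b c = (let (q', as) = local_step M (fst (snd z)) (snd (snd z)) in
    (fst b, q', map (\<lambda>i. let s = source (snd (as ! i)) a b c in
      if fst s then fst (as ! i) else snd (snd s) ! i) [0..<num_tapes M]))"

definition cells :: "tm \<Rightarrow> cell set" where
  "cells M = UNIV \<times> {..<num_states M} \<times> {ss. set ss \<subseteq> {..<num_syms M} \<and> length ss = num_tapes M}"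

lemma finite_cells: "finite (cells M)"
  unfolding cells_def by (intro finite_cartesian_product finite_lists_length_eq) simp_all

lemma step_local:
  "step M (q, ts) = (fst (local_step M q (map (\<lambda>(t, h). t h) ts)),
    map2 act ts (snd (local_step M q (map (\<lambda>(t, h). t h) ts))))"
  by (simp add: local_step_def map2_act_keep split: prod.split)

lemma local_step_wf:
  assumes "wf_tm M" "q < num_states M" "length ss = num_tapes M" "set ss \<subseteq> {..<num_syms M}"
    and "local_step M q ss = (q', as)"
  shows "q' < num_states M" "length as = num_tapes M" "\<And>i. i < num_tapes M \<Longrightarrow> fst (as ! i) < num_syms M"
proof -
  have "q' < num_states M \<and> length as = num_tapes M \<and> (\<forall>(b, d) \<in> set as. b < num_syms M)"
  proof (cases "halting q")
    case True
    then show ?thesis using assms by (auto simp: local_step_def keep_def)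
  next
    case False
    then have "delta M q ss = (q', as)" using assms(5) by (simp add: local_step_def)
    then show ?thesis using assms(1-4) unfolding wf_tm_def by fastforce
  qed
  then show "q' < num_states M" "length as = num_tapes M" "\<And>i. i < num_tapes M \<Longrightarrow> fst (as ! i) < num_syms M"
    by (auto simp: case_prod_beta)
qed

lemma nth_cell: "(f, q, ss) \<in> cells M \<Longrightarrow> i < num_tapes M \<Longrightarrow> ss ! i < num_syms M"
  unfolding cells_def using subsetD[of "set ss" "{..<num_syms M}" "ss ! i"] by auto

lemma rule_cells:
  assumes wf: "wf_tm M" and z: "z \<in> cells M" and abc: "a \<in> cells M" "b \<in> cells M" "c \<in> cells M"
  shows "rule M z a b c \<in> cells M"
proof -
  obtain f q ss where z': "z = (f, q, ss)" by (rule prod_cases3)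
  obtain q' as where ls: "local_step M q ss = (q', as)" by (rule prod.exhaust)
  have "q < num_states M" "length ss = num_tapes M" "set ss \<subseteq> {..<num_syms M}"
    using z unfolding z' cells_def by auto
  note wf' = local_step_wf[OF wf this ls]
  have src: "source d a b c \<in> cells M" for d using abc by (cases d) simp_all
  have "(let s = source (snd (as ! i)) a b c in if fst s then fst (as ! i) else snd (snd s) ! i)
      < num_syms M" if "i < num_tapes M" for i
    using wf'(3)[OF that] nth_cell[of _ _ _ M i] src[of "snd (as ! i)"] that
    by (cases "source (snd (as ! i)) a b c") (auto simp: Let_def)
  then show ?thesis using wf'(1) unfolding rule_def z' fst_conv snd_conv ls
    by (auto simp: cells_def)
qed

lemma cell_step:
  assumes "wf_tm M" "cell_at c 0 \<in> cells M"
  shows "cell_at (step M c) p = rule M (cell_at c 0) (cell_at c (p - 1)) (cell_at c p) (cell_at c (p + 1))"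
proof -
  obtain q ts where c: "c = (q, ts)" by (rule prod.exhaust)
  let ?ss = "map (\<lambda>(t, h). t h) ts"
  obtain q' as where ls: "local_step M q ?ss = (q', as)" by (rule prod.exhaust)
  have c0: "cell_at c 0 = (True, q, ?ss)" by (simp add: cell_at_def c)
  have "q < num_states M" "length ?ss = num_tapes M" "set ?ss \<subseteq> {..<num_syms M}"
    using assms(2) unfolding c0 cells_def by auto
  note wf' = local_step_wf[OF assms(1) this ls]
  have len: "length ts = num_tapes M" using \<open>length ?ss = num_tapes M\<close> by simp
  have "map (\<lambda>(t, h). t (h + p)) (map2 act ts as) = map (\<lambda>i.
      let s = source (snd (as ! i)) (cell_at c (p - 1)) (cell_at c p) (cell_at c (p + 1)) in
      if fst s then fst (as ! i) else snd (snd s) ! i) [0..<num_tapes M]"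
  proof (rule nth_equalityI)
    fix i assume "i < length (map (\<lambda>(t, h). t (h + p)) (map2 act ts as))"
    then have i: "i < length ts" "i < length as" "i < num_tapes M" using len wf'(2) by simp_all
    obtain t h where th: "ts ! i = (t, h)" by (rule prod.exhaust)
    obtain b d where bd: "as ! i = (b, d)" by (rule prod.exhaust)
    show "map (\<lambda>(t, h). t (h + p)) (map2 act ts as) ! i = map (\<lambda>i.
      let s = source (snd (as ! i)) (cell_at c (p - 1)) (cell_at c p) (cell_at c (p + 1)) in
      if fst s then fst (as ! i) else snd (snd s) ! i) [0..<num_tapes M] ! i"
      using i th bd by (cases d) (simp_all add: cell_at_def c algebra_simps)
  qed (use len wf'(2) in simp)
  then show ?thesis unfolding rule_def c0 fst_conv snd_conv ls
    by (simp add: cell_at_def c step_local ls del: step.simps)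
qed

text \<open>What \<open>word_tape x\<close> holds at offset \<open>u - T\<close>, in a form that
  bounded formulas can express.\<close>

definition symbol_ok :: "word \<Rightarrow> nat \<Rightarrow> nat \<Rightarrow> nat \<Rightarrow> bool" where
  "symbol_ok x T u s \<longleftrightarrow> (\<exists>i < length x. u = T + i \<and> (s = 2 \<and> bit_at x i \<or> s = 1 \<and> \<not> bit_at x i)) \<or>
    (u < T \<or> T + length x \<le> u) \<and> s = 0"

text \<open>Only tape 1 is left open, on the \<open>m\<close> cells from the centre to the right:
  there the certificate is guessed. This is the sole nondeterminism, as later rows follow from the
  rule.\<close>

definition initial_cell :: "tm \<Rightarrow> word \<Rightarrow> nat \<Rightarrow> nat \<Rightarrow> nat \<Rightarrow> cell \<Rightarrow> bool" where
  "initial_cell M x T m u z \<longleftrightarrow> (case z of (f, q, ss) \<Rightarrow> f = (u = T) \<and> q = 0 \<and> symbol_ok x T u (ss ! 0) \<and>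
    (\<forall>i \<in> {2..<num_tapes M}. ss ! i = 0) \<and> ss ! 1 \<le> 2 \<and> (ss ! 1 \<noteq> 0 \<longrightarrow> T \<le> u \<and> u < T + m))"

text \<open>Forbidding a nonblank after a blank turns the guessed symbols into one contiguous
  word.\<close>

definition gap :: "nat \<Rightarrow> nat \<Rightarrow> cell \<Rightarrow> cell \<Rightarrow> bool" where
  "gap T u z z' \<longleftrightarrow> T \<le> u \<and> snd (snd z) ! 1 = 0 \<and> snd (snd z') ! 1 \<noteq> 0"

lemma symbol_ok_iff:
  "symbol_ok x T u s \<longleftrightarrow> s = fst (word_tape x) (int u - int T)"
proof (cases "T \<le> u \<and> u < T + length x")
  case True
  then have n: "nat (int u - int T) = u - T" "0 \<le> int u - int T" "int u - int T < int (length x)" by auto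
  have "symbol_ok x T u s \<longleftrightarrow> s = bit_sym (x ! (u - T))"
    using True by (auto simp: symbol_ok_def bit_at_def bit_sym_def intro!: exI[of _ "u - T"])
  then show ?thesis using n by (simp add: word_tape_def)
next
  case False
  then have "\<not> (0 \<le> int u - int T \<and> int u - int T < int (length x))" by auto
  then have "fst (word_tape x) (int u - int T) = 0" unfolding word_tape_def fst_conv by (rule if_not_P)
  moreover have "symbol_ok x T u s \<longleftrightarrow> s = 0" using False by (auto simp: symbol_ok_def)
  ultimately show ?thesis by simp
qed

lemma cell_init:
  assumes "num_tapes M \<ge> 2"
  shows "cell_at (init_config M [x, y]) p = (p = 0, 0, map (\<lambda>i. fst (word_tape
    (if i = 0 then x else if i = 1 then y else [])) p) [0..<num_tapes M])"
proof -
  have "word_tape w = (fst (word_tape w), 0)" for w by (simp add: word_tape_def)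
  then have "(case word_tape w of (t, h) \<Rightarrow> t (h + p)) = fst (word_tape w) p" for w
    by (metis (no_types, lifting) add_0 case_prod_conv)
  moreover have "(if i < length [x, y] then [x, y] ! i else []) = (if i = 0 then x else if i = 1 then y else [])" for i
    by (auto simp: nth_Cons' less_Suc_eq)
  ultimately show ?thesis by (simp add: cell_at_def init_config_def comp_def)
qed

text \<open>\<open>G\<close> and \<open>D\<close> count cells and templates; they depend on the
  machine alone and are constants with respect to the input.\<close>

locale tm_automaton =
  fixes M :: tm and G D :: nat and enc :: "cell \<Rightarrow> nat" and dec :: "nat \<Rightarrow> cell"
    and tpl :: "nat \<Rightarrow> nat \<times> nat \<times> nat \<times> nat \<times> nat"
  assumes wf: "wf_tm M" and two: "2 \<le> num_tapes M"
    and enc: "\<And>z. z \<in> cells M \<Longrightarrow> enc z < G" "\<And>z. z \<in> cells M \<Longrightarrow> dec (enc z) = z"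
    and dec: "\<And>g. g < G \<Longrightarrow> dec g \<in> cells M"
    and tpl_range: "tpl ` {..<D} = {..<4} \<times> {..<G} \<times> {..<G} \<times> {..<G} \<times> {..<G}"
begin

definition F :: "nat \<Rightarrow> nat \<Rightarrow> nat \<Rightarrow> nat \<Rightarrow> nat" where
  "F z a b c = enc (rule M (dec z) (dec a) (dec b) (dec c))"

definition ini :: "word \<Rightarrow> nat \<Rightarrow> nat \<Rightarrow> nat \<Rightarrow> nat \<Rightarrow> bool" where
  "ini x T m u g \<longleftrightarrow> initial_cell M x T m u (dec g)"

definition bad :: "nat \<Rightarrow> nat \<Rightarrow> nat \<Rightarrow> nat \<Rightarrow> bool" where
  "bad T u g g' \<longleftrightarrow> gap T u (dec g) (dec g')"

definition acc :: "nat \<Rightarrow> bool" where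
  "acc g \<longleftrightarrow> fst (snd (dec g)) = 1"

lemma wf_sizes: "3 \<le> num_states M" "3 \<le> num_syms M"
  using wf by (auto simp: wf_tm_def)

lemma cell_init_cells: "cell_at (init_config M [x, y]) p \<in> cells M"
proof -
  have "fst (word_tape w) p < num_syms M" for w
    using wf_sizes(2) by (auto simp: word_tape_def bit_sym_def)
  then show ?thesis unfolding cell_init[OF two] cells_def using wf_sizes(1) by auto
qed

lemma run_cells: "cell_at (run M [x, y] t) p \<in> cells M"
proof (induction t arbitrary: p)
  case 0
  then show ?case by (simp add: run_def cell_init_cells)
next
  case (Suc t)
  have "cell_at (step M (run M [x, y] t)) p \<in> cells M"
    unfolding cell_step[OF wf Suc.IH] by (intro rule_cells[OF wf] Suc.IH)
  then show ?case by (simp add: run_def)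
qed

lemma run_step: "cell_at (run M [x, y] (Suc t)) p = rule M (cell_at (run M [x, y] t) 0)
    (cell_at (run M [x, y] t) (p - 1)) (cell_at (run M [x, y] t) p) (cell_at (run M [x, y] t) (p + 1))"
  using cell_step[OF wf run_cells] by (simp add: run_def)

lemma automaton: "automaton G F D tpl"
proof
  show "F a b c e < G" if "a < G" "b < G" "c < G" "e < G" for a b c e
    unfolding F_def using that by (intro enc(1) rule_cells[OF wf] dec)
  show "0 < G" using enc(1)[OF run_cells] by (metis gr_zeroI not_less_zero)
qed (rule tpl_range)

text \<open>The certificate is read off tape 1 of the first row, up to its first blank. Since
  \<open>m < T\<close>, the cell \<open>T + m\<close>, which is forced to be blank, lies inside the
  window.\<close>

lemma row_imp_accepts:
  assumes m: "m < T"
    and row0: "\<And>u. u < 2 * T + 1 \<Longrightarrow> row 0 u < G \<and> ini x T m u (row 0 u)"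
    and nobad: "\<And>u. Suc u < 2 * T + 1 \<Longrightarrow> \<not> bad T u (row 0 u) (row 0 (Suc u))"
    and rowS: "\<And>t u. row (Suc t) (Suc u) = F (row t T) (row t u) (row t (Suc u)) (row t (Suc (Suc u)))"
    and acc: "acc (row T T)"
  shows "\<exists>y. length y \<le> m \<and> fst (run M [x, y] T) = 1"
proof -
  define s where "s u = snd (snd (dec (row 0 u))) ! 1" for u
  have s: "s u \<le> 2 \<and> (s u \<noteq> 0 \<longrightarrow> T \<le> u \<and> u < T + m)" if "u < 2 * T + 1" for u
    using row0[OF that] unfolding ini_def initial_cell_def s_def by (auto split: prod.splits)
  define l where "l = (LEAST i. s (T + i) = 0)"
  have sm: "s (T + m) = 0" using s[of "T + m"] m by auto
  have l: "s (T + l) = 0" unfolding l_def using sm by (rule LeastI)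
  have "l \<le> m" unfolding l_def using sm by (rule Least_le)
  have below: "s (T + i) \<noteq> 0" if "i < l" for i
    using not_less_Least[of i "\<lambda>i. s (T + i) = 0"] that unfolding l_def by blast
  have above: "s (T + (l + i)) = 0" if "l + i \<le> T" for i
    using that
  proof (induction i)
    case 0
    then show ?case using l by simp
  next
    case (Suc i)
    then have "s (T + (l + i)) = 0" by simp
    moreover have "\<not> bad T (T + (l + i)) (row 0 (T + (l + i))) (row 0 (Suc (T + (l + i))))"
      using Suc.prems by (intro nobad) simp
    ultimately show ?case unfolding bad_def gap_def s_def by simp
  qed
  define y where "y = map (\<lambda>i. s (T + i) = 2) [0..<l]"
  have y: "s u = fst (word_tape y) (int u - int T)" if u: "u < 2 * T + 1" for u
  proof -
    consider "u < T" | i where "u = T + i" "i < l" | i where "u = T + (l + i)"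
      by (metis le_Suc_ex not_less)
    then show ?thesis
    proof cases
      case 1
      then show ?thesis using s[OF u] by (simp add: word_tape_def)
    next
      case 2
      then show ?thesis using s[OF u] below[OF 2(2)] by (auto simp: word_tape_def y_def bit_sym_def)
    next
      case 3
      then show ?thesis using above[of i] u by (simp add: word_tape_def y_def)
    qed
  qed
  have start: "dec (row 0 u) = cell_at (init_config M [x, y]) (int u - int T)" if u: "u < 2 * T + 1" for u
  proof -
    obtain f q ss where d: "dec (row 0 u) = (f, q, ss)" by (rule prod_cases3)
    have len: "length ss = num_tapes M"
      using dec[of "row 0 u"] row0[OF u] unfolding d cells_def by simp
    have i: "f = (u = T)" "q = 0" "symbol_ok x T u (ss ! 0)" "\<forall>i \<in> {2..<num_tapes M}. ss ! i = 0"
      using row0[OF u] unfolding ini_def initial_cell_def d by simp_all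
    have "ss = map (\<lambda>i. fst (word_tape (if i = 0 then x else if i = 1 then y else [])) (int u - int T))
      [0..<num_tapes M]"
    proof (rule nth_equalityI)
      fix i assume "i < length ss"
      then consider "i = 0" | "i = 1" | "i \<in> {2..<num_tapes M}" using len by force
      then show "ss ! i = map (\<lambda>i. fst (word_tape (if i = 0 then x else if i = 1 then y else []))
          (int u - int T)) [0..<num_tapes M] ! i"
      proof cases
        case 1
        then show ?thesis using i(3) two by (simp add: symbol_ok_iff)
      next
        case 2
        then show ?thesis using y[OF u] two by (simp add: s_def d)
      next
        case 3
        then show ?thesis using i(4) by (auto simp: word_tape_def)
      qed
    qed (simp add: len)
    then show ?thesis unfolding d cell_init[OF two] using i(1,2) by simp
  qed
  have main: "dec (row t u) = cell_at (run M [x, y] t) (int u - int T)"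
    if "t \<le> u" "u + t < 2 * T + 1" "t \<le> T" for t u
    using that
  proof (induction t arbitrary: u)
    case 0
    then show ?case using start by (simp add: run_def)
  next
    case (Suc t)
    obtain v where v: "u = Suc v" using Suc.prems by (cases u) auto
    have a: "dec (row t T) = cell_at (run M [x, y] t) 0"
      using Suc.IH[of T] Suc.prems by simp
    have b: "dec (row t v) = cell_at (run M [x, y] t) (int u - int T - 1)"
      using Suc.IH[of v] Suc.prems v by simp
    have c: "dec (row t (Suc v)) = cell_at (run M [x, y] t) (int u - int T)"
      using Suc.IH[of "Suc v"] Suc.prems v by simp
    have e: "dec (row t (Suc (Suc v))) = cell_at (run M [x, y] t) (int u - int T + 1)"
      using Suc.IH[of "Suc (Suc v)"] Suc.prems v by (simp add: algebra_simps)
    have "dec (row (Suc t) (Suc v)) = cell_at (run M [x, y] (Suc t)) (int u - int T)"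
      unfolding rowS F_def a b c e run_step[symmetric] by (rule enc(2), rule run_cells)
    then show ?case by (simp only: v)
  qed
  have "dec (row T T) = cell_at (run M [x, y] T) 0" using main[of T T] by simp
  then have "fst (run M [x, y] T) = 1" using acc by (simp add: acc_def cell_at_def)
  moreover have "length y \<le> m" using \<open>l \<le> m\<close> by (simp add: y_def)
  ultimately show ?thesis by blast
qed

text \<open>The actual run supplies contents for every cell at every time, so nothing has to be
  restricted to the determined region.\<close>

lemma accepts_imp_row:
  assumes y: "length y \<le> m" and acc: "fst (run M [x, y] T) = 1"
  defines "row \<equiv> \<lambda>t u. enc (cell_at (run M [x, y] t) (int u - int T))"
  shows "row t u < G" "ini x T m u (row 0 u)" "\<not> bad T u (row 0 u) (row 0 (Suc u))"
    "row (Suc t) (Suc u) = F (row t T) (row t u) (row t (Suc u)) (row t (Suc (Suc u)))"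
    "acc (row T T)"
proof -
  have d: "dec (row t u) = cell_at (run M [x, y] t) (int u - int T)" for t u
    unfolding row_def by (rule enc(2), rule run_cells)
  show "row t u < G" unfolding row_def by (rule enc(1), rule run_cells)
  have r0: "run M [x, y] 0 = init_config M [x, y]" by (simp add: run_def)
  have blank: "fst (word_tape []) p = 0" for p by (simp add: word_tape_def)
  have nth: "map f [0..<num_tapes M] ! i = f i" if "i < num_tapes M" for f :: "nat \<Rightarrow> nat" and i
    using that by simp
  have y2: "fst (word_tape y) p \<le> 2" for p by (simp add: word_tape_def bit_sym_def)
  have y0: "fst (word_tape y) (int u - int T) \<noteq> 0 \<longleftrightarrow> T \<le> u \<and> u < T + length y" for u
    by (auto simp: word_tape_def bit_sym_def)
  show "ini x T m u (row 0 u)"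
    unfolding ini_def d initial_cell_def r0 cell_init[OF two]
    using two y y2[of "int u - int T"] y0[of u] by (simp add: symbol_ok_iff blank nth del: nth_map)
  show "\<not> bad T u (row 0 u) (row 0 (Suc u))"
    unfolding bad_def d gap_def r0 cell_init[OF two]
    using two y0[of u] y0[of "Suc u"] by (simp add: nth del: nth_map of_nat_Suc) (intro impI, linarith)
  show "row (Suc t) (Suc u) = F (row t T) (row t u) (row t (Suc u)) (row t (Suc (Suc u)))"
  proof -
    have e: "int (Suc (Suc u)) - int T = int (Suc u) - int T + 1" "int u - int T = int (Suc u) - int T - 1"
      "int T - int T = 0" by simp_all
    show ?thesis unfolding F_def d unfolding row_def run_step e(1,3) by (simp only: e(2))
  qed
  show "acc (row T T)" unfolding acc_def d using acc by (simp add: cell_at_def)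
qed

end

section \<open>Codes of graphs\<close>

lemma concat_rectangle:
  "concat (map (\<lambda>u. map (\<lambda>v. P u v) [0..<n]) [0..<m]) = map (\<lambda>i. P (i div n) (i mod n)) [0..<m * n]"
proof (induction m)
  case (Suc m)
  have "map (\<lambda>v. P m v) [0..<n] = map (\<lambda>i. P (i div n) (i mod n)) [m * n..<m * n + n]"
    by (rule nth_equalityI) (auto simp: div_add1_eq)
  moreover have "[0..<Suc m * n] = [0..<m * n] @ [m * n..<m * n + n]"
    using upt_add_eq_append[of 0 "m * n" n] by (simp add: add.commute)
  ultimately show ?case using Suc.IH by simp
qed simp

text \<open>\<open>Q\<close> stands for the list-size bits of a code and \<open>A\<close> for its adjacency matrix.\<close>

definition code_bit :: "nat \<Rightarrow> (nat \<Rightarrow> bool) \<Rightarrow> (nat \<Rightarrow> nat \<Rightarrow> bool) \<Rightarrow> nat \<Rightarrow> bool" where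
  "code_bit n Q A i \<longleftrightarrow> i < n \<or> (\<exists>v < n. i = Suc (n + v) \<and> Q v) \<or>
    (\<exists>u < n. \<exists>v < n. i = Suc (2 * n + u * n + v) \<and> A u v)"

lemma code_bit_simps:
  "i < n \<Longrightarrow> code_bit n Q A i" "\<not> code_bit n Q A n" "v < n \<Longrightarrow> code_bit n Q A (Suc (n + v)) \<longleftrightarrow> Q v"
  by (auto simp: code_bit_def)

lemma code_bit_matrix:
  assumes "u < n" "v < n"
  shows "code_bit n Q A (Suc (2 * n + u * n + v)) \<longleftrightarrow> A u v"
proof
  assume "code_bit n Q A (Suc (2 * n + u * n + v))"
  then have "\<exists>u' < n. \<exists>v' < n. Suc (2 * n + u * n + v) = Suc (2 * n + u' * n + v') \<and> A u' v'"
    unfolding code_bit_def using assms by auto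
  then obtain u' v' where *: "v' < n" "u * n + v = u' * n + v'" "A u' v'" by auto
  then show "A u v" using radix_inj[OF assms(2) *(1), of u u'] by simp
next
  assume "A u v"
  then show "code_bit n Q A (Suc (2 * n + u * n + v))" unfolding code_bit_def using assms by blast
qed

lemma index_cases:
  assumes "i < Suc (2 * n + n * n)"
  obtains "i < n" | "i = n" | v where "v < n" "i = Suc (n + v)"
    | u v where "u < n" "v < n" "i = Suc (2 * n + u * n + v)"
proof -
  consider "i < n" | "i = n" | "n < i" "i < Suc (2 * n)" | "Suc (2 * n) \<le> i" by linarith
  then show ?thesis
  proof cases
    case 3
    then show ?thesis using that(3)[of "i - Suc n"] by simp
  next
    case 4
    then have "i - Suc (2 * n) < n * n" using assms by simp
    then obtain u v where "u < n" "v < n" "i - Suc (2 * n) = u * n + v" by (rule radix_ex)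
    then show ?thesis using that(4)[of u v] 4 by simp
  qed (use that in blast)+
qed

text \<open>Turns the code into a table whose entries avoid division, which terms of bounded
  arithmetic do not provide.\<close>

lemma encode_bits:
  "encode n E f = map (code_bit n (\<lambda>v. f v = 3) (\<lambda>u v. {u, v} \<in> E)) [0..<Suc (2 * n + n * n)]"
proof (rule nth_equalityI)
  let ?P = "code_bit n (\<lambda>v. f v = 3) (\<lambda>u v. {u, v} \<in> E)"
  have e: "encode n E f = replicate n True @ [False] @ map (\<lambda>v. f v = 3) [0..<n] @
      map (\<lambda>i. {i div n, i mod n} \<in> E) [0..<n * n]"
    unfolding encode_def concat_rectangle ..
  show "length (encode n E f) = length (map ?P [0..<Suc (2 * n + n * n)])"
    unfolding e by simp
  fix i assume "i < length (encode n E f)"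
  then have i: "i < Suc (2 * n + n * n)" unfolding e by simp
  have outer: "map ?P [0..<Suc (2 * n + n * n)] ! i = ?P i"
    using i by (simp only: nth_map_upt length_upt diff_zero add_0)
  have "encode n E f ! i = ?P i"
    using i
  proof (cases rule: index_cases)
    case 1
    then show ?thesis unfolding e by (simp add: nth_append code_bit_simps)
  next
    case 2
    then show ?thesis unfolding e by (simp add: nth_append code_bit_simps)
  next
    case (3 v)
    then show ?thesis unfolding e by (simp add: nth_append code_bit_simps)
  next
    case (4 u v)
    have "u * n + v < n * n" by (rule radix_less[OF 4(1,2)])
    moreover have "(u * n + v) div n = u" "(u * n + v) mod n = v" using 4 by simp_all
    ultimately have "encode n E f ! i \<longleftrightarrow> {u, v} \<in> E"
      unfolding e using 4(3) by (simp add: nth_append)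
    then show ?thesis unfolding 4(3) code_bit_matrix[OF 4(1,2)] .
  qed
  then show "encode n E f ! i = map ?P [0..<Suc (2 * n + n * n)] ! i" unfolding outer .
qed

section \<open>Decoding words\<close>

definition adj :: "word \<Rightarrow> nat \<Rightarrow> nat \<Rightarrow> nat \<Rightarrow> bool" where
  "adj w n u v \<longleftrightarrow> bit_at w (Suc (2 * n + u * n + v))"

definition thr :: "word \<Rightarrow> nat \<Rightarrow> nat \<Rightarrow> bool" where
  "thr w n v \<longleftrightarrow> bit_at w (Suc (n + v))"

text \<open>Symmetric matrices without loops are those of simple graphs, so these are exactly the
  codes of instances, as \<open>encode_of\<close> and \<open>encode_valid\<close> show.\<close>

definition valid :: "word \<Rightarrow> nat \<Rightarrow> bool" where
  "valid w n \<longleftrightarrow> length w = Suc (2 * n + n * n) \<and> (\<forall>i < n. bit_at w i) \<and> \<not> bit_at w n \<and>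
    (\<forall>u < n. \<forall>v < n. adj w n u v \<longrightarrow> adj w n v u \<and> u \<noteq> v)"

definition E_of :: "word \<Rightarrow> nat \<Rightarrow> nat set set" where
  "E_of w n = {{u, v} | u v. u < n \<and> v < n \<and> adj w n u v}"

definition f_of :: "word \<Rightarrow> nat \<Rightarrow> nat \<Rightarrow> nat" where
  "f_of w n v = (if thr w n v then 3 else 2)"

lemma E_of_iff: "valid w n \<Longrightarrow> {u, v} \<in> E_of w n \<longleftrightarrow> u < n \<and> v < n \<and> adj w n u v"
  unfolding E_of_def valid_def by (auto simp: doubleton_eq_iff)

lemma instance_of: "valid w n \<Longrightarrow> CH23_instance {..<n} (E_of w n) (f_of w n)"
  unfolding CH23_instance_def simple_graph_def
  by (auto simp: E_of_def valid_def f_of_def card_insert_if)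

lemma bit_at_map: "bit_at (map P [0..<N]) i \<longleftrightarrow> i < N \<and> P i"
  by (auto simp: bit_at_def)

text \<open>\<open>n\<close> is the position of the first zero bit.\<close>

lemma valid_unique: "valid w n \<Longrightarrow> valid w n' \<Longrightarrow> n = n'"
  unfolding valid_def by (metis linorder_neqE_nat)

lemma encode_of:
  assumes "valid w n"
  shows "encode n (E_of w n) (f_of w n) = w"
proof (rule nth_equalityI)
  show len: "length (encode n (E_of w n) (f_of w n)) = length w"
    using assms unfolding encode_bits by (simp add: valid_def)
  fix i assume "i < length (encode n (E_of w n) (f_of w n))"
  then have i: "i < Suc (2 * n + n * n)" unfolding encode_bits by simp
  have P: "encode n (E_of w n) (f_of w n) ! i \<longleftrightarrow>
      code_bit n (\<lambda>v. f_of w n v = 3) (\<lambda>u v. {u, v} \<in> E_of w n) i"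
    unfolding encode_bits using i by (simp only: nth_map_upt length_upt diff_zero add_0)
  have w: "w ! i = bit_at w i" using i assms by (simp add: bit_at_def valid_def)
  have "code_bit n (\<lambda>v. f_of w n v = 3) (\<lambda>u v. {u, v} \<in> E_of w n) i = bit_at w i"
    using i
  proof (cases rule: index_cases)
    case 1
    then show ?thesis using assms by (simp add: valid_def code_bit_simps)
  next
    case 2
    then show ?thesis using assms by (simp add: valid_def code_bit_simps)
  next
    case (3 v)
    then show ?thesis by (simp add: code_bit_simps f_of_def thr_def)
  next
    case (4 u v)
    then show ?thesis
      unfolding 4(3) code_bit_matrix[OF 4(1,2)] E_of_iff[OF assms] by (simp add: adj_def)
  qed
  then show "encode n (E_of w n) (f_of w n) ! i = w ! i" unfolding P w .
qed

lemma encode_valid: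
  assumes "CH23_instance {..<n} E f"
  shows "valid (encode n E f) n" "E_of (encode n E f) n = E"
    "\<And>v. v < n \<Longrightarrow> f_of (encode n E f) n v = f v"
proof -
  let ?w = "encode n E f"
  have E: "e \<subseteq> {..<n}" "card e = 2" if "e \<in> E" for e
    using assms that by (auto simp: CH23_instance_def simple_graph_def)
  have f: "f v = 2 \<or> f v = 3" if "v < n" for v
    using assms that by (auto simp: CH23_instance_def)
  have adj: "adj ?w n u v \<longleftrightarrow> {u, v} \<in> E" if uv: "u < n" "v < n" for u v
    unfolding adj_def encode_bits bit_at_map code_bit_matrix[OF uv] using radix_less[OF uv] by simp
  have thr: "thr ?w n v \<longleftrightarrow> f v = 3" if v: "v < n" for v
    unfolding thr_def encode_bits bit_at_map using v by (simp add: code_bit_simps)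
  show "valid ?w n" unfolding valid_def
  proof (intro conjI allI impI)
    show "length ?w = Suc (2 * n + n * n)" unfolding encode_bits by simp
    show "bit_at ?w i" if "i < n" for i unfolding encode_bits bit_at_map using that by (simp add: code_bit_simps)
    show "\<not> bit_at ?w n" unfolding encode_bits bit_at_map by (simp add: code_bit_simps)
    fix u v assume uv: "u < n" "v < n" "adj ?w n u v"
    then have "{u, v} \<in> E" using adj by blast
    then show "adj ?w n v u" "u \<noteq> v" using adj[of v u] uv E(2)[of "{u, v}"] by (auto simp: insert_commute)
  qed
  show "E_of ?w n = E"
  proof (intro equalityI subsetI)
    fix e assume "e \<in> E_of ?w n"
    then show "e \<in> E" using adj unfolding E_of_def by auto
  next
    fix e assume e: "e \<in> E"
    then obtain u v where "e = {u, v}" using E(2)[OF e] by (auto simp: card_2_iff)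
    then show "e \<in> E_of ?w n" using e adj[of u v] E(1)[OF e] unfolding E_of_def by auto
  qed
  show "f_of ?w n v = f v" if "v < n" for v using thr[OF that] f[OF that] by (auto simp: f_of_def)
qed

lemma choosable_cong: "(\<And>v. v \<in> V \<Longrightarrow> f v = g v) \<Longrightarrow> choosable V E f k = choosable V E g k"
  unfolding choosable_def by (metis (mono_tags, lifting))

text \<open>The condition may see \<open>f\<close> only through its vertices with 2-lists, because
  decoding recovers \<open>f\<close> on the vertex set but not beyond it.\<close>

lemma restricted_iff:
  "w \<in> CH23_restricted (\<lambda>V E f. C V E (two_list_vertices V f)) \<longleftrightarrow>
    (\<exists>n. valid w n \<and> C {..<n} (E_of w n) {v. v < n \<and> \<not> thr w n v} \<and>
      choosable {..<n} (E_of w n) (f_of w n) 3)"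
proof -
  have two: "two_list_vertices {..<n} (f_of w n) = {v. v < n \<and> \<not> thr w n v}" for n
    by (auto simp: two_list_vertices_def f_of_def)
  show ?thesis
  proof
    assume "w \<in> CH23_restricted (\<lambda>V E f. C V E (two_list_vertices V f))"
    then obtain n E f where *: "w = encode n E f" "CH23_instance {..<n} E f"
      "C {..<n} E (two_list_vertices {..<n} f)" "choosable {..<n} E f 3"
      unfolding CH23_restricted_def by blast
    note v = encode_valid[OF *(2), folded *(1)]
    have "two_list_vertices {..<n} f = {v. v < n \<and> \<not> thr w n v}"
      unfolding two[symmetric] using v(3) by (auto simp: two_list_vertices_def)
    moreover have "choosable {..<n} (E_of w n) (f_of w n) 3"
      unfolding v(2) using *(4) choosable_cong[of "{..<n}" "f_of w n" f E 3] v(3) by simp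
    ultimately show "\<exists>n. valid w n \<and> C {..<n} (E_of w n) {v. v < n \<and> \<not> thr w n v} \<and>
      choosable {..<n} (E_of w n) (f_of w n) 3"
      using v(1,2) *(3) by (intro exI[of _ n]) simp
  next
    assume "\<exists>n. valid w n \<and> C {..<n} (E_of w n) {v. v < n \<and> \<not> thr w n v} \<and>
      choosable {..<n} (E_of w n) (f_of w n) 3"
    then obtain n where n: "valid w n" "C {..<n} (E_of w n) {v. v < n \<and> \<not> thr w n v}"
      "choosable {..<n} (E_of w n) (f_of w n) 3" by blast
    show "w \<in> CH23_restricted (\<lambda>V E f. C V E (two_list_vertices V f))"
      unfolding CH23_restricted_def mem_Collect_eq
      using encode_of[OF n(1)] instance_of[OF n(1)] n(2,3) two
      by (intro exI[of _ n] exI[of _ "E_of w n"] exI[of _ "f_of w n"]) simp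
  qed
qed

section \<open>Hardness\<close>

text \<open>Carries a parameter that is merely assumed definable under one more bound
  variable.\<close>

lemma dtm_weaken: "dtm X Y R f \<Longrightarrow>
    dtm (\<lambda>z. X (snd z)) (\<lambda>z. Y (snd z)) (\<lambda>z. h z # R (snd z)) (\<lambda>z. f (snd z))"
  unfolding dtm_def by (elim exE, rule_tac x = "shift t" in exI) (simp add: tval_shift)

context tm_automaton
begin

section \<open>Definability of the reduction\<close>

abbreviation cpos :: "word \<Rightarrow> nat \<Rightarrow> nat \<Rightarrow> nat \<Rightarrow> nat \<Rightarrow> bool" where
  "cpos x T m \<equiv> automaton.pos G T F (ini x T m) (bad T) acc D tpl"

abbreviation cneg :: "nat \<Rightarrow> nat \<Rightarrow> nat \<Rightarrow> bool" where
  "cneg T \<equiv> automaton.neg G T (bad T) acc D tpl"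

abbreviation Nc :: "nat \<Rightarrow> nat" where
  "Nc T \<equiv> automaton.nclauses T D"

abbreviation Nv :: "nat \<Rightarrow> nat" where
  "Nv T \<equiv> automaton.nvars G T"

lemma cnf_graph: "cnf_graph (Nc T) (Nv T)"
  using automaton.nclauses_pos[OF automaton] automaton.nvars_pos[OF automaton] by (rule cnf_graph.intro)

lemma sat_iff_accepts:
  assumes "m < T"
  shows "cnf_graph.sat (Nc T) (Nv T) (cpos x T m) (cneg T) \<longleftrightarrow>
    (\<exists>y. length y \<le> m \<and> fst (run M [x, y] T) = 1)"
proof
  assume "cnf_graph.sat (Nc T) (Nv T) (cpos x T m) (cneg T)"
  then obtain \<alpha> where "automaton.satisfied G T F (ini x T m) (bad T) acc D tpl \<alpha>"
    unfolding cnf_graph.sat_def[OF cnf_graph] automaton.satisfied_def[OF automaton] by blast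
  from automaton.satisfied_imp_row[OF automaton this]
  obtain row where row: "\<forall>u < 2 * T + 1. row 0 u < G \<and> ini x T m u (row 0 u)"
    "\<forall>u. Suc u < 2 * T + 1 \<longrightarrow> \<not> bad T u (row 0 u) (row 0 (Suc u))"
    "\<forall>t u. row (Suc t) (Suc u) = F (row t T) (row t u) (row t (Suc u)) (row t (Suc (Suc u)))"
    "acc (row T T)"
    unfolding automaton.width_def[OF automaton] by (elim exE conjE)
  show "\<exists>y. length y \<le> m \<and> fst (run M [x, y] T) = 1"
    by (rule row_imp_accepts[OF assms row(1,2,3)[rule_format] row(4)])
next
  assume "\<exists>y. length y \<le> m \<and> fst (run M [x, y] T) = 1"
  then obtain y where "length y \<le> m" "fst (run M [x, y] T) = 1" by blast
  note row = accepts_imp_row[OF this]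
  have "\<exists>\<alpha>. automaton.satisfied G T F (ini x T m) (bad T) acc D tpl \<alpha>"
    by (rule automaton.row_imp_satisfied[OF automaton,
          where row = "\<lambda>t u. enc (cell_at (run M [x, y] t) (int u - int T))"]) (rule row)+
  then show "cnf_graph.sat (Nc T) (Nv T) (cpos x T m) (cneg T)"
    unfolding cnf_graph.sat_def[OF cnf_graph] automaton.satisfied_def[OF automaton] .
qed

lemma dtm_width: "dtm X Y R T \<Longrightarrow> dtm X Y R (\<lambda>c. automaton.width (T c))"
  unfolding automaton.width_def[OF automaton] by (intro dtm_add dtm_mult dtm_const)

lemma dtm_vr: "dtm X Y R T \<Longrightarrow> dtm X Y R t \<Longrightarrow> dtm X Y R u \<Longrightarrow>
    dtm X Y R (\<lambda>c. automaton.vr G (T c) (t c) (u c) g)"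
  unfolding automaton.vr_def[OF automaton] by (intro dtm_add dtm_mult dtm_const dtm_width)

lemma dtm_cl: "dtm X Y R T \<Longrightarrow> dtm X Y R t \<Longrightarrow> dtm X Y R u \<Longrightarrow>
    dtm X Y R (\<lambda>c. automaton.cl (T c) D (t c) (u c) d)"
  unfolding automaton.cl_def[OF automaton] by (intro dtm_add dtm_mult dtm_const dtm_width)

lemma dtm_Nv: "dtm X Y R T \<Longrightarrow> dtm X Y R (\<lambda>c. Nv (T c))"
  unfolding automaton.nvars_def[OF automaton] by (intro dtm_Suc dtm_mult dtm_const dtm_width)

lemma dtm_Nc: "dtm X Y R T \<Longrightarrow> dtm X Y R (\<lambda>c. Nc (T c))"
  unfolding automaton.nclauses_def[OF automaton] by (intro dtm_Suc dtm_mult dtm_const dtm_width)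

text \<open>The symbol \<open>g\<close> is a constant, so \<open>dec g\<close> is evaluated while
  the formula is being built; only the word and the numbers remain inside it.\<close>

lemma dfm_ini:
  assumes "dtm X Y R T" "dtm X Y R m" "dtm X Y R u"
  shows "dfm X Y R (\<lambda>c. ini (X c) (T c) (m c) (u c) g)"
proof -
  obtain f q ss where d: "dec g = (f, q, ss)" by (rule prod_cases3)
  show ?thesis
    unfolding ini_def initial_cell_def d symbol_ok_def prod.case
    by (rule dintros assms assms[THEN dtm_weaken] finite_atLeastLessThan)+
qed

lemma dfm_bad:
  assumes "dtm X Y R T" "dtm X Y R u"
  shows "dfm X Y R (\<lambda>c. bad (T c) (u c) g g')"
  unfolding bad_def gap_def by (intro dintros assms)


lemma dfm_posl:
  assumes "dtm X Y R T" "dtm X Y R m" "dtm X Y R t" "dtm X Y R u" "dtm X Y R j"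
  shows "dfm X Y R (\<lambda>c. automaton.posl G (T c) F (ini (X c) (T c) (m c)) (bad (T c)) acc tpl (t c) (u c) d (j c))"
proof -
  obtain k a b c e where d: "tpl d = (k, a, b, c, e)" by (rule prod_cases5)
  show ?thesis
    unfolding automaton.posl_def[OF automaton] d prod.case
    by (rule dfm_if dfm_ini dfm_bad dtm_vr dtm_width dintros assms finite_lessThan)+
qed

lemma dfm_negl:
  assumes "dtm X Y R T" "dtm X Y R t" "dtm X Y R u" "dtm X Y R j"
  shows "dfm X Y R (\<lambda>c. automaton.negl G (T c) (bad (T c)) acc tpl (t c) (u c) d (j c))"
proof -
  obtain k a b c e where d: "tpl d = (k, a, b, c, e)" by (rule prod_cases5)
  show ?thesis
    unfolding automaton.negl_def[OF automaton] d prod.case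
    by (rule dfm_if dfm_bad dtm_vr dtm_width dintros assms finite_lessThan)+
qed

lemma dfm_pos:
  assumes "dtm X Y R T" "dtm X Y R m" "dtm X Y R i" "dtm X Y R j"
  shows "dfm X Y R (\<lambda>c. cpos (X c) (T c) (m c) (i c) (j c))"
  unfolding automaton.pos_def[OF automaton]
  by (rule dfm_posl dtm_cl dtm_width dintros assms assms[THEN dtm_weaken]
      assms[THEN dtm_weaken, THEN dtm_weaken] finite_lessThan)+

lemma dfm_neg:
  assumes "dtm X Y R T" "dtm X Y R i" "dtm X Y R j"
  shows "dfm X Y R (\<lambda>c. cneg (T c) (i c) (j c))"
  unfolding automaton.neg_def[OF automaton]
  by (rule dfm_negl dtm_cl dtm_width dintros assms assms[THEN dtm_weaken]
      assms[THEN dtm_weaken, THEN dtm_weaken] finite_lessThan)+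


lemma dtm_size_n: "dtm X Y R T \<Longrightarrow> dtm X Y R (\<lambda>c. cnf_graph.size_n (Nc (T c)) (Nv (T c)))"
  unfolding cnf_graph.size_n_def[OF cnf_graph] by (intro dtm_add dtm_mult dtm_const dtm_Nc dtm_Nv)

lemma dtm_vt: "dtm X Y R T \<Longrightarrow> dtm X Y R i \<Longrightarrow> dtm X Y R j \<Longrightarrow>
    dtm X Y R (\<lambda>c. cnf_graph.vt (Nv (T c)) k (i c) (j c))"
  unfolding cnf_graph.vt_def[OF cnf_graph] by (intro dtm_add dtm_mult dtm_const dtm_Nv)

lemma dfm_arc:
  assumes "dtm X Y R T" "dtm X Y R m" "dtm X Y R u" "dtm X Y R v"
  shows "dfm X Y R (\<lambda>c. cnf_graph.arc (Nc (T c)) (Nv (T c)) (cpos (X c) (T c) (m c)) (cneg (T c)) (u c) (v c))"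
  unfolding cnf_graph.arc_def[OF cnf_graph]
  by (rule dfm_pos dfm_neg dtm_vt dtm_Nc dtm_Nv dintros assms assms[THEN dtm_weaken]
      assms[THEN dtm_weaken, THEN dtm_weaken])+

abbreviation gsize :: "nat \<Rightarrow> nat" where
  "gsize T \<equiv> cnf_graph.size_n (Nc T) (Nv T)"

abbreviation gedges :: "word \<Rightarrow> nat \<Rightarrow> nat \<Rightarrow> nat set set" where
  "gedges x T m \<equiv> cnf_graph.edges (Nc T) (Nv T) (cpos x T m) (cneg T)"

text \<open>\<open>T\<close> has to be definable in two contexts: with the bit position in the
  environment, for the entries of the code, and without it, for the length of the code.\<close>

lemma ptime_computable_graph:
  assumes T: "dtm (\<lambda>c. fst c) (\<lambda>c. []) (\<lambda>c. [snd c]) (\<lambda>c. T (fst c))"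
    and m: "dtm (\<lambda>c. fst c) (\<lambda>c. []) (\<lambda>c. [snd c]) (\<lambda>c. m (fst c))"
    and T': "dtm (\<lambda>x. x) (\<lambda>x. []) (\<lambda>x. []) T"
  shows "ptime_computable (\<lambda>x. encode (gsize (T x)) (gedges x (T x) (m x)) cnf_graph.lists)"
proof -
  have "dtm (\<lambda>x. x) (\<lambda>x. []) (\<lambda>x. []) (\<lambda>x. Suc (2 * gsize (T x) + gsize (T x) * gsize (T x)))"
    by (intro dtm_Suc dtm_add dtm_mult dtm_const dtm_size_n T')
  then obtain t where t: "\<And>x. tval x [] [] t = Suc (2 * gsize (T x) + gsize (T x) * gsize (T x))"
    unfolding dtm_def by blast
  have lists: "cnf_graph.lists v = 3 \<longleftrightarrow> \<not> v < 6" for v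
    unfolding cnf_graph.lists_def[OF cnf_graph] by simp
  have "dfm (\<lambda>c. fst c) (\<lambda>c. []) (\<lambda>c. [snd c]) (\<lambda>c. code_bit (gsize (T (fst c)))
    (\<lambda>v. cnf_graph.lists v = 3) (\<lambda>u v. {u, v} \<in> gedges (fst c) (T (fst c)) (m (fst c))) (snd c))"
    unfolding code_bit_def cnf_graph.edges_iff[OF cnf_graph] lists
    by (rule dfm_arc dtm_size_n dintros T m T[THEN dtm_weaken] m[THEN dtm_weaken]
        T[THEN dtm_weaken, THEN dtm_weaken] m[THEN dtm_weaken, THEN dtm_weaken])+
  then obtain f where f: "\<And>c. fval (fst c) [] [snd c] f = code_bit (gsize (T (fst c)))
    (\<lambda>v. cnf_graph.lists v = 3) (\<lambda>u v. {u, v} \<in> gedges (fst c) (T (fst c)) (m (fst c))) (snd c)"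
    unfolding dfm_def by blast
  have "table x [] t f = encode (gsize (T x)) (gedges x (T x) (m x)) cnf_graph.lists" for x
    unfolding table_def t encode_bits using f[of "(x, _)"] by simp
  then show ?thesis using ptime_computable_table[of t f] by simp
qed

end

lemma tm_automaton_exists:
  assumes "wf_tm M" "2 \<le> num_tapes M"
  shows "\<exists>G D enc dec tpl. tm_automaton M G D enc dec tpl"
proof -
  obtain enc where "bij_betw enc (cells M) {0..<card (cells M)}"
    using ex_bij_betw_finite_nat[OF finite_cells] by blast
  then have enc: "inj_on enc (cells M)" "enc ` cells M = {..<card (cells M)}"
    by (auto simp: bij_betw_def)
  let ?D = "{..<4::nat} \<times> {..<card (cells M)} \<times> {..<card (cells M)} \<times> {..<card (cells M)} \<times> {..<card (cells M)}"
  have "finite ?D" by simp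
  then obtain tpl :: "nat \<Rightarrow> nat \<times> nat \<times> nat \<times> nat \<times> nat" where "bij_betw tpl {0..<card ?D} ?D"
    using ex_bij_betw_nat_finite by blast
  then have "tpl ` {..<card ?D} = ?D" by (simp add: bij_betw_def atLeast0LessThan)
  then have "tm_automaton M (card (cells M)) (card ?D) enc (inv_into (cells M) enc) tpl"
    using assms enc by unfold_locales (auto intro: inv_into_into)
  then show ?thesis by blast
qed

definition C6_instance :: "nat set \<Rightarrow> nat set set \<Rightarrow> (nat \<Rightarrow> nat) \<Rightarrow> bool" where
  "C6_instance V E f \<longleftrightarrow> bipartite V E \<and> card (two_list_vertices V f) = 6 \<and>
    induces_C6 E (two_list_vertices V f)"

lemma (in cnf_graph) encode_in_restricted:
  "encode size_n edges lists \<in> CH23_restricted C6_instance \<longleftrightarrow> sat"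
proof -
  let ?w = "encode size_n edges lists"
  have "bipartite {..<size_n} edges"
    using bipartition_edges unfolding bipartite_def bipartition_def by blast
  moreover have "induces_C6 edges {..<6}"
  proof -
    have "card e = 2" if "e \<in> edges" for e
      using instance_edges that by (simp add: CH23_instance_def simple_graph_def)
    then show ?thesis
      using induces_C6_iff[OF bipartition_edges] hex_image hexagon_hex chordless_hex by blast
  qed
  ultimately have C: "C6_instance {..<size_n} edges lists"
    unfolding C6_instance_def two_lists by simp
  have "choosable {..<size_n} edges lists 3" if "?w \<in> CH23_restricted C6_instance"
  proof -
    have "C6_instance = (\<lambda>V E f. (\<lambda>V E S. bipartite V E \<and> card S = 6 \<and> induces_C6 E S) V E (two_list_vertices V f))"
      by (simp add: C6_instance_def fun_eq_iff)
    with that obtain n where n: "valid ?w n" "choosable {..<n} (E_of ?w n) (f_of ?w n) 3"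
      using restricted_iff[of ?w "\<lambda>V E S. bipartite V E \<and> card S = 6 \<and> induces_C6 E S"] by auto
    note v = encode_valid[OF instance_edges]
    have "n = size_n" by (rule valid_unique[OF n(1) v(1)])
    then show ?thesis
      using n(2) v(2) choosable_cong[of "{..<size_n}" "f_of ?w size_n" lists edges 3] v(3) by simp
  qed
  moreover have "?w \<in> CH23_restricted C6_instance" if "choosable {..<size_n} edges lists 3"
    unfolding CH23_restricted_def using that C instance_edges by blast
  ultimately show ?thesis using choosable_iff_sat by blast
qed

theorem NP_hard_C6: "NP_hard (CH23_restricted C6_instance)"
  unfolding NP_hard_def
proof (intro allI impI)
  fix L' assume "in_NP L'"
  then obtain R q where R: "ptime_decidable 2 {[x, y] | x y. (x, y) \<in> R}"
    and L': "\<And>x. x \<in> L' \<longleftrightarrow> (\<exists>y. length y \<le> poly q (length x) \<and> (x, y) \<in> R)"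
    unfolding in_NP_def by blast
  from R obtain M p where M: "wf_tm M" "2 \<le> num_tapes M"
    and run: "\<And>ws. length ws = 2 \<Longrightarrow> fst (run M ws (poly p (sum_list (map length ws)))) =
      (if ws \<in> {[x, y] | x y. (x, y) \<in> R} then 1 else 2)"
    unfolding ptime_decidable_def by blast
  obtain G D enc dec tpl where "tm_automaton M G D enc dec tpl"
    using tm_automaton_exists[OF M] by blast
  then interpret tm_automaton M G D enc dec tpl .
  define m where "m x = poly q (length x)" for x :: word
  \<comment> \<open>At least the running time of the verifier on every certificate of length up to
    \<open>m x\<close>, and larger than \<open>m x\<close>, so that such certificates fit into the
    window.\<close>
  define T where "T x = Suc (poly p (length x + m x) + m x)" for x
  have T: "dtm (\<lambda>c. fst c) (\<lambda>c. []) (\<lambda>c. [snd c]) (\<lambda>c. T (fst c))"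
    "dtm (\<lambda>x. x) (\<lambda>x. []) (\<lambda>x. []) T"
    "dtm (\<lambda>c. fst c) (\<lambda>c. []) (\<lambda>c. [snd c]) (\<lambda>c. m (fst c))"
    unfolding T_def m_def by (intro dtm_Suc dtm_add dtm_poly dtm_len0)+
  have acc: "fst (run M [x, y] (T x)) = 1 \<longleftrightarrow> (x, y) \<in> R" if "length y \<le> m x" for x y
  proof -
    let ?t = "poly p (length x + length y)"
    obtain s ts where r: "run M [x, y] ?t = (s, ts)" by (rule prod.exhaust)
    then have s: "s = (if (x, y) \<in> R then 1 else 2)" using run[of "[x, y]"] by simp
    have "?t \<le> poly p (length x + m x)" using that by (intro poly_nat_mono) simp
    then have "?t \<le> T x" by (simp add: T_def)
    then have "run M [x, y] (T x) = (s, ts)" using r s by (intro halting_stable[OF r]) (simp_all add: halting_def)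
    then show ?thesis using s by simp
  qed
  have "x \<in> L' \<longleftrightarrow> encode (gsize (T x)) (gedges x (T x) (m x)) cnf_graph.lists \<in> CH23_restricted C6_instance" for x
  proof -
    have "m x < T x" by (simp add: T_def)
    from sat_iff_accepts[OF this, of x] show ?thesis
      unfolding cnf_graph.encode_in_restricted[OF cnf_graph] L' m_def[symmetric] using acc by blast
  qed
  then show "ptime_reducible L' (CH23_restricted C6_instance)"
    unfolding ptime_reducible_def using ptime_computable_graph[OF T(1,3,2)] by blast
qed

section \<open>Membership in NP\<close>

definition dist6 :: "nat \<Rightarrow> nat \<Rightarrow> nat \<Rightarrow> nat \<Rightarrow> nat \<Rightarrow> nat \<Rightarrow> bool" where
  "dist6 a b c d e f \<longleftrightarrow> a \<noteq> b \<and> a \<noteq> c \<and> a \<noteq> d \<and> a \<noteq> e \<and> a \<noteq> f \<and> b \<noteq> c \<and> b \<noteq> d \<and> b \<noteq> e \<and> b \<noteq> f \<and>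
    c \<noteq> d \<and> c \<noteq> e \<and> c \<noteq> f \<and> d \<noteq> e \<and> d \<noteq> f \<and> e \<noteq> f"

definition twos :: "word \<Rightarrow> nat \<Rightarrow> nat \<Rightarrow> nat \<Rightarrow> nat \<Rightarrow> nat \<Rightarrow> nat \<Rightarrow> nat \<Rightarrow> bool" where
  "twos w n a b c d e f \<longleftrightarrow> dist6 a b c d e f \<and>
    (\<forall>v < n. (v = a \<or> v = b \<or> v = c \<or> v = d \<or> v = e \<or> v = f) = (\<not> thr w n v))"

definition cyc6 :: "word \<Rightarrow> nat \<Rightarrow> nat \<Rightarrow> nat \<Rightarrow> nat \<Rightarrow> nat \<Rightarrow> nat \<Rightarrow> nat \<Rightarrow> bool" where
  "cyc6 w n a b c d e f \<longleftrightarrow> adj w n a b \<and> adj w n b c \<and> adj w n c d \<and> adj w n d e \<and> adj w n e f \<and> adj w n f a"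

text \<open>Six quantifiers over numbers, because formulas cannot quantify over the map
  \<open>w\<close>.\<close>

definition six :: "nat \<Rightarrow> (nat \<Rightarrow> nat \<Rightarrow> nat \<Rightarrow> nat \<Rightarrow> nat \<Rightarrow> nat \<Rightarrow> bool) \<Rightarrow> bool" where
  "six n P \<longleftrightarrow> (\<exists>a < n. \<exists>b < n. \<exists>c < n. \<exists>d < n. \<exists>e < n. \<exists>f < n. P a b c d e f)"

lemma six_iff: "six n P \<longleftrightarrow> (\<exists>w. (\<forall>k < 6 :: nat. w k < n) \<and> P (w 0) (w 1) (w 2) (w 3) (w 4) (w 5))"
proof
  assume "six n P"
  then obtain a b c d e f where *: "a < n" "b < n" "c < n" "d < n" "e < n" "f < n" "P a b c d e f"
    unfolding six_def by (elim exE conjE)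
  show "\<exists>w. (\<forall>k < 6 :: nat. w k < n) \<and> P (w 0) (w 1) (w 2) (w 3) (w 4) (w 5)"
    by (rule exI[of _ "nth [a, b, c, d, e, f]"]) (use * in \<open>simp add: all_less_6\<close>)
next
  assume "\<exists>w. (\<forall>k < 6 :: nat. w k < n) \<and> P (w 0) (w 1) (w 2) (w 3) (w 4) (w 5)"
  then show "six n P" unfolding six_def all_less_6 by (elim exE conjE) (intro exI conjI)
qed

lemma dist6_inj: "dist6 (w 0) (w 1) (w 2) (w 3) (w 4) (w 5) \<longleftrightarrow> inj_on w {..<6::nat}"
  unfolding lessThan_6 dist6_def by (auto simp: inj_on_def)

lemma twos_iff:
  fixes w :: "nat \<Rightarrow> nat"
  assumes "\<forall>k < 6. w k < n"
  shows "twos x n (w 0) (w 1) (w 2) (w 3) (w 4) (w 5) \<longleftrightarrow>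
    inj_on w {..<6} \<and> w ` {..<6} = {v. v < n \<and> \<not> thr x n v}"
proof -
  have "w ` {..<6} = {v. v < n \<and> \<not> thr x n v} \<longleftrightarrow> (\<forall>v < n. v \<in> w ` {..<6} \<longleftrightarrow> \<not> thr x n v)"
    using assms by (auto simp: set_eq_iff image_iff)
  then show ?thesis unfolding twos_def dist6_inj image_6 by simp
qed

lemma cyc6_iff:
  fixes w :: "nat \<Rightarrow> nat"
  assumes "valid x n" "\<forall>k < 6. w k < n"
  shows "inj_on w {..<6} \<and> cyc6 x n (w 0) (w 1) (w 2) (w 3) (w 4) (w 5) \<longleftrightarrow> hexagon (E_of x n) w"
  using assms(2) unfolding cyc6_def hexagon_def E_of_iff[OF assms(1)] all_less_6 by auto

lemma card_twos_iff: "card {v. v < n \<and> \<not> thr x n v} = 6 \<longleftrightarrow> six n (twos x n)"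
proof
  let ?S = "{v. v < n \<and> \<not> thr x n v}"
  assume "card ?S = 6"
  then obtain w where "bij_betw w {..<6::nat} ?S"
    using ex_bij_betw_nat_finite[of ?S] by (auto simp: atLeast0LessThan)
  then have w: "inj_on w {..<6}" "w ` {..<6} = ?S" by (auto simp: bij_betw_def)
  then have "\<forall>k < 6. w k < n" by blast
  then show "six n (twos x n)" unfolding six_iff using twos_iff w by blast
next
  let ?S = "{v. v < n \<and> \<not> thr x n v}"
  assume "six n (twos x n)"
  then obtain w where w: "inj_on w {..<6::nat}" "w ` {..<6} = ?S" unfolding six_iff using twos_iff by blast
  show "card ?S = 6" unfolding w(2)[symmetric] card_image[OF w(1)] by simp
qed

lemma hexagon_twos_iff:
  assumes "valid x n"
  shows "(\<exists>w. w ` {..<6} = {v. v < n \<and> \<not> thr x n v} \<and> hexagon (E_of x n) w) \<longleftrightarrow>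
    six n (\<lambda>a b c d e f. twos x n a b c d e f \<and> cyc6 x n a b c d e f)"
  (is "?l \<longleftrightarrow> ?r")
proof
  assume ?l
  then obtain w where w: "w ` {..<6} = {v. v < n \<and> \<not> thr x n v}" "hexagon (E_of x n) w" by blast
  then have b: "\<forall>k < 6. w k < n" by blast
  show ?r unfolding six_iff using w b twos_iff[OF b, of x] cyc6_iff[OF assms b] by blast
next
  assume ?r
  then obtain w :: "nat \<Rightarrow> nat" where b: "\<forall>k < 6. w k < n" and w: "twos x n (w 0) (w 1) (w 2) (w 3) (w 4) (w 5)"
    "cyc6 x n (w 0) (w 1) (w 2) (w 3) (w 4) (w 5)" unfolding six_iff by blast
  show ?l using w twos_iff[OF b, of x] cyc6_iff[OF assms b] by blast
qed

lemma E_of_bipartition: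
  assumes "valid x n" "\<And>u v. u < n \<Longrightarrow> v < n \<Longrightarrow> adj x n u v \<Longrightarrow> s u \<noteq> s v"
  shows "bipartition {..<n} (E_of x n) {v. v < n \<and> s v} {v. v < n \<and> \<not> s v}"
  unfolding bipartition_def
proof (intro conjI ballI)
  fix e assume "e \<in> E_of x n"
  then obtain u v where uv: "e = {u, v}" "u < n" "v < n" "adj x n u v" unfolding E_of_def by blast
  show "\<exists>a \<in> {v. v < n \<and> s v}. \<exists>b \<in> {v. v < n \<and> \<not> s v}. e = {a, b}"
  proof (cases "s u")
    case True
    then show ?thesis using uv assms(2)[OF uv(2-4)] by (intro bexI[of _ u] bexI[of _ v]) simp_all
  next
    case False
    then show ?thesis using uv assms(2)[OF uv(2-4)]
      by (intro bexI[of _ v] bexI[of _ u]) (simp_all add: insert_commute)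
  qed
qed auto

lemma bipartition_E_of:
  assumes "valid x n" "bipartition {..<n} (E_of x n) A B" "u < n" "v < n" "adj x n u v"
  shows "u \<in> A \<longleftrightarrow> v \<notin> A"
proof -
  have "{u, v} \<in> E_of x n" unfolding E_of_iff[OF assms(1)] using assms by simp
  moreover have "A \<inter> B = {}" using assms(2) by (simp add: bipartition_def)
  ultimately show ?thesis using bipartition_sides[OF assms(2)] by blast
qed

lemma bipartite_E_of_iff:
  assumes "valid x n"
  shows "bipartite {..<n} (E_of x n) \<longleftrightarrow>
    (\<exists>s :: nat \<Rightarrow> bool. \<forall>u < n. \<forall>v < n. adj x n u v \<longrightarrow> s u \<noteq> s v)"
proof
  assume "bipartite {..<n} (E_of x n)"
  then obtain A B where "bipartition {..<n} (E_of x n) A B" unfolding bipartite_def bipartition_def by blast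
  from bipartition_E_of[OF assms this]
  show "\<exists>s :: nat \<Rightarrow> bool. \<forall>u < n. \<forall>v < n. adj x n u v \<longrightarrow> s u \<noteq> s v"
    by (intro exI[of _ "\<lambda>v. v \<in> A"]) blast
next
  assume "\<exists>s :: nat \<Rightarrow> bool. \<forall>u < n. \<forall>v < n. adj x n u v \<longrightarrow> s u \<noteq> s v"
  then obtain s :: "nat \<Rightarrow> bool" where "\<forall>u < n. \<forall>v < n. adj x n u v \<longrightarrow> s u \<noteq> s v" by blast
  then have "bipartition {..<n} (E_of x n) {v. v < n \<and> s v} {v. v < n \<and> \<not> s v}"
    by (intro E_of_bipartition[OF assms]) blast
  then show "bipartite {..<n} (E_of x n)" unfolding bipartite_def bipartition_def by blast
qed

text \<open>Colour 3 is the default, so every word denotes a map into the three colours.\<close>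

definition hue_of :: "word \<Rightarrow> nat \<Rightarrow> nat \<Rightarrow> nat" where
  "hue_of y n v = (if bit_at y (n + v) then 1 else if bit_at y (n + n + v) then 2 else 3)"

text \<open>A certificate lists the sides of a bipartition, then the vertices coloured 1, then those coloured 2.\<close>

definition certifies :: "word \<Rightarrow> word \<Rightarrow> bool" where
  "certifies x y \<longleftrightarrow> (\<exists>n < length x. valid x n \<and>
    (\<forall>u < n. \<forall>v < n. adj x n u v \<longrightarrow> bit_at y u \<noteq> bit_at y v \<and> hue_of y n u \<noteq> hue_of y n v) \<and>
    six n (\<lambda>a b c d e f. twos x n a b c d e f \<and> cyc6 x n a b c d e f \<and>
      \<not> adj x n a d \<and> \<not> adj x n b e \<and> \<not> adj x n c f \<and>
      hue_of y n a \<noteq> 1 \<and> hue_of y n b \<noteq> 2 \<and> hue_of y n c \<noteq> 3 \<and>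
      hue_of y n d \<noteq> 1 \<and> hue_of y n e \<noteq> 2 \<and> hue_of y n f \<noteq> 3))"

text \<open>Rewrites comparisons of colours as conditions on bits, for which the definability rules
  suffice.\<close>

lemma hue_of_simps: "hue_of y n v \<noteq> 1 \<longleftrightarrow> \<not> bit_at y (n + v)"
  "hue_of y n v \<noteq> 2 \<longleftrightarrow> bit_at y (n + v) \<or> \<not> bit_at y (n + n + v)"
  "hue_of y n v \<noteq> 3 \<longleftrightarrow> bit_at y (n + v) \<or> bit_at y (n + n + v)"
  "hue_of y n u \<noteq> hue_of y n v \<longleftrightarrow> bit_at y (n + u) \<noteq> bit_at y (n + v) \<or>
    \<not> bit_at y (n + u) \<and> bit_at y (n + n + u) \<noteq> bit_at y (n + n + v)"
  by (auto simp: hue_of_def)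

lemma dfm_certifies: "dfm (\<lambda>c. fst c) (\<lambda>c. snd c) (\<lambda>c. []) (\<lambda>c. certifies (fst c) (snd c))"
  unfolding certifies_def valid_def adj_def thr_def hue_of_simps six_def twos_def cyc6_def dist6_def
  by (rule dintros)+

lemma valid_less: "valid x n \<Longrightarrow> n < length x"
  by (simp add: valid_def)

text \<open>A single colouring replaces the quantifier over list assignments, by
  \<open>choosable_imp_coloring\<close> in one direction and \<open>coloring_imp_choosable\<close>
  in the other. The excluded colours 1, 2, 3, 1, 2, 3 are the values of
  \<open>Suc (k mod 3)\<close>.\<close>

lemma certifies_iff: "x \<in> CH23_restricted C6_instance \<longleftrightarrow> (\<exists>y. length y \<le> 3 * length x \<and> certifies x y)"
proof -
  have C: "C6_instance = (\<lambda>V E f. (\<lambda>V E S. bipartite V E \<and> card S = 6 \<and> induces_C6 E S) V E (two_list_vertices V f))"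
    by (simp add: C6_instance_def fun_eq_iff)
  have two: "two_list_vertices {..<n} (f_of x n) = {v. v < n \<and> \<not> thr x n v}" for n
    by (auto simp: two_list_vertices_def f_of_def)
  note r = restricted_iff[of x "\<lambda>V E S. bipartite V E \<and> card S = 6 \<and> induces_C6 E S", folded C]
  have loops: "card e = 2" if "valid x n" "e \<in> E_of x n" for e n
    using instance_of[OF that(1)] that(2) by (simp add: CH23_instance_def simple_graph_def)
  show ?thesis
  proof
    assume "x \<in> CH23_restricted C6_instance"
    then obtain n where n: "valid x n" "bipartite {..<n} (E_of x n)"
      "induces_C6 (E_of x n) {v. v < n \<and> \<not> thr x n v}" "choosable {..<n} (E_of x n) (f_of x n) 3"
      unfolding r by blast
    obtain A B where bip: "bipartition {..<n} (E_of x n) A B"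
      using n(2) unfolding bipartite_def bipartition_def by blast
    obtain w where cyc: "w ` {..<6} = {v. v < n \<and> \<not> thr x n v}" "hexagon (E_of x n) w" "chordless (E_of x n) w"
      using n(3) induces_C6_iff[OF bip loops[OF n(1)]] by blast
    interpret hexagon_instance "{..<n}" "E_of x n" "f_of x n" A B w
      by (rule hexagon_instance.intro[OF instance_of[OF n(1)] bip _ cyc(2)]) (simp add: two cyc(1))
    obtain c where c: "proper_coloring (E_of x n) c" "\<forall>v \<in> {..<n}. c v \<in> {1..3}"
      "\<forall>k < 6. c (w k) \<noteq> Suc (k mod 3)"
      using choosable_imp_coloring[OF n(4)] by blast
    define y where "y = map (\<lambda>i. if i < n then i \<in> A else if i < n + n then c (i - n) = 1 else c (i - (n + n)) = 2)
      [0..<n + n + n]"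
    have y: "bit_at y v \<longleftrightarrow> v \<in> A" "bit_at y (n + v) \<longleftrightarrow> c v = 1" "bit_at y (n + n + v) \<longleftrightarrow> c v = 2" if "v < n" for v
      using that unfolding y_def bit_at_map by simp_all
    have hue: "hue_of y n v = c v" if "v < n" for v
      using c(2) that unfolding hue_of_def y[OF that] by force
    have b: "\<forall>k < 6. w k < n" using cyc(1) by blast
    have "length y \<le> 3 * length x" using valid_less[OF n(1)] by (simp add: y_def)
    moreover have "certifies x y"
      unfolding certifies_def
    proof (intro exI[of _ n] conjI allI impI)
      fix u v assume uv: "u < n" "v < n" "adj x n u v"
      show "bit_at y u \<noteq> bit_at y v"
        using bipartition_E_of[OF n(1) bip uv] y(1)[OF uv(1)] y(1)[OF uv(2)] by blast
      have "{u, v} \<in> E_of x n" unfolding E_of_iff[OF n(1)] using uv by simp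
      then show "hue_of y n u \<noteq> hue_of y n v"
        using c(1) hue[OF uv(1)] hue[OF uv(2)] by (simp add: proper_coloring_def)
    next
      have "twos x n (w 0) (w 1) (w 2) (w 3) (w 4) (w 5)" "cyc6 x n (w 0) (w 1) (w 2) (w 3) (w 4) (w 5)"
        using twos_iff[OF b, of x] cyc6_iff[OF n(1) b] cyc(1,2) by blast+
      moreover have "\<not> adj x n (w 0) (w 3)" "\<not> adj x n (w 1) (w 4)" "\<not> adj x n (w 2) (w 5)"
        using cyc(3) b unfolding chordless_def E_of_iff[OF n(1)] all_less_6 by blast+
      moreover have "c (w 0) \<noteq> 1" "c (w 1) \<noteq> 2" "c (w 2) \<noteq> 3" "c (w 3) \<noteq> 1" "c (w 4) \<noteq> 2" "c (w 5) \<noteq> 3"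
        using c(3) unfolding all_less_6 by simp_all
      ultimately show "six n (\<lambda>a b c d e f. twos x n a b c d e f \<and> cyc6 x n a b c d e f \<and>
        \<not> adj x n a d \<and> \<not> adj x n b e \<and> \<not> adj x n c f \<and>
        hue_of y n a \<noteq> 1 \<and> hue_of y n b \<noteq> 2 \<and> hue_of y n c \<noteq> 3 \<and>
        hue_of y n d \<noteq> 1 \<and> hue_of y n e \<noteq> 2 \<and> hue_of y n f \<noteq> 3)"
        unfolding six_iff using b by (intro exI[of _ w]) (simp add: hue)
    qed (use n valid_less in blast)+
    ultimately show "\<exists>y. length y \<le> 3 * length x \<and> certifies x y" by blast
  next
    assume "\<exists>y. length y \<le> 3 * length x \<and> certifies x y"
    then obtain y n and w :: "nat \<Rightarrow> nat" where n: "valid x n" and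
      proper: "\<And>u v. u < n \<Longrightarrow> v < n \<Longrightarrow> adj x n u v \<Longrightarrow> bit_at y u \<noteq> bit_at y v \<and> hue_of y n u \<noteq> hue_of y n v" and
      b: "\<forall>k < 6. w k < n" and
      w: "twos x n (w 0) (w 1) (w 2) (w 3) (w 4) (w 5)" "cyc6 x n (w 0) (w 1) (w 2) (w 3) (w 4) (w 5)"
        "\<not> adj x n (w 0) (w 3)" "\<not> adj x n (w 1) (w 4)" "\<not> adj x n (w 2) (w 5)" and
      hue: "hue_of y n (w 0) \<noteq> 1" "hue_of y n (w 1) \<noteq> 2" "hue_of y n (w 2) \<noteq> 3"
        "hue_of y n (w 3) \<noteq> 1" "hue_of y n (w 4) \<noteq> 2" "hue_of y n (w 5) \<noteq> 3"
      unfolding certifies_def six_iff by blast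
    have bip: "bipartition {..<n} (E_of x n) {v. v < n \<and> bit_at y v} {v. v < n \<and> \<not> bit_at y v}"
      using proper by (intro E_of_bipartition[OF n]) blast
    have img: "inj_on w {..<6}" "w ` {..<6} = {v. v < n \<and> \<not> thr x n v}" using w(1) twos_iff[OF b] by blast+
    have hex: "hexagon (E_of x n) w" using cyc6_iff[OF n b] w(2) img(1) by blast
    have chordless: "chordless (E_of x n) w" unfolding chordless_def E_of_iff[OF n] using w(3-5) by blast
    interpret hexagon_instance "{..<n}" "E_of x n" "f_of x n" "{v. v < n \<and> bit_at y v}" "{v. v < n \<and> \<not> bit_at y v}" w
      by (rule hexagon_instance.intro[OF instance_of[OF n] bip _ hex]) (simp add: two img(2))
    have "choosable {..<n} (E_of x n) (f_of x n) 3"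
    proof (rule coloring_imp_choosable[OF chordless])
      show "proper_coloring (E_of x n) (hue_of y n)"
        unfolding proper_coloring_def E_of_iff[OF n] using proper by blast
      show "\<forall>v \<in> {..<n}. hue_of y n v \<in> {1..3}" by (simp add: hue_of_def)
      show "\<forall>k < 6. hue_of y n (w k) \<noteq> Suc (k mod 3)" unfolding all_less_6 using hue by simp
    qed
    moreover have "card {v. v < n \<and> \<not> thr x n v} = 6" unfolding img(2)[symmetric] card_image[OF img(1)] by simp
    moreover have "induces_C6 (E_of x n) {v. v < n \<and> \<not> thr x n v}"
      using induces_C6_iff[OF bip loops[OF n]] img(2) hex chordless by blast
    moreover have "bipartite {..<n} (E_of x n)" using bip unfolding bipartite_def bipartition_def by blast
    ultimately show "x \<in> CH23_restricted C6_instance" unfolding r using n by blast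
  qed
qed

theorem in_NP_C6: "in_NP (CH23_restricted C6_instance)"
proof -
  obtain f where f: "\<And>c. fval (fst c) (snd c) [] f = certifies (fst c) (snd c)"
    using dfm_certifies unfolding dfm_def by blast
  have "ptime_decidable 2 {[x, y] | x y. (x, y) \<in> {(x, y). certifies x y}}"
  proof (rule ptime_decidable_fm[where f = f])
    fix ws :: "word list" assume "length ws = 2"
    then obtain x y where "ws = [x, y]" by (auto simp: numeral_2_eq_2 length_Suc_conv)
    then show "ws \<in> {[x, y] | x y. (x, y) \<in> {(x, y). certifies x y}} \<longleftrightarrow>
        fval (init_store ws 0) (init_store ws 1) [] f"
      using f[of "(x, y)"] by (simp add: init_store_def)
  qed simp
  moreover have "x \<in> CH23_restricted C6_instance \<longleftrightarrow>
      (\<exists>y. length y \<le> poly [:0, 3:] (length x) \<and> (x, y) \<in> {(x, y). certifies x y})" for x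
    using certifies_iff[of x] by (simp add: mult.commute)
  ultimately show ?thesis unfolding in_NP_def by blast
qed

section \<open>The polynomial case\<close>

text \<open>Bipartiteness without search: extend a partial 2-colouring \<open>C\<close> on the known vertices \<open>K\<close> to all
  neighbours of known vertices; if there are none, colour the least unknown vertex arbitrarily.
  A 2-colouring of the whole graph that agrees with \<open>C\<close> on \<open>K\<close> survives each round, because
  it may be flipped outside \<open>K\<close> when no edge leaves \<open>K\<close>.\<close>

definition frontier :: "nat \<Rightarrow> (nat \<Rightarrow> nat \<Rightarrow> bool) \<Rightarrow> (nat \<Rightarrow> bool) \<Rightarrow> bool" where
  "frontier n r K \<longleftrightarrow> (\<exists>u < n. \<exists>v < n. r u v \<and> K u \<and> \<not> K v)"

definition fresh :: "nat \<Rightarrow> (nat \<Rightarrow> nat \<Rightarrow> bool) \<Rightarrow> (nat \<Rightarrow> bool) \<Rightarrow> nat \<Rightarrow> bool" where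
  "fresh n r K v \<longleftrightarrow> \<not> K v \<and> (if frontier n r K then \<exists>u < n. r u v \<and> K u else \<forall>u < v. K u)"

text \<open>\<open>False\<close> is the default for a new vertex without known neighbours.\<close>

definition tint :: "nat \<Rightarrow> (nat \<Rightarrow> nat \<Rightarrow> bool) \<Rightarrow> (nat \<Rightarrow> bool) \<Rightarrow> (nat \<Rightarrow> bool) \<Rightarrow> nat \<Rightarrow> bool" where
  "tint n r K C v \<longleftrightarrow> (if K v then C v else \<exists>u < n. r u v \<and> K u \<and> \<not> C u)"

definition two_coloring :: "nat \<Rightarrow> (nat \<Rightarrow> nat \<Rightarrow> bool) \<Rightarrow> (nat \<Rightarrow> bool) \<Rightarrow> bool" where
  "two_coloring n r s \<longleftrightarrow> (\<forall>u < n. \<forall>v < n. r u v \<longrightarrow> s u \<noteq> s v)"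

definition extendable :: "nat \<Rightarrow> (nat \<Rightarrow> nat \<Rightarrow> bool) \<Rightarrow> (nat \<Rightarrow> bool) \<Rightarrow> (nat \<Rightarrow> bool) \<Rightarrow> bool" where
  "extendable n r K C \<longleftrightarrow> (\<exists>s. two_coloring n r s \<and> (\<forall>v < n. K v \<longrightarrow> C v = s v))"

lemma extendable_step:
  assumes sym: "\<And>u v. u < n \<Longrightarrow> v < n \<Longrightarrow> r u v \<Longrightarrow> r v u" and ext: "extendable n r K C"
  shows "extendable n r (\<lambda>v. K v \<or> fresh n r K v) (tint n r K C)"
proof -
  obtain s where s0: "two_coloring n r s" "\<forall>v < n. K v \<longrightarrow> C v = s v"
    using ext unfolding extendable_def by (elim exE conjE)
  have s: "u < n \<Longrightarrow> v < n \<Longrightarrow> r u v \<Longrightarrow> s u \<noteq> s v" "v < n \<Longrightarrow> K v \<Longrightarrow> C v = s v" for u v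
    using s0 by (simp_all add: two_coloring_def)
  show ?thesis
  proof (cases "frontier n r K")
    case True
    have "tint n r K C v = s v" if v: "v < n" "K v \<or> fresh n r K v" for v
    proof (cases "K v")
      case False
      then obtain u where u: "u < n" "r u v" "K u" using v(2) True by (auto simp: fresh_def)
      have nb: "C u' = (\<not> s v)" if "u' < n" "r u' v" "K u'" for u'
        using s(1)[OF that(1) v(1) that(2)] s(2)[OF that(1,3)] by blast
      show ?thesis using nb[OF u] nb u False unfolding tint_def by auto
    qed (use s(2) v in \<open>simp add: tint_def\<close>)
    then show ?thesis unfolding extendable_def using s0(1) by (intro exI[of _ s]) simp
  next
    case False
    \<comment> \<open>With symmetry of \<open>r\<close>, the known vertices now form a union of
      components.\<close>
    then have closed: "K u = K v" if "u < n" "v < n" "r u v" for u v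
      using that sym[OF that] unfolding frontier_def by blast
    define w where "w = (LEAST v. \<not> K v)"
    \<comment> \<open>Flips the colours outside \<open>K\<close> if necessary, so that the next
      vertex \<open>w\<close> has colour \<open>False\<close>, the default of
      \<open>tint\<close>.\<close>
    define s' where "s' v = (if K v then s v else s v \<noteq> s w)" for v
    have "two_coloring n r s'"
      unfolding two_coloring_def s'_def
    proof (intro allI impI)
      fix u v assume uv: "u < n" "v < n" "r u v"
      show "(if K u then s u else s u \<noteq> s w) \<noteq> (if K v then s v else s v \<noteq> s w)"
        using s(1)[OF uv] closed[OF uv] by (cases "K v") simp_all
    qed
    moreover have "tint n r K C v = s' v" if v: "v < n" "K v \<or> fresh n r K v" for v
    proof (cases "K v")
      case True
      then show ?thesis using s(2)[OF v(1)] by (simp add: tint_def s'_def)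
    next
      case nK: False
      then have "\<forall>u < v. K u" using v(2) False by (simp add: fresh_def)
      then have "w = v" unfolding w_def using nK by (intro Least_equality) (auto simp: not_less[symmetric])
      moreover have "\<not> tint n r K C v" using nK closed[OF _ v(1)] by (auto simp: tint_def)
      ultimately show ?thesis using nK by (simp add: s'_def)
    qed
    ultimately show ?thesis unfolding extendable_def by (intro exI[of _ s']) simp
  qed
qed

lemma fresh_exists:
  assumes "v < n" "\<not> K v"
  shows "\<exists>w < n. fresh n r K w"
proof (cases "frontier n r K")
  case True
  then show ?thesis unfolding frontier_def fresh_def by auto
next
  case False
  define w where "w = (LEAST v. \<not> K v)"
  have "\<not> K w" unfolding w_def using assms(2) by (rule LeastI)
  moreover have "w \<le> v" unfolding w_def using assms(2) by (rule Least_le)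
  moreover have "\<forall>u < w. K u" unfolding w_def using not_less_Least by blast
  ultimately show ?thesis using False assms(1) by (intro exI[of _ w]) (simp add: fresh_def)
qed

text \<open>The first \<open>n\<close> bits of \<open>y\<close> hold the known vertices and the next
  \<open>n\<close> their colours. The number \<open>n\<close> is recovered from the length of
  \<open>x\<close>, which \<open>size_inj\<close> shows to be unambiguous.\<close>

definition bip_round :: "word \<Rightarrow> word \<Rightarrow> nat \<Rightarrow> bool" where
  "bip_round x y i \<longleftrightarrow> (\<exists>n < length x. length x = Suc (2 * n + n * n) \<and>
    (i < n \<and> (bit_at y i \<or> fresh n (adj x n) (bit_at y) i) \<or>
     (\<exists>v < n. i = n + v \<and> tint n (adj x n) (bit_at y) (\<lambda>v. bit_at y (n + v)) v)))"

lemma dfm_bip_round: "dfm (\<lambda>c. fst (fst c)) (\<lambda>c. snd (fst c)) (\<lambda>c. [snd c])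
    (\<lambda>c. bip_round (fst (fst c)) (snd (fst c)) (snd c))"
  unfolding bip_round_def fresh_def frontier_def tint_def adj_def
  by (rule dintros)+

definition rounds :: "word \<Rightarrow> nat \<Rightarrow> word" where
  "rounds x k = ((\<lambda>y. map (bip_round x y) [0..<length x]) ^^ k) []"

definition two_colored :: "word \<Rightarrow> nat \<Rightarrow> word \<Rightarrow> bool" where
  "two_colored x n y \<longleftrightarrow> (\<forall>u < n. \<forall>v < n. adj x n u v \<longrightarrow> bit_at y (n + u) \<noteq> bit_at y (n + v))"

lemma size_inj: "Suc (2 * n + n * n) = Suc (2 * m + m * m) \<longleftrightarrow> n = m"
proof
  assume *: "Suc (2 * n + n * n) = Suc (2 * m + m * m)"
  have "a < b \<Longrightarrow> 2 * a + a * a < 2 * b + b * b" for a b :: nat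
    by (intro add_less_le_mono mult_le_mono) simp_all
  from this[of n m] this[of m n] * show "n = m" by (cases n m rule: linorder_cases) simp_all
qed simp

lemma rounds_Suc:
  assumes "valid x n" "v < n"
  shows "bit_at (rounds x (Suc k)) v \<longleftrightarrow>
      bit_at (rounds x k) v \<or> fresh n (adj x n) (bit_at (rounds x k)) v"
    "bit_at (rounds x (Suc k)) (n + v) \<longleftrightarrow>
      tint n (adj x n) (bit_at (rounds x k)) (\<lambda>v. bit_at (rounds x k) (n + v)) v"
proof -
  have len: "length x = Suc (2 * n + n * n)" using assms(1) by (simp add: valid_def)
  have r: "bip_round x y i \<longleftrightarrow> i < n \<and> (bit_at y i \<or> fresh n (adj x n) (bit_at y) i) \<or>
     (\<exists>v < n. i = n + v \<and> tint n (adj x n) (bit_at y) (\<lambda>v. bit_at y (n + v)) v)" for y i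
    unfolding bip_round_def len size_inj by auto
  have S: "bit_at (rounds x (Suc k)) i \<longleftrightarrow> i < length x \<and> bip_round x (rounds x k) i" for i
    by (simp add: rounds_def bit_at_map)
  show "bit_at (rounds x (Suc k)) v \<longleftrightarrow>
      bit_at (rounds x k) v \<or> fresh n (adj x n) (bit_at (rounds x k)) v"
    "bit_at (rounds x (Suc k)) (n + v) \<longleftrightarrow>
      tint n (adj x n) (bit_at (rounds x k)) (\<lambda>v. bit_at (rounds x k) (n + v)) v"
    unfolding S r using assms(2) len by auto
qed

text \<open>Every round adds a vertex as long as one is unknown; since \<open>n < length x\<close>
  for valid words, \<open>length x\<close> rounds reach all vertices.\<close>

lemma rounds_card:
  assumes "valid x n"
  shows "min n k \<le> card {v. v < n \<and> bit_at (rounds x k) v}"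
proof (induction k)
  case (Suc k)
  let ?K = "{v. v < n \<and> bit_at (rounds x k) v}" and ?K' = "{v. v < n \<and> bit_at (rounds x (Suc k)) v}"
  have sub: "?K \<subseteq> ?K'" using rounds_Suc(1)[OF assms] by blast
  show ?case
  proof (cases "\<exists>v < n. \<not> bit_at (rounds x k) v")
    case True
    then obtain w where "w < n" "fresh n (adj x n) (bit_at (rounds x k)) w" using fresh_exists by blast
    then have "w \<in> ?K'" "w \<notin> ?K" using rounds_Suc(1)[OF assms] by (auto simp: fresh_def)
    then have "?K \<subset> ?K'" using sub by blast
    then have "card ?K < card ?K'" by (intro psubset_card_mono) simp_all
    then show ?thesis using Suc.IH by simp
  next
    case False
    then have "?K' = {..<n}" using sub by auto
    then show ?thesis by simp
  qed
qed simp

text \<open>For a bipartite graph the computed colours agree with some 2-colouring on the known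
  vertices, which finally are all vertices. The converse is immediate, since the final test checks
  the colouring.\<close>

lemma bipartite_rounds:
  assumes "valid x n"
  shows "bipartite {..<n} (E_of x n) \<longleftrightarrow> two_colored x n (rounds x (length x))"
proof
  assume "bipartite {..<n} (E_of x n)"
  then have start: "extendable n (adj x n) (bit_at (rounds x 0)) (\<lambda>v. bit_at (rounds x 0) (n + v))"
    unfolding bipartite_E_of_iff[OF assms] extendable_def two_coloring_def
    by (simp add: rounds_def bit_at_def)
  have sym: "adj x n v u" if "u < n" "v < n" "adj x n u v" for u v
    using assms that unfolding valid_def by blast
  have "extendable n (adj x n) (bit_at (rounds x k)) (\<lambda>v. bit_at (rounds x k) (n + v))" for k
  proof (induction k)
    case (Suc k)
    have "extendable n (adj x n) (\<lambda>v. bit_at (rounds x k) v \<or> fresh n (adj x n) (bit_at (rounds x k)) v)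
        (tint n (adj x n) (bit_at (rounds x k)) (\<lambda>v. bit_at (rounds x k) (n + v)))"
      by (rule extendable_step[OF _ Suc.IH]) (rule sym)
    then show ?case unfolding extendable_def by (simp add: rounds_Suc[OF assms])
  qed (rule start)
  from this[of "length x"]
  obtain s where s: "two_coloring n (adj x n) s"
    "\<forall>v < n. bit_at (rounds x (length x)) v \<longrightarrow> bit_at (rounds x (length x)) (n + v) = s v"
    unfolding extendable_def by (elim exE conjE)
  have "n \<le> card {v. v < n \<and> bit_at (rounds x (length x)) v}"
    using rounds_card[OF assms, of "length x"] valid_less[OF assms] by simp
  then have "{v. v < n \<and> bit_at (rounds x (length x)) v} = {..<n}"
    by (intro card_seteq subsetI) simp_all
  then have "v \<in> {v. v < n \<and> bit_at (rounds x (length x)) v}" if "v < n" for v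
    using that by (simp only: lessThan_iff)
  then have known: "bit_at (rounds x (length x)) v" if "v < n" for v
    using that by blast
  show "two_colored x n (rounds x (length x))"
    unfolding two_colored_def
  proof (intro allI impI)
    fix u v assume uv: "u < n" "v < n" "adj x n u v"
    have "s u \<noteq> s v" using s(1)[unfolded two_coloring_def, rule_format, OF uv] .
    then show "bit_at (rounds x (length x)) (n + u) \<noteq> bit_at (rounds x (length x)) (n + v)"
      unfolding s(2)[rule_format, OF uv(1) known[OF uv(1)]] s(2)[rule_format, OF uv(2) known[OF uv(2)]] .
  qed
next
  assume "two_colored x n (rounds x (length x))"
  then show "bipartite {..<n} (E_of x n)"
    unfolding bipartite_E_of_iff[OF assms] two_colored_def
    by (intro exI[of _ "\<lambda>v. bit_at (rounds x (length x)) (n + v)"])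
qed

section \<open>The polynomial decision procedure\<close>

definition nonC6_instance :: "nat set \<Rightarrow> nat set set \<Rightarrow> (nat \<Rightarrow> nat) \<Rightarrow> bool" where
  "nonC6_instance V E f \<longleftrightarrow> bipartite V E \<and> card (two_list_vertices V f) = 6 \<and>
    \<not> induces_C6 E (two_list_vertices V f)"

text \<open>Choosability does not occur: by \<open>choosable_not_C6_iff\<close>, being choosable
  without inducing a \<open>C_6\<close> means that no hexagon spans the vertices with
  2-lists.\<close>

definition accepted :: "word \<Rightarrow> word \<Rightarrow> bool" where
  "accepted x y \<longleftrightarrow> (\<exists>n < length x. valid x n \<and> two_colored x n y \<and> six n (twos x n) \<and>
    \<not> six n (\<lambda>a b c d e f. twos x n a b c d e f \<and> cyc6 x n a b c d e f))"

lemma dfm_accepted: "dfm (\<lambda>c. fst c) (\<lambda>c. snd c) (\<lambda>c. []) (\<lambda>c. accepted (fst c) (snd c))"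
  unfolding accepted_def two_colored_def valid_def adj_def thr_def six_def twos_def cyc6_def dist6_def
  by (rule dintros)+

lemma accepted_iff: "x \<in> CH23_restricted nonC6_instance \<longleftrightarrow> accepted x (rounds x (length x))"
proof -
  have C: "nonC6_instance = (\<lambda>V E f. (\<lambda>V E S. bipartite V E \<and> card S = 6 \<and> \<not> induces_C6 E S) V E (two_list_vertices V f))"
    by (simp add: nonC6_instance_def fun_eq_iff)
  have two: "two_list_vertices {..<n} (f_of x n) = {v. v < n \<and> \<not> thr x n v}" for n
    by (auto simp: two_list_vertices_def f_of_def)
  have "bipartite {..<n} (E_of x n) \<and> card {v. v < n \<and> \<not> thr x n v} = 6 \<and>
      \<not> induces_C6 (E_of x n) {v. v < n \<and> \<not> thr x n v} \<and> choosable {..<n} (E_of x n) (f_of x n) 3 \<longleftrightarrow>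
    two_colored x n (rounds x (length x)) \<and> six n (twos x n) \<and>
      \<not> six n (\<lambda>a b c d e f. twos x n a b c d e f \<and> cyc6 x n a b c d e f)" (is "?l \<longleftrightarrow> ?r")
    if n: "valid x n" for n
  proof -
    have "?l \<longleftrightarrow> bipartite {..<n} (E_of x n) \<and> card {v. v < n \<and> \<not> thr x n v} = 6 \<and>
      \<not> (\<exists>w. w ` {..<6} = {v. v < n \<and> \<not> thr x n v} \<and> hexagon (E_of x n) w)"
    proof (cases "bipartite {..<n} (E_of x n) \<and> card {v. v < n \<and> \<not> thr x n v} = 6")
      case True
      then obtain A B where "bipartition {..<n} (E_of x n) A B"
        unfolding bipartite_def bipartition_def by blast
      from choosable_not_C6_iff[OF instance_of[OF n] this] show ?thesis unfolding two using True by blast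
    qed blast
    then show ?thesis unfolding bipartite_rounds[OF n] card_twos_iff hexagon_twos_iff[OF n] .
  qed
  then show ?thesis
    using restricted_iff[of x "\<lambda>V E S. bipartite V E \<and> card S = 6 \<and> \<not> induces_C6 E S", folded C]
    unfolding accepted_def using valid_less by blast
qed

theorem in_P_nonC6: "in_P (CH23_restricted nonC6_instance)"
proof -
  obtain f where f: "\<And>c. fval (fst (fst c)) (snd (fst c)) [snd c] f = bip_round (fst (fst c)) (snd (fst c)) (snd c)"
    using dfm_bip_round unfolding dfm_def by blast
  obtain g where g: "\<And>c. fval (fst c) (snd c) [] g = accepted (fst c) (snd c)"
    using dfm_accepted unfolding dfm_def by blast
  have "table x y (TLen False) f = map (bip_round x y) [0..<length x]" for x y
    using f[of "((x, y), _)"] by (simp add: table_def wsel_def)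
  then have "iterate f x k = rounds x k" for x k by (simp add: iterate_def rounds_def)
  then show ?thesis
    unfolding in_P_def using accepted_iff g[of "(_, _)"]
    by (intro ptime_decidable_iterate[where f = f and g = g]) simp
qed

theorem proposition4p2:
  shows "NP_complete (CH23_restricted (\<lambda>V E f. bipartite V E \<and>
           card (two_list_vertices V f) = 6 \<and> induces_C6 E (two_list_vertices V f)))
       \<and> in_P (CH23_restricted (\<lambda>V E f. bipartite V E \<and>
           card (two_list_vertices V f) = 6 \<and> \<not> induces_C6 E (two_list_vertices V f)))
       \<and> (\<forall>(V :: 'a set) E f. CH23_instance V E f \<and> bipartite V E \<and>
           card (two_list_vertices V f) \<le> 5 \<longrightarrow> choosable V E f 3)"
proof (intro conjI allI impI)
  have "C6_instance = (\<lambda>V E f. bipartite V E \<and>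
      card (two_list_vertices V f) = 6 \<and> induces_C6 E (two_list_vertices V f))"
    by (simp add: C6_instance_def fun_eq_iff)
  then show "NP_complete (CH23_restricted (\<lambda>V E f. bipartite V E \<and>
      card (two_list_vertices V f) = 6 \<and> induces_C6 E (two_list_vertices V f)))"
    using in_NP_C6 NP_hard_C6 by (simp add: NP_complete_def)
  have "nonC6_instance = (\<lambda>V E f. bipartite V E \<and>
      card (two_list_vertices V f) = 6 \<and> \<not> induces_C6 E (two_list_vertices V f))"
    by (simp add: nonC6_instance_def fun_eq_iff)
  then show "in_P (CH23_restricted (\<lambda>V E f. bipartite V E \<and>
      card (two_list_vertices V f) = 6 \<and> \<not> induces_C6 E (two_list_vertices V f)))"
    using in_P_nonC6 by simp
next
  fix V :: "'a set" and E f
  assume "CH23_instance V E f \<and> bipartite V E \<and> card (two_list_vertices V f) \<le> 5"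
  then show "choosable V E f 3" by (blast intro: choosable_few)
qed

end
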